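(* Let $G$ be a residually finite group, let $(G_n)$ be a sofic chain of finite-index subgroups, let $\Sigma=(\sigma_n:G\to\mathrm{Sym}(G_n\backslash G))$ be the associated sofic approximation, and let $\mathbb{K}$ be a finite field. Let $G$ act freely and cocompactly by simplicial automorphisms on a simplicial complex $L$, let $\delta^i:C^{i-1}(L,\mathbb{K})\to C^i(L,\mathbb{K})$ be the coboundary map, and let $\delta^i_n:C^{i-1}(G_n\backslash L,\mathbb{K})\to C^i(G_n\backslash L,\mathbb{K})$ denote the quotient coboundary map. Let $p\ge1$ and assume that $\frac1{|G:G_n|}\log|\ker(\delta^p_n)|$ converges as $n\to\infty$. Then $$h^\Sigma_{\mathrm{top}}(G\curvearrowright C^{p-1}(L,\mathbb{K}))+\limsup_{n\to\infty}\frac{\dim_{\mathbb{K}}H^p(G_n\backslash L,\mathbb{K})}{|G:G_n|}\cdot\log|\mathbb{K}|=h^\Sigma_{\mathrm{top}}(G\curvearrowright\ker(\delta^p))+h^\Sigma_{\mathrm{top}}(G\curvearrowright\ker(\delta^{p+1})).$$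
   Context: Sofic chain: a decreasing sequence $(G_n)$ of finite-index (not necessarily normal) subgroups of a countable group $G$ such that for every $g\ne1_G$, $\lim_{n\to\infty}|\{G_nu:u\in G,\ g\in u^{-1}G_nu\}|/[G:G_n]=0$. The associated sofic approximation is $\Sigma=(\sigma_n)$ with $D_n=G_n\backslash G=\{G_nu:u\in G\}$ and $\sigma_n(g)(G_nu)=G_nug^{-1}$. (In general, a sofic approximation is a sequence of maps $\sigma_n:G\to\mathrm{Sym}(D_n)$ with $D_n$ finite that is asymptotically free and asymptotically an action.) Cochains: $C^i(L,\mathbb{K})$ is the group of all simplicial $i$-cochains of $L$ with coefficients in $\mathbb{K}$, with the topology of pointwise convergence ($\mathbb{K}$ discrete) and the natural $G$-action. The action on $L$ is free on the geometric realization. $G_n\backslash L$ has the quotient cell structure, so $C^i(G_n\backslash L,\mathbb{K})$ is identified with the $G_n$-invariant elements of $C^i(L,\mathbb{K})$ and $\delta^i_n$ with the restriction of $\delta^i$; $H^p(G_n\backslash L,\mathbb{K})=\ker(\delta_n^{p+1})/\mathrm{Im}(\delta_n^p)$. Topological sofic entropy: Let $G\curvearrowright X$ be a continuous action on a compact metrizable space. Let $\rho$ be a continuous pseudo-metric on $X$ that is generating (for $x\ne y$ there is $g\in G$ with $\rho(g\cdot x,g\cdot y)>0$). For $\phi,\phi':D_n\to X$ let $\rho_2(\phi,\phi')=\bigl(\frac1{|D_n|}\sum_{i}\rho(\phi(i),\phi'(i))^2\bigr)^{1/2}$ and $\rho_\infty(\phi,\phi')=\max_i\rho(\phi(i),\phi'(i))$.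 For finite $F\subseteq G$, $\delta>0$ let $\mathrm{Map}(\rho,F,\delta,\sigma_n)=\{\phi:D_n\to X:\rho_2(\phi\circ\sigma_n(f),f\cdot\phi)<\delta\ \forall f\in F\}$, and let $N_\kappa(\cdot,\rho_\infty)$ be the maximum cardinality of a subset whose distinct elements satisfy $\rho_\infty(\phi,\phi')\ge\kappa$. Then $$h^\Sigma_{\mathrm{top}}(G\curvearrowright X)=\sup_{\kappa>0}\inf_{\delta>0}\inf_{F}\limsup_{n\to\infty}\frac1{|D_n|}\log N_\kappa(\mathrm{Map}(\rho,F,\delta,\sigma_n),\rho_\infty)$$ ($F$ ranging over finite subsets of $G$, $\log 0=-\infty$); this is independent of $\rho$. *)

theory Defs
  imports
    "HOL-Analysis.Analysis"
    "HOL-Algebra.AbelCoset"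
    "HOL-Algebra.Group_Action"
    "HOL-Combinatorics.Permutations"
    "Jordan_Normal_Form.VS_Connect"
begin

section \<open>Residually finite groups and sofic chains\<close>

definition residually_finite :: "('g, 'm) monoid_scheme \<Rightarrow> bool" where
  "residually_finite G \<longleftrightarrow>
     (\<forall>g \<in> carrier G - {\<one>\<^bsub>G\<^esub>}. \<exists>N. N \<lhd> G \<and> finite (carrier (G Mod N)) \<and> g \<notin> N)"

text \<open>The coset space \<open>G\<^sub>n \ G\<close> is \<open>rcosets\<^bsub>G\<^esub> (\<Gamma> n)\<close>, whose elements are
  \<open>\<Gamma> n #>\<^bsub>G\<^esub> u\<close>; its cardinality is the index of \<open>\<Gamma> n\<close>.\<close>

definition sofic_chain :: "('g, 'm) monoid_scheme \<Rightarrow> (nat \<Rightarrow> 'g set) \<Rightarrow> bool" where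
  "sofic_chain G \<Gamma> \<longleftrightarrow>
     group G \<and> countable (carrier G) \<and>
     (\<forall>n. subgroup (\<Gamma> n) G \<and> finite (rcosets\<^bsub>G\<^esub> (\<Gamma> n)) \<and> \<Gamma> (Suc n) \<subseteq> \<Gamma> n) \<and>
     (\<forall>g \<in> carrier G - {\<one>\<^bsub>G\<^esub>}.
        (\<lambda>n. real (card {\<Gamma> n #>\<^bsub>G\<^esub> u | u. u \<in> carrier G \<and>
                                g \<in> (inv\<^bsub>G\<^esub> u <#\<^bsub>G\<^esub> \<Gamma> n) #>\<^bsub>G\<^esub> u})
             / real (card (rcosets\<^bsub>G\<^esub> (\<Gamma> n)))) \<longlonglongrightarrow> 0)"

definition coset_space :: "('g, 'm) monoid_scheme \<Rightarrow> (nat \<Rightarrow> 'g set) \<Rightarrow> nat \<Rightarrow> 'g set set" where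
  "coset_space G \<Gamma> n = rcosets\<^bsub>G\<^esub> (\<Gamma> n)"

definition chain_approximation ::
    "('g, 'm) monoid_scheme \<Rightarrow> (nat \<Rightarrow> 'g set) \<Rightarrow> nat \<Rightarrow> 'g \<Rightarrow> 'g set \<Rightarrow> 'g set" where
  "chain_approximation G \<Gamma> n g = (\<lambda>C \<in> coset_space G \<Gamma> n. C #>\<^bsub>G\<^esub> inv\<^bsub>G\<^esub> g)"


section \<open>Topological sofic entropy\<close>

text \<open>The entropy is defined relative to a generating continuous pseudo-metric \<open>\<rho>\<close>;
  its value does not depend on \<open>\<rho>\<close>.\<close>

definition generating_pseudometric ::
    "('g, 'm) monoid_scheme \<Rightarrow> 'x topology \<Rightarrow> ('g \<Rightarrow> 'x \<Rightarrow> 'x) \<Rightarrow> ('x \<Rightarrow> 'x \<Rightarrow> real) \<Rightarrow> bool" where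
  "generating_pseudometric G X \<alpha> \<rho> \<longleftrightarrow>
     (\<forall>x \<in> topspace X. \<rho> x x = 0) \<and>
     (\<forall>x \<in> topspace X. \<forall>y \<in> topspace X. 0 \<le> \<rho> x y \<and> \<rho> x y = \<rho> y x) \<and>
     (\<forall>x \<in> topspace X. \<forall>y \<in> topspace X. \<forall>z \<in> topspace X. \<rho> x z \<le> \<rho> x y + \<rho> y z) \<and>
     continuous_map (prod_topology X X) euclideanreal (\<lambda>(x, y). \<rho> x y) \<and>
     (\<forall>x \<in> topspace X. \<forall>y \<in> topspace X. x \<noteq> y \<longrightarrow> (\<exists>g \<in> carrier G. \<rho> (\<alpha> g x) (\<alpha> g y) > 0))"

definition dist_2 ::
    "('x \<Rightarrow> 'x \<Rightarrow> real) \<Rightarrow> 'd set \<Rightarrow> ('d \<Rightarrow> 'x) \<Rightarrow> ('d \<Rightarrow> 'x) \<Rightarrow> real" where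
  "dist_2 \<rho> D \<phi> \<psi> = sqrt ((\<Sum>d\<in>D. (\<rho> (\<phi> d) (\<psi> d))\<^sup>2) / real (card D))"

definition dist_inf ::
    "('x \<Rightarrow> 'x \<Rightarrow> real) \<Rightarrow> 'd set \<Rightarrow> ('d \<Rightarrow> 'x) \<Rightarrow> ('d \<Rightarrow> 'x) \<Rightarrow> real" where
  "dist_inf \<rho> D \<phi> \<psi> = Max ((\<lambda>d. \<rho> (\<phi> d) (\<psi> d)) ` D)"

definition approx_maps ::
    "'x topology \<Rightarrow> ('g \<Rightarrow> 'x \<Rightarrow> 'x) \<Rightarrow> ('x \<Rightarrow> 'x \<Rightarrow> real) \<Rightarrow> 'g set \<Rightarrow> real \<Rightarrow>
     'd set \<Rightarrow> ('g \<Rightarrow> 'd \<Rightarrow> 'd) \<Rightarrow> ('d \<Rightarrow> 'x) set" where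
  "approx_maps X \<alpha> \<rho> F \<delta> D s =
     {\<phi> \<in> D \<rightarrow>\<^sub>E topspace X. \<forall>f\<in>F. dist_2 \<rho> D (\<lambda>d. \<phi> (s f d)) (\<lambda>d. \<alpha> f (\<phi> d)) < \<delta>}"

definition separation_number :: "real \<Rightarrow> 'a set \<Rightarrow> ('a \<Rightarrow> 'a \<Rightarrow> real) \<Rightarrow> enat" where
  "separation_number \<kappa> S d =
     (SUP A \<in> {A. A \<subseteq> S \<and> finite A \<and> (\<forall>\<phi>\<in>A. \<forall>\<psi>\<in>A. \<phi> \<noteq> \<psi> \<longrightarrow> \<kappa> \<le> d \<phi> \<psi>)}. enat (card A))"

definition log_enat :: "enat \<Rightarrow> ereal" where
  "log_enat N = (case N of enat k \<Rightarrow> if k = 0 then - \<infinity> else ereal (ln (real k)) | \<infinity> \<Rightarrow> \<infinity>)"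

definition sofic_entropy ::
    "('g, 'm) monoid_scheme \<Rightarrow> (nat \<Rightarrow> 'd set) \<Rightarrow> (nat \<Rightarrow> 'g \<Rightarrow> 'd \<Rightarrow> 'd) \<Rightarrow>
     'x topology \<Rightarrow> ('g \<Rightarrow> 'x \<Rightarrow> 'x) \<Rightarrow> ('x \<Rightarrow> 'x \<Rightarrow> real) \<Rightarrow> ereal" where
  "sofic_entropy G D \<sigma> X \<alpha> \<rho> =
     (SUP \<kappa> \<in> {0<..}. INF \<delta> \<in> {0<..}. INF F \<in> {F. finite F \<and> F \<subseteq> carrier G}.
        limsup (\<lambda>n. log_enat (separation_number \<kappa> (approx_maps X \<alpha> \<rho> F \<delta> (D n) (\<sigma> n))
                                (dist_inf \<rho> (D n)))
                    / ereal (real (card (D n)))))"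


section \<open>Simplicial complexes and their geometric realizations\<close>

definition abstract_simplicial_complex :: "'v set set \<Rightarrow> bool" where
  "abstract_simplicial_complex L \<longleftrightarrow>
     (\<forall>s\<in>L. finite s \<and> s \<noteq> {}) \<and> (\<forall>s\<in>L. \<forall>t. t \<subseteq> s \<and> t \<noteq> {} \<longrightarrow> t \<in> L)"

text \<open>The action is given on the vertex set \<open>\<Union>L\<close>. The inverse of \<open>a g\<close> is \<open>a (inv g)\<close>, so
  preservation of \<open>L\<close> makes each \<open>a g\<close> a simplicial automorphism.\<close>

definition simplicial_action ::
    "('g, 'm) monoid_scheme \<Rightarrow> 'v set set \<Rightarrow> ('g \<Rightarrow> 'v \<Rightarrow> 'v) \<Rightarrow> bool" where
  "simplicial_action G L a \<longleftrightarrow>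
     group_action G (\<Union>L) a \<and> (\<forall>g \<in> carrier G. \<forall>s\<in>L. a g ` s \<in> L)"

text \<open>Points of the realization are given by barycentric coordinates.\<close>

definition realization :: "'v set set \<Rightarrow> ('v \<Rightarrow> real) set" where
  "realization L =
     {t. (\<forall>v. 0 \<le> t v) \<and> {v. t v \<noteq> 0} \<in> L \<and> (\<Sum>v | t v \<noteq> 0. t v) = 1}"

definition closed_cell :: "'v set set \<Rightarrow> 'v set \<Rightarrow> ('v \<Rightarrow> real) set" where
  "closed_cell L s = {t \<in> realization L. {v. t v \<noteq> 0} \<subseteq> s}"

text \<open>The weak topology. On a closed cell, the product topology of \<open>'v \<Rightarrow> real\<close> induces the
  Euclidean topology, since only finitely many coordinates are non-zero.\<close>

definition realization_topology :: "'v set set \<Rightarrow> ('v \<Rightarrow> real) topology" where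
  "realization_topology L =
     topology (\<lambda>U. U \<subseteq> realization L \<and>
       (\<forall>s\<in>L. openin (top_of_set (closed_cell L s)) (U \<inter> closed_cell L s)))"

lemma openin_realization_topology:
  "openin (realization_topology L) U \<longleftrightarrow>
     U \<subseteq> realization L \<and> (\<forall>s\<in>L. openin (top_of_set (closed_cell L s)) (U \<inter> closed_cell L s))"
proof -
  have "istopology (\<lambda>U. U \<subseteq> realization L \<and>
       (\<forall>s\<in>L. openin (top_of_set (closed_cell L s)) (U \<inter> closed_cell L s)))"
    unfolding istopology_def
  proof (intro conjI allI impI ballI; (elim conjE)?)
    fix S T s
    assume "\<forall>s\<in>L. openin (top_of_set (closed_cell L s)) (S \<inter> closed_cell L s)"
      and "\<forall>s\<in>L. openin (top_of_set (closed_cell L s)) (T \<inter> closed_cell L s)" and "s \<in> L"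
    then have "openin (top_of_set (closed_cell L s)) (S \<inter> closed_cell L s)"
      and "openin (top_of_set (closed_cell L s)) (T \<inter> closed_cell L s)"
      by blast+
    then have "openin (top_of_set (closed_cell L s))
        ((S \<inter> closed_cell L s) \<inter> (T \<inter> closed_cell L s))"
      by (rule openin_Int)
    moreover have "(S \<inter> closed_cell L s) \<inter> (T \<inter> closed_cell L s) = S \<inter> T \<inter> closed_cell L s"
      by blast
    ultimately show "openin (top_of_set (closed_cell L s)) (S \<inter> T \<inter> closed_cell L s)"
      by simp
  next
    fix \<K> s
    assume "\<forall>K\<in>\<K>. K \<subseteq> realization L \<and>
       (\<forall>s\<in>L. openin (top_of_set (closed_cell L s)) (K \<inter> closed_cell L s))" and "s \<in> L"
    then have "openin (top_of_set (closed_cell L s)) (\<Union>K\<in>\<K>. K \<inter> closed_cell L s)"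
      by (intro openin_Union) auto
    then show "openin (top_of_set (closed_cell L s)) (\<Union>\<K> \<inter> closed_cell L s)"
      by (simp only: Int_Union2)
  qed auto
  then show ?thesis
    unfolding realization_topology_def by simp
qed

definition realization_action ::
    "('g, 'm) monoid_scheme \<Rightarrow> 'v set set \<Rightarrow> ('g \<Rightarrow> 'v \<Rightarrow> 'v) \<Rightarrow> 'g \<Rightarrow> ('v \<Rightarrow> real) \<Rightarrow> ('v \<Rightarrow> real)"
  where
  "realization_action G L a g t = (\<lambda>v. if v \<in> \<Union>L then t (a (inv\<^bsub>G\<^esub> g) v) else 0)"

definition free_action ::
    "('g, 'm) monoid_scheme \<Rightarrow> 'v set set \<Rightarrow> ('g \<Rightarrow> 'v \<Rightarrow> 'v) \<Rightarrow> bool" where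
  "free_action G L a \<longleftrightarrow>
     (\<forall>g \<in> carrier G. \<forall>t \<in> realization L. realization_action G L a g t = t \<longrightarrow> g = \<one>\<^bsub>G\<^esub>)"

definition quotient_topology :: "'x topology \<Rightarrow> ('x \<Rightarrow> 'y) \<Rightarrow> 'y topology" where
  "quotient_topology X q =
     topology (\<lambda>W. W \<subseteq> q ` topspace X \<and> openin X {x \<in> topspace X. q x \<in> W})"

lemma openin_quotient_topology:
  "openin (quotient_topology X q) W \<longleftrightarrow>
     W \<subseteq> q ` topspace X \<and> openin X {x \<in> topspace X. q x \<in> W}"
proof -
  have "istopology (\<lambda>W. W \<subseteq> q ` topspace X \<and> openin X {x \<in> topspace X. q x \<in> W})"
    unfolding istopology_def
  proof (intro conjI allI impI; (elim conjE)?)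
    fix S T
    assume "openin X {x \<in> topspace X. q x \<in> S}" "openin X {x \<in> topspace X. q x \<in> T}"
    then have "openin X ({x \<in> topspace X. q x \<in> S} \<inter> {x \<in> topspace X. q x \<in> T})"
      by (rule openin_Int)
    moreover have "{x \<in> topspace X. q x \<in> S} \<inter> {x \<in> topspace X. q x \<in> T} =
        {x \<in> topspace X. q x \<in> S \<inter> T}" by auto
    ultimately show "openin X {x \<in> topspace X. q x \<in> S \<inter> T}" by simp
  next
    fix \<K>
    assume "\<forall>K\<in>\<K>. K \<subseteq> q ` topspace X \<and> openin X {x \<in> topspace X. q x \<in> K}"
    then have "openin X (\<Union>K\<in>\<K>. {x \<in> topspace X. q x \<in> K})"
      by (intro openin_Union) auto
    moreover have "(\<Union>K\<in>\<K>. {x \<in> topspace X. q x \<in> K}) = {x \<in> topspace X. q x \<in> \<Union>\<K>}"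
      by auto
    ultimately show "openin X {x \<in> topspace X. q x \<in> \<Union>\<K>}" by simp
  qed auto
  then show ?thesis
    unfolding quotient_topology_def by simp
qed

lemma quotient_map_quotient_topology: "quotient_map X (quotient_topology X q) q"
proof -
  have "openin (quotient_topology X q) (q ` topspace X)"
    unfolding openin_quotient_topology by (simp cong: conj_cong)
  then have "q ` topspace X \<subseteq> topspace (quotient_topology X q)"
    by (rule openin_subset)
  moreover have "topspace (quotient_topology X q) \<subseteq> q ` topspace X"
    using openin_topspace[of "quotient_topology X q"] by (simp only: openin_quotient_topology)
  ultimately have "topspace (quotient_topology X q) = q ` topspace X"
    by (rule subset_antisym[rotated])
  then show ?thesis
    unfolding quotient_map_def by (simp add: openin_quotient_topology)
qed

definition cocompact_action ::
    "('g, 'm) monoid_scheme \<Rightarrow> 'v set set \<Rightarrow> ('g \<Rightarrow> 'v \<Rightarrow> 'v) \<Rightarrow> bool" where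
  "cocompact_action G L a \<longleftrightarrow>
     compact_space (quotient_topology (realization_topology L)
       (Group_Action.orbit G (realization_action G L a)))"


section \<open>Simplicial cochains\<close>

definition ordered_simplices :: "'v set set \<Rightarrow> nat \<Rightarrow> 'v list set" where
  "ordered_simplices L i = {vs. distinct vs \<and> length vs = Suc i \<and> set vs \<in> L}"

text \<open>Cochains are alternating functions of ordered simplices, which avoids choosing orientations;
  they are extended by zero to all other lists of vertices.\<close>

definition cochains :: "'v set set \<Rightarrow> nat \<Rightarrow> ('v list \<Rightarrow> 'k :: field) set" where
  "cochains L i =
     {c. (\<forall>vs. vs \<notin> ordered_simplices L i \<longrightarrow> c vs = 0) \<and>
         (\<forall>vs \<in> ordered_simplices L i. \<forall>\<pi>. \<pi> permutes {..<length vs} \<longrightarrow>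
            c (permute_list \<pi> vs) = of_int (sign \<pi>) * c vs)}"

text \<open>\<open>coboundary L i\<close> is the map from \<open>(i - 1)\<close>-cochains to \<open>i\<close>-cochains, for \<open>i \<ge> 1\<close>.\<close>

definition coboundary ::
    "'v set set \<Rightarrow> nat \<Rightarrow> ('v list \<Rightarrow> 'k :: field) \<Rightarrow> ('v list \<Rightarrow> 'k)" where
  "coboundary L i c =
     (\<lambda>vs. if vs \<in> ordered_simplices L i
           then (\<Sum>j\<le>i. (-1) ^ j * c (take j vs @ drop (Suc j) vs)) else 0)"

definition coboundary_kernel :: "'v set set \<Rightarrow> nat \<Rightarrow> ('v list \<Rightarrow> 'k :: field) set" where
  "coboundary_kernel L i = {c \<in> cochains L (i - 1). coboundary L i c = (\<lambda>_. 0)}"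

definition cochain_action ::
    "('g, 'm) monoid_scheme \<Rightarrow> 'v set set \<Rightarrow> ('g \<Rightarrow> 'v \<Rightarrow> 'v) \<Rightarrow>
     'g \<Rightarrow> ('v list \<Rightarrow> 'k :: field) \<Rightarrow> ('v list \<Rightarrow> 'k)" where
  "cochain_action G L a g c = (\<lambda>vs. if set vs \<in> L then c (map (a (inv\<^bsub>G\<^esub> g)) vs) else 0)"

definition pointwise_topology :: "('v list \<Rightarrow> 'k) set \<Rightarrow> ('v list \<Rightarrow> 'k) topology" where
  "pointwise_topology S = subtopology (product_topology (\<lambda>_. discrete_topology UNIV) UNIV) S"

text \<open>Cochains of the quotient \<open>H \ L\<close> are the \<open>H\<close>-invariant cochains of \<open>L\<close>, with the
  restricted coboundary maps.\<close>

definition quotient_cochains ::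
    "('g, 'm) monoid_scheme \<Rightarrow> 'v set set \<Rightarrow> ('g \<Rightarrow> 'v \<Rightarrow> 'v) \<Rightarrow> 'g set \<Rightarrow> nat \<Rightarrow>
     ('v list \<Rightarrow> 'k :: field) set" where
  "quotient_cochains G L a H i = {c \<in> cochains L i. \<forall>h\<in>H. cochain_action G L a h c = c}"

definition quotient_coboundary_kernel ::
    "('g, 'm) monoid_scheme \<Rightarrow> 'v set set \<Rightarrow> ('g \<Rightarrow> 'v \<Rightarrow> 'v) \<Rightarrow> 'g set \<Rightarrow> nat \<Rightarrow>
     ('v list \<Rightarrow> 'k :: field) set" where
  "quotient_coboundary_kernel G L a H i =
     {c \<in> quotient_cochains G L a H (i - 1). coboundary L i c = (\<lambda>_. 0)}"

definition quotient_coboundary_image ::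
    "('g, 'm) monoid_scheme \<Rightarrow> 'v set set \<Rightarrow> ('g \<Rightarrow> 'v \<Rightarrow> 'v) \<Rightarrow> 'g set \<Rightarrow> nat \<Rightarrow>
     ('v list \<Rightarrow> 'k :: field) set" where
  "quotient_coboundary_image G L a H i = coboundary L i ` quotient_cochains G L a H (i - 1)"

text \<open>The fields \<open>mult\<close> and \<open>one\<close> of a \<open>module\<close> record play no role for modules.\<close>

definition function_space :: "('v list \<Rightarrow> 'k) set \<Rightarrow> ('k :: field, 'v list \<Rightarrow> 'k) module" where
  "function_space S =
     \<lparr>carrier = S, mult = undefined, one = undefined, zero = (\<lambda>_. 0),
      add = (\<lambda>c d vs. c vs + d vs), smult = (\<lambda>r c vs. r * c vs)\<rparr>"

definition quotient_module :: "('r, 'c) module \<Rightarrow> 'c set \<Rightarrow> ('r, 'c set) module" where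
  "quotient_module M B =
     \<lparr>carrier = A_RCOSETS M B, mult = undefined, one = undefined, zero = B,
      add = set_add M, smult = (\<lambda>r C. {(r \<odot>\<^bsub>M\<^esub> c) \<oplus>\<^bsub>M\<^esub> b | c b. c \<in> C \<and> b \<in> B})\<rparr>"

definition quotient_cohomology ::
    "('g, 'm) monoid_scheme \<Rightarrow> 'v set set \<Rightarrow> ('g \<Rightarrow> 'v \<Rightarrow> 'v) \<Rightarrow> 'g set \<Rightarrow> nat \<Rightarrow>
     ('k :: field, ('v list \<Rightarrow> 'k) set) module" where
  "quotient_cohomology G L a H p =
     quotient_module (function_space (quotient_coboundary_kernel G L a H (p + 1)))
                     (quotient_coboundary_image G L a H p)"

end

theory Submission
  imports Defs
begin

text \<open>The proof rests on one fact: if \<open>X\<close> is the space of \<open>i\<close>-cochains satisfying the cocycle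
  condition on a \<open>G\<close>-invariant set of simplices, then the sofic entropy of \<open>X\<close> along a chain of
  finite-index subgroups \<open>\<Gamma>\<^sub>n\<close> is the exponential growth rate of the number of \<open>\<Gamma>\<^sub>n\<close>-invariant points
  of \<open>X\<close> (theorem \<open>sofic_entropy_eq_periodic_growth\<close>). Testing no simplices gives all cochains,
  testing all simplices gives the kernel of the coboundary map, so that theorem computes all three
  entropies.

  The lower bound is direct. An invariant point \<open>x\<close> defines a map \<open>H u \<mapsto> u\<^bsup>-1\<^esup> x\<close>, which is exactly
  equivariant, and by compactness two different invariant points give maps at distance at least a
  fixed \<open>\<kappa>\<close> (\<open>agree_if_pseudometric_small\<close>, \<open>separated_periodic_orbit_maps\<close>).

  For the upper bound, the action on simplices is free with finitely many orbits, so there is an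
  equivariant map \<open>\<gamma>\<close> from the simplices to \<open>G\<close> that takes the value \<open>\<one>\<close> only finitely often
  (\<open>equivariant_map_to_group_exists\<close>). With it, an approximately equivariant map \<open>\<phi>\<close> on the cosets is
  glued to an \<open>H\<close>-invariant cochain \<open>glue H \<phi>\<close>. At all cosets outside a small set \<open>bad V \<phi>\<close> the glued
  cochain reproduces \<open>\<phi>\<close> on any prescribed finite set \<open>V\<close> of simplices (\<open>card_bad_le\<close>), and there it
  inherits the cocycle condition from \<open>\<phi>\<close>. Because everything is linear, two maps with the same bad
  set and the same finite data at each bad coset have glued cochains that differ by an
  invariant point of \<open>X\<close>, and this point determines the map up to small distance
  (\<open>card_with_bad_set_le\<close>). So a separated set has at most as many elements as there are invariant
  points, up to a sum over small bad sets, which is subexponential (\<open>sum_small_subsets_le_exp\<close>).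

  Now let \<open>C\<close>, \<open>K\<close>, \<open>Z\<close> be the spaces of invariant cochains, invariant elements of \<open>ker \<delta>\<^bsup>p\<^esup>\<close> and
  invariant elements of \<open>ker \<delta>\<^bsup>p+1\<^esup>\<close> at level \<open>n\<close>. Counting gives \<open>|Z| |K| = |H\<^bsup>p\<^esup>| |C|\<close>. The
  number \<open>|C|\<close> is exactly the \<open>[G : \<Gamma>\<^sub>n]\<close>-th power of a constant, and the growth rate of \<open>|K|\<close>
  converges by assumption, so dividing logarithms by the index and taking the limes superior gives the
  identity.\<close>

section \<open>Sums over small subsets\<close>

text \<open>For \<open>0 < z \<le> 1\<close> and \<open>|B| \<le> \<epsilon>N\<close> the summand is at most \<open>(A z)\<^bsup>|B|\<^esup> z\<^bsup>-\<epsilon>N\<^esup>\<close>, and the sum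
  of \<open>(A z)\<^bsup>|B|\<^esup>\<close> over all subsets is \<open>(1 + A z)\<^bsup>N\<^esup> \<le> exp (A z N)\<close>. It remains to take \<open>z\<close> so small
  that \<open>A z \<le> \<eta> / 2\<close>, and then \<open>\<epsilon>\<close> so small that \<open>- \<epsilon> ln z \<le> \<eta> / 2\<close>.\<close>
lemma sum_small_subsets_le_exp:
  fixes A \<eta> :: real
  assumes "A \<ge> 0" "\<eta> > 0"
  obtains \<epsilon> where "\<epsilon> > 0"
    "\<forall>D :: 'a set. finite D \<longrightarrow>
       (\<Sum>B | B \<subseteq> D \<and> real (card B) \<le> \<epsilon> * real (card D). A ^ card B) \<le> exp (\<eta> * real (card D))"
proof -
  define z where "z = min 1 (\<eta> / (2 * (A + 1)))"
  have z: "0 < z" "z \<le> 1" using assms by (auto simp: z_def)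
  have Az: "A * z \<le> \<eta> / 2"
  proof -
    have "A * z \<le> (A + 1) * (\<eta> / (2 * (A + 1)))"
      using assms z by (intro mult_mono) (auto simp: z_def)
    also have "\<dots> = \<eta> / 2" using assms by (simp add: field_simps)
    finally show ?thesis .
  qed
  have lnz: "- ln z \<ge> 0" using z by simp
  define \<epsilon> where "\<epsilon> = \<eta> / (2 * (1 - ln z))"
  have eps: "\<epsilon> > 0" using assms lnz by (simp add: \<epsilon>_def)
  have eln: "\<epsilon> * (- ln z) \<le> \<eta> / 2"
  proof -
    have "\<epsilon> * (- ln z) \<le> \<epsilon> * (1 - ln z)" using eps by (intro mult_left_mono) auto
    also have "\<dots> = \<eta> / 2" using lnz by (simp add: \<epsilon>_def field_simps)
    finally show ?thesis .
  qed
  have "(\<Sum>B | B \<subseteq> D \<and> real (card B) \<le> \<epsilon> * real (card D). A ^ card B) \<le> exp (\<eta> * real (card D))"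
    if D: "finite D" for D :: "'a set"
  proof -
    let ?N = "real (card D)"
    have le: "A ^ card B \<le> (A * z) ^ card B * exp (\<epsilon> * ?N * (- ln z))"
      if "real (card B) \<le> \<epsilon> * ?N" for B :: "'a set"
    proof -
      have "1 = z ^ card B * exp (real (card B) * (- ln z))"
        using z by (simp add: exp_minus exp_of_nat_mult)
      also have "\<dots> \<le> z ^ card B * exp (\<epsilon> * ?N * (- ln z))"
        using that lnz z by (intro mult_left_mono) (auto intro: mult_right_mono_neg)
      finally have "A ^ card B * 1 \<le> A ^ card B * (z ^ card B * exp (\<epsilon> * ?N * (- ln z)))"
        using assms by (intro mult_left_mono) auto
      then show ?thesis by (simp add: power_mult_distrib mult.assoc)
    qed
    have "(\<Sum>B | B \<subseteq> D \<and> real (card B) \<le> \<epsilon> * ?N. A ^ card B)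
        \<le> (\<Sum>B | B \<subseteq> D \<and> real (card B) \<le> \<epsilon> * ?N. (A * z) ^ card B * exp (\<epsilon> * ?N * (- ln z)))"
      by (intro sum_mono le) auto
    also have "\<dots> \<le> (\<Sum>B \<in> Pow D. (A * z) ^ card B * exp (\<epsilon> * ?N * (- ln z)))"
      using D assms z by (intro sum_mono2) auto
    also have "\<dots> = (\<Sum>B \<in> Pow D. \<Prod>i\<in>B. A * z) * exp (\<epsilon> * ?N * (- ln z))"
      by (simp add: sum_distrib_right)
    also have "(\<Sum>B \<in> Pow D. \<Prod>i\<in>B. A * z) = (\<Prod>i\<in>D. A * z + 1)"
      using D by (subst prod_add) auto
    also have "\<dots> = (1 + A * z) ^ card D" by (simp add: add.commute)
    also have "\<dots> \<le> exp (A * z) ^ card D"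
      using assms z by (intro power_mono) auto
    also have "\<dots> = exp (?N * (A * z))" by (simp add: exp_of_nat_mult)
    also have "exp (?N * (A * z)) * exp (\<epsilon> * ?N * (- ln z)) = exp (?N * (A * z + \<epsilon> * (- ln z)))"
      by (simp add: exp_add [symmetric] algebra_simps)
    also have "\<dots> \<le> exp (\<eta> * ?N)"
    proof -
      have "A * z + \<epsilon> * (- ln z) \<le> \<eta>" using Az eln by simp
      from mult_left_mono[OF this, of ?N] show ?thesis by (simp add: mult.commute)
    qed
    finally show ?thesis by simp
  qed
  with eps that show thesis by blast
qed

section \<open>Alternating functions and the coboundary map\<close>

definition face :: "nat \<Rightarrow> 'v list \<Rightarrow> 'v list" where
  "face j vs = take j vs @ drop (Suc j) vs"

lemma coboundary_eq:
  "coboundary L i c vs =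
     (if vs \<in> ordered_simplices L i then \<Sum>j\<le>i. (-1) ^ j * c (face j vs) else 0)"
  by (simp add: coboundary_def face_def)

lemma length_face: "j < length vs \<Longrightarrow> length (face j vs) = length vs - 1"
  by (simp add: face_def)

lemma set_face: "set (face j vs) \<subseteq> set vs"
  by (auto simp: face_def dest: in_set_takeD in_set_dropD)

lemma nth_face: "n < length vs - 1 \<Longrightarrow> face j vs ! n = (if n < j then vs ! n else vs ! Suc n)"
  by (auto simp: face_def nth_append min_def)

text \<open>The simplicial identity behind \<open>\<delta> \<circ> \<delta> = 0\<close>.\<close>
lemma face_face:
  assumes "l < j" "j < length vs"
  shows "face l (face j vs) = face (j - 1) (face l vs)"
proof (rule nth_equalityI)
  show "length (face l (face j vs)) = length (face (j - 1) (face l vs))"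
    using assms by (simp add: length_face)
  fix n assume "n < length (face l (face j vs))"
  then have n: "n < length vs - 2" using assms by (simp add: length_face)
  have "face l (face j vs) ! n = (if n < l then vs ! n else if Suc n < j then vs ! Suc n else vs ! Suc (Suc n))"
    using n assms by (subst nth_face) (auto simp: nth_face length_face)
  also have "\<dots> = face (j - 1) (face l vs) ! n"
    using n assms by (subst nth_face) (auto simp: nth_face length_face)
  finally show "face l (face j vs) ! n = face (j - 1) (face l vs) ! n" .
qed

lemma face_map: "face j (map f vs) = map f (face j vs)"
  by (simp add: face_def take_map drop_map)

lemma face_in_ordered_simplices:
  assumes "abstract_simplicial_complex L" "vs \<in> ordered_simplices L (Suc i)" "j \<le> Suc i"
  shows "face j vs \<in> ordered_simplices L i"
proof -
  have vs: "distinct vs" "length vs = Suc (Suc i)" "set vs \<in> L"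
    using assms by (auto simp: ordered_simplices_def)
  have eq: "vs = take j vs @ vs ! j # drop (Suc j) vs"
    using assms(3) vs by (intro id_take_nth_drop) auto
  have "distinct (face j vs)" using vs(1) by (subst (asm) eq) (auto simp: face_def)
  moreover have len: "length (face j vs) = Suc i" using vs assms(3) by (simp add: length_face)
  moreover note set_face[of j vs]
  moreover have "set (face j vs) \<noteq> {}" using len by (metis list.size(3) nat.simps(3) set_empty)
  ultimately show ?thesis
    using assms(1) vs(3) unfolding abstract_simplicial_complex_def ordered_simplices_def by blast
qed

lemma permute_list_in_ordered_simplices:
  assumes "vs \<in> ordered_simplices L i" "\<pi> permutes {..<length vs}"
  shows "permute_list \<pi> vs \<in> ordered_simplices L i"
  using assms by (auto simp: ordered_simplices_def)

lemma permute_list_swap_adjacent: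
  "permute_list (Transposition.transpose (length xs) (Suc (length xs))) (xs @ [x, y] @ ys) = xs @ [y, x] @ ys"
proof (rule nth_equalityI)
  fix n assume n: "n < length (permute_list (Transposition.transpose (length xs) (Suc (length xs))) (xs @ [x, y] @ ys))"
  have "Transposition.transpose (length xs) (Suc (length xs)) permutes {..<length (xs @ [x, y] @ ys)}"
    by (intro permutes_swap_id) auto
  then show "permute_list (Transposition.transpose (length xs) (Suc (length xs))) (xs @ [x, y] @ ys) ! n = (xs @ [y, x] @ ys) ! n"
    using n by (subst permute_list_nth) (auto simp: Transposition.transpose_def nth_append nth_Cons split: nat.splits)
qed simp

text \<open>Adjacent transpositions generate the symmetric group: the permutations that obey the sign rule
  are closed under composition, and the transposition of \<open>k\<close> and \<open>b + 1\<close> is the conjugate of the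
  transposition of \<open>k\<close> and \<open>b\<close> by the adjacent one of \<open>b\<close> and \<open>b + 1\<close>.\<close>
lemma alternating_if_adjacent:
  fixes c :: "'v list \<Rightarrow> 'k :: field"
  assumes adj: "\<And>xs x y ys. xs @ [x, y] @ ys \<in> ordered_simplices L i \<Longrightarrow>
                  c (xs @ [y, x] @ ys) = - c (xs @ [x, y] @ ys)"
    and \<pi>: "\<pi> permutes {..i}" and vs: "vs \<in> ordered_simplices L i"
  shows "c (permute_list \<pi> vs) = of_int (sign \<pi>) * c vs"
proof -
  have len: "{..<length vs} = {..i}" if "vs \<in> ordered_simplices L i" for vs
    using that by (auto simp: ordered_simplices_def)
  define Q where "Q \<pi> \<longleftrightarrow> (\<forall>vs \<in> ordered_simplices L i. c (permute_list \<pi> vs) = of_int (sign \<pi>) * c vs)"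
    for \<pi>
  have comp: "Q (f \<circ> g)" if "Q f" "Q g" "f permutes {..i}" "g permutes {..i}" for f g
    unfolding Q_def
  proof
    fix vs assume vs: "vs \<in> ordered_simplices L i"
    have f: "permute_list f vs \<in> ordered_simplices L i"
      using vs that len by (intro permute_list_in_ordered_simplices) auto
    have "c (permute_list (f \<circ> g) vs) = c (permute_list g (permute_list f vs))"
      using that len[OF vs] by (subst permute_list_compose) auto
    also have "\<dots> = of_int (sign g) * (of_int (sign f) * c vs)"
      using that f vs unfolding Q_def by simp
    also have "\<dots> = of_int (sign (f \<circ> g)) * c vs"
      using that by (simp add: sign_compose mult_ac permutes_imp_permutation[of "{..i}"])
    finally show "c (permute_list (f \<circ> g) vs) = of_int (sign (f \<circ> g)) * c vs" .
  qed
  have adjacent: "Q (Transposition.transpose k (Suc k))" if "Suc k \<le> i" for k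
    unfolding Q_def
  proof
    fix vs assume vs: "vs \<in> ordered_simplices L i"
    then have "length vs = Suc i" by (auto simp: ordered_simplices_def)
    then have eq: "vs = take k vs @ [vs ! k, vs ! Suc k] @ drop (Suc (Suc k)) vs"
      using that by (metis Cons_nth_drop_Suc append_Cons append_Nil id_take_nth_drop
          less_Suc_eq_le less_or_eq_imp_le Suc_le_lessD le_imp_less_Suc)
    have "length (take k vs) = k" using that \<open>length vs = Suc i\<close> by simp
    then have "permute_list (Transposition.transpose k (Suc k)) vs = take k vs @ [vs ! Suc k, vs ! k] @ drop (Suc (Suc k)) vs"
      using permute_list_swap_adjacent[of "take k vs" "vs ! k" "vs ! Suc k" "drop (Suc (Suc k)) vs"] eq
      by simp
    then show "c (permute_list (Transposition.transpose k (Suc k)) vs) = of_int (sign (Transposition.transpose k (Suc k))) * c vs"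
      using adj[of "take k vs" "vs ! k" "vs ! Suc k" "drop (Suc (Suc k)) vs"] vs eq
      by (simp add: sign_swap_id)
  qed
  have "Q (Transposition.transpose k (k + Suc m))" if "k + Suc m \<le> i" for k m
    using that
  proof (induction m)
    case 0 then show ?case using adjacent by simp
  next
    case (Suc m)
    let ?b = "k + Suc m"
    have per: "Transposition.transpose ?b (Suc ?b) permutes {..i}" "Transposition.transpose k ?b permutes {..i}"
      using Suc.prems by (auto intro!: permutes_swap_id)
    have "Transposition.transpose k (Suc ?b) = Transposition.transpose (Suc ?b) k" by (rule transpose_commute)
    also have "\<dots> = Transposition.transpose (Suc ?b) ?b \<circ> Transposition.transpose ?b k \<circ> Transposition.transpose (Suc ?b) ?b"
      by (rule transpose_comp_triple [symmetric]) auto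
    also have "\<dots> = Transposition.transpose ?b (Suc ?b) \<circ> Transposition.transpose k ?b \<circ> Transposition.transpose ?b (Suc ?b)"
      by (simp only: transpose_commute)
    finally have eq: "Transposition.transpose k (Suc ?b) = Transposition.transpose ?b (Suc ?b) \<circ> Transposition.transpose k ?b \<circ> Transposition.transpose ?b (Suc ?b)" .
    have "Q (Transposition.transpose k ?b)" "Q (Transposition.transpose ?b (Suc ?b))"
      using Suc adjacent by auto
    then have "Q (Transposition.transpose ?b (Suc ?b) \<circ> Transposition.transpose k ?b \<circ> Transposition.transpose ?b (Suc ?b))"
      using per by (intro comp permutes_compose) auto
    moreover have "k + Suc (Suc m) = Suc ?b" by simp
    ultimately show ?case using eq by (simp only:)
  qed
  then have less: "Q (Transposition.transpose a b)" if "a < b" "b \<le> i" for a b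
    using that by (metis less_iff_Suc_add add_Suc_right)
  have trans: "Q (Transposition.transpose a b)" if "a \<noteq> b" "a \<le> i" "b \<le> i" for a b
    using less[of a b] less[of b a] that by (metis linorder_neqE_nat transpose_commute)
  have "Q \<pi>"
    using \<pi> finite_atMost
  proof (induction rule: permutes_induct)
    case id then show ?case by (simp add: Q_def)
  next
    case (swap a b p)
    then show ?case by (intro comp trans permutes_swap_id) auto
  qed
  then show ?thesis using vs by (auto simp: Q_def)
qed

lemma cochain_swap_adjacent:
  fixes c :: "'v list \<Rightarrow> 'k :: field"
  assumes "c \<in> cochains L i" "xs @ [x, y] @ ys \<in> ordered_simplices L i"
  shows "c (xs @ [y, x] @ ys) = - c (xs @ [x, y] @ ys)"
proof -
  let ?t = "Transposition.transpose (length xs) (Suc (length xs))"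
  have "?t permutes {..<length (xs @ [x, y] @ ys)}"
    by (intro permutes_swap_id) auto
  then have "c (permute_list ?t (xs @ [x, y] @ ys)) = of_int (sign ?t) * c (xs @ [x, y] @ ys)"
    using assms unfolding cochains_def by blast
  then show ?thesis by (simp only: permute_list_swap_adjacent) (simp add: sign_swap_id)
qed

lemma cochain_swap_adjacent':
  fixes c :: "'v list \<Rightarrow> 'k :: field"
  assumes "c \<in> cochains L i"
    and "xs @ [x, y] @ ys = vs" "vs \<in> ordered_simplices L i" "vs' = xs @ [y, x] @ ys" 
  shows "c vs' = - c vs"
  using cochain_swap_adjacent[OF assms(1), of xs x y ys] assms by simp

text \<open>It suffices to swap two neighbouring vertices. A face that keeps both of them changes sign because
  \<open>c\<close> is alternating; the two faces that drop one of them trade places, and their positions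
  have opposite signs. Reindexing the sum by the transposition of the two positions matches the terms.\<close>
lemma coboundary_in_cochains:
  fixes c :: "'v list \<Rightarrow> 'k :: field"
  assumes L: "abstract_simplicial_complex L" and c: "c \<in> cochains L i"
  shows "coboundary L (Suc i) c \<in> cochains L (Suc i)"
proof -
  have "coboundary L (Suc i) c (xs @ [y, x] @ ys) = - coboundary L (Suc i) c (xs @ [x, y] @ ys)"
    if vs: "xs @ [x, y] @ ys \<in> ordered_simplices L (Suc i)" for xs x y ys
  proof -
    define k where "k = length xs"
    define \<tau> where "\<tau> = Transposition.transpose k (Suc k)"
    let ?vs = "xs @ [x, y] @ ys" and ?ws = "xs @ [y, x] @ ys"
    have len: "length xs + length ys = i" using vs by (auto simp: ordered_simplices_def)
    have ws: "?ws \<in> ordered_simplices L (Suc i)" using vs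
      by (auto simp: ordered_simplices_def insert_commute)
    have \<tau>: "\<tau> permutes {..Suc i}" unfolding \<tau>_def
      using len by (intro permutes_swap_id) (auto simp: k_def)
    have "(\<Sum>j\<le>Suc i. (-1) ^ j * c (face j ?ws)) = (\<Sum>j\<le>Suc i. (-1) ^ (\<tau> j) * c (face (\<tau> j) ?ws))"
      by (subst sum.permute[OF \<tau>]) (simp add: o_def)
    also have "\<dots> = (\<Sum>j\<le>Suc i. - ((-1) ^ j * c (face j ?vs)))"
    proof (rule sum.cong)
      fix j assume j: "j \<in> {..Suc i}"
      have fv: "face j ?vs \<in> ordered_simplices L i"
        using face_in_ordered_simplices[OF L vs, of j] j by simp
      consider "j < k" | "j = k" | "j = Suc k" | "j > Suc k" by linarith
      then show "(-1) ^ (\<tau> j) * c (face (\<tau> j) ?ws) = - ((-1) ^ j * c (face j ?vs))"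
      proof cases
        case 1
        have "c (face j ?ws) = - c (face j ?vs)"
          by (rule cochain_swap_adjacent'[OF c _ fv, of "face j xs" x y ys])
             (use 1 in \<open>auto simp: k_def face_def\<close>)
        then show ?thesis using 1 by (simp add: \<tau>_def Transposition.transpose_def)
      next
        case 4
        have "c (face j ?ws) = - c (face j ?vs)"
          by (rule cochain_swap_adjacent'[OF c _ fv, of xs x y "face (j - k - 2) ys"])
             (use 4 in \<open>auto simp: k_def face_def take_Cons' drop_Cons' numeral_2_eq_2 Suc_diff_Suc\<close>)
        then show ?thesis using 4 by (simp add: \<tau>_def Transposition.transpose_def)
      qed (simp_all add: \<tau>_def k_def face_def take_Cons' drop_Cons')
    qed simp
    also have "\<dots> = - (\<Sum>j\<le>Suc i. (-1) ^ j * c (face j ?vs))" by (rule sum_negf)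
    finally show ?thesis using vs ws unfolding coboundary_eq by simp
  qed
  from alternating_if_adjacent[of L "Suc i" "coboundary L (Suc i) c", OF this]
  show ?thesis
    unfolding cochains_def
    by (auto simp: ordered_simplices_def coboundary_def lessThan_Suc_atMost)
qed

text \<open>In the double sum over pairs of removed positions, the term at \<open>(j, l)\<close> with \<open>l < j\<close> cancels the one
  at \<open>(l, j - 1)\<close>, which removes the same two vertices in the other order.\<close>
lemma coboundary_coboundary:
  fixes c :: "'v list \<Rightarrow> 'k :: field"
  assumes L: "abstract_simplicial_complex L"
  shows "coboundary L (Suc (Suc i)) (coboundary L (Suc i) c) = (\<lambda>_. 0)"
proof
  fix vs
  show "coboundary L (Suc (Suc i)) (coboundary L (Suc i) c) vs = 0"
  proof (cases "vs \<in> ordered_simplices L (Suc (Suc i))")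
    case True
    then have len: "length vs = Suc (Suc (Suc i))" by (auto simp: ordered_simplices_def)
    define f where "f = (\<lambda>(j, l). (-1) ^ (j + l) * c (face l (face j vs)))"
    let ?A = "{..Suc (Suc i)} \<times> {..Suc i}"
    let ?U = "{(j, l) \<in> ?A. l < j}" and ?D = "{(j, l) \<in> ?A. j \<le> l}"
    have "coboundary L (Suc (Suc i)) (coboundary L (Suc i) c) vs
        = (\<Sum>j\<le>Suc (Suc i). (-1) ^ j * (\<Sum>l\<le>Suc i. (-1) ^ l * c (face l (face j vs))))"
      using True face_in_ordered_simplices[OF L True] by (simp add: coboundary_eq del: sum.atMost_Suc)
    also have "\<dots> = sum f ?A"
      by (simp only: f_def sum_distrib_left sum.cartesian_product [symmetric] prod.case power_add mult.assoc)
    also have "?A = ?U \<union> ?D" by auto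
    also have "sum f (?U \<union> ?D) = sum f ?U + sum f ?D"
      by (rule sum.union_disjoint) (auto intro: finite_subset[of _ ?A])
    also have "sum f ?U = sum (\<lambda>q. - f q) ?D"
    proof (rule sum.reindex_bij_witness[where j = "\<lambda>(j, l). (l, j - 1)" and i = "\<lambda>(j, l). (Suc l, j)"])
      fix q assume "q \<in> ?U"
      then obtain j l where q: "q = (j, l)" "l < j" "j \<le> Suc (Suc i)" by auto
      then obtain j' where j': "j = Suc j'" by (cases j) auto
      have "face l (face j vs) = face j' (face l vs)"
        using face_face[of l j vs] q len j' by simp
      then show "- f (case q of (j, l) \<Rightarrow> (l, j - 1)) = f q"
        by (simp add: f_def q j' add.commute)
    qed auto
    finally show ?thesis by (simp add: sum_negf)
  qed (simp add: coboundary_def)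
qed

section \<open>Finite vector spaces\<close>

text \<open>Coordinates with respect to a finite basis.\<close>
lemma (in vectorspace) card_carrier_eq_power_dim:
  assumes "finite (carrier K)" "finite (carrier V)"
  shows "card (carrier V) = card (carrier K) ^ dim"
proof -
  have "gen_set (carrier V)"
    using in_own_span[of "carrier V"] span_is_subset2[of "carrier V"] by blast
  then have "fin_dim" unfolding fin_dim_def using assms(2) by blast
  then obtain \<beta> where \<beta>: "finite \<beta>" "basis \<beta>" using finite_basis_exists by blast
  then have sub: "\<beta> \<subseteq> carrier V" by (simp add: basis_def)
  have ex1: "\<exists>!a. a \<in> \<beta> \<rightarrow>\<^sub>E carrier K \<and> lincomb a \<beta> = v" if "v \<in> carrier V" for v
    using that by (rule mp[OF spec[OF iffD1[OF basis_criterion[OF \<beta>(1) sub] \<beta>(2)]]])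
  have "bij_betw (\<lambda>a. lincomb a \<beta>) (\<beta> \<rightarrow>\<^sub>E carrier K) (carrier V)"
    unfolding bij_betw_def
  proof (intro conjI inj_onI equalityI subsetI)
    fix a b assume ab: "a \<in> \<beta> \<rightarrow>\<^sub>E carrier K" "b \<in> \<beta> \<rightarrow>\<^sub>E carrier K" "lincomb a \<beta> = lincomb b \<beta>"
    then have "lincomb b \<beta> \<in> carrier V" using sub by (intro lincomb_closed) auto
    then show "a = b" using ex1 ab by blast
  next
    fix v assume "v \<in> (\<lambda>a. lincomb a \<beta>) ` (\<beta> \<rightarrow>\<^sub>E carrier K)"
    then show "v \<in> carrier V" using sub by (auto intro!: lincomb_closed)
  next
    fix v assume "v \<in> carrier V"
    then show "v \<in> (\<lambda>a. lincomb a \<beta>) ` (\<beta> \<rightarrow>\<^sub>E carrier K)" using ex1 by blast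
  qed
  then have "card (carrier V) = card (\<beta> \<rightarrow>\<^sub>E carrier K)" by (simp add: bij_betw_same_card)
  also have "\<dots> = card (carrier K) ^ card \<beta>" using \<beta> by (simp add: card_PiE)
  finally show ?thesis using dim_basis \<beta> by simp
qed

text \<open>Both operations of \<open>quotient_module\<close> are computed on coset representatives, so that the module axioms
  descend from \<open>M\<close>.\<close>
lemma module_quotient_module:
  fixes R (structure) and M (structure)
  assumes "module R M" "additive_subgroup B M"
    and smult: "\<And>r b. r \<in> carrier R \<Longrightarrow> b \<in> B \<Longrightarrow> r \<odot>\<^bsub>M\<^esub> b \<in> B"
  shows "module R (quotient_module M B)"
proof -
  interpret M: module R M by fact
  interpret B: abelian_subgroup B M
    using assms(2) M.abelian_group_axioms by (rule abelian_subgroupI3)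
  let ?Q = "quotient_module M B"
  let ?c = "\<lambda>x. B +>\<^bsub>M\<^esub> x"
  have carr: "carrier ?Q = ?c ` carrier M"
    by (auto simp: quotient_module_def A_RCOSETS_def')
  have zero: "\<zero>\<^bsub>?Q\<^esub> = ?c \<zero>\<^bsub>M\<^esub>"
    by (simp add: quotient_module_def M.a_coset_add_zero B.a_subset)
  have add: "?c x \<oplus>\<^bsub>?Q\<^esub> ?c y = ?c (x \<oplus>\<^bsub>M\<^esub> y)" if "x \<in> carrier M" "y \<in> carrier M" for x y
    using that by (simp add: quotient_module_def B.a_rcos_sum)
  have sm: "r \<odot>\<^bsub>?Q\<^esub> ?c x = ?c (r \<odot>\<^bsub>M\<^esub> x)" if "x \<in> carrier M" "r \<in> carrier R" for r x
  proof -
    have "{(r \<odot>\<^bsub>M\<^esub> c) \<oplus>\<^bsub>M\<^esub> b | c b. c \<in> ?c x \<and> b \<in> B} = ?c (r \<odot>\<^bsub>M\<^esub> x)"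
    proof (intro equalityI subsetI)
      fix y assume "y \<in> {(r \<odot>\<^bsub>M\<^esub> c) \<oplus>\<^bsub>M\<^esub> b | c b. c \<in> ?c x \<and> b \<in> B}"
      then obtain b b' where b: "b \<in> B" "b' \<in> B" and y: "y = (r \<odot>\<^bsub>M\<^esub> (b' \<oplus>\<^bsub>M\<^esub> x)) \<oplus>\<^bsub>M\<^esub> b"
        by (auto simp: a_r_coset_def')
      have "y = ((r \<odot>\<^bsub>M\<^esub> b') \<oplus>\<^bsub>M\<^esub> b) \<oplus>\<^bsub>M\<^esub> (r \<odot>\<^bsub>M\<^esub> x)"
        using b that B.a_subset by (simp add: y M.smult_r_distr M.a_ac subset_eq)
      moreover have "(r \<odot>\<^bsub>M\<^esub> b') \<oplus>\<^bsub>M\<^esub> b \<in> B" using b smult that by (intro B.a_closed) auto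
      ultimately show "y \<in> ?c (r \<odot>\<^bsub>M\<^esub> x)" by (auto simp: a_r_coset_def')
    next
      fix y assume "y \<in> ?c (r \<odot>\<^bsub>M\<^esub> x)"
      then obtain b where b: "b \<in> B" "y = b \<oplus>\<^bsub>M\<^esub> (r \<odot>\<^bsub>M\<^esub> x)" by (auto simp: a_r_coset_def')
      then have "y = (r \<odot>\<^bsub>M\<^esub> x) \<oplus>\<^bsub>M\<^esub> b" using that B.a_subset by (simp add: M.a_comm subset_eq)
      then show "y \<in> {(r \<odot>\<^bsub>M\<^esub> c) \<oplus>\<^bsub>M\<^esub> b | c b. c \<in> ?c x \<and> b \<in> B}"
        using b(1) B.a_rcos_self[OF that(1)] by blast
    qed
    then show ?thesis by (simp add: quotient_module_def)
  qed
  show ?thesis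
  proof (rule moduleI)
    show "cring R" by (rule M.R.is_cring)
    show "abelian_group ?Q"
    proof (rule abelian_groupI)
      fix x assume "x \<in> carrier ?Q"
      then obtain u where u: "u \<in> carrier M" "x = ?c u" by (auto simp: carr)
      then have "?c (\<ominus>\<^bsub>M\<^esub> u) \<oplus>\<^bsub>?Q\<^esub> x = \<zero>\<^bsub>?Q\<^esub>"
        by (simp add: add zero M.l_neg)
      then show "\<exists>y \<in> carrier ?Q. y \<oplus>\<^bsub>?Q\<^esub> x = \<zero>\<^bsub>?Q\<^esub>"
        using u by (intro bexI[of _ "?c (\<ominus>\<^bsub>M\<^esub> u)"]) (auto simp: carr)
    qed (auto simp: carr zero add M.a_ac)
  qed (auto simp: carr add sm M.smult_l_distr M.smult_r_distr M.smult_assoc1)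
qed

lemma field_class_ring: "field (class_ring :: 'k :: field ring)"
proof -
  have "\<exists>y. x * y = 1 \<and> y * x = 1" if "x \<noteq> 0" for x :: 'k
    using that by (intro exI[of _ "inverse x"]) auto
  then show ?thesis by unfold_locales (auto simp: Units_def)
qed

text \<open>Subspaces are treated as sets of functions rather than as module records, because the arguments
  about cochains are pointwise; the records appear only where dimensions are read off.\<close>
definition linear_set :: "('v list \<Rightarrow> 'k :: field) set \<Rightarrow> bool" where
  "linear_set S \<longleftrightarrow> (\<lambda>_. 0) \<in> S \<and> (\<forall>c\<in>S. \<forall>d\<in>S. (\<lambda>x. c x + d x) \<in> S) \<and> (\<forall>r. \<forall>c\<in>S. (\<lambda>x. r * c x) \<in> S)"

lemma linear_setD:
  assumes "linear_set S"
  shows "(\<lambda>_. 0) \<in> S"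
    and "c \<in> S \<Longrightarrow> d \<in> S \<Longrightarrow> (\<lambda>x. c x + d x) \<in> S"
    and "c \<in> S \<Longrightarrow> (\<lambda>x. r * c x) \<in> S"
proof -
  note l = assms[unfolded linear_set_def]
  show "(\<lambda>_. 0) \<in> S" by (rule conjunct1 [OF l])
  show "(\<lambda>x. c x + d x) \<in> S" if "c \<in> S" "d \<in> S"
    by (rule bspec [OF bspec [OF conjunct1 [OF conjunct2 [OF l]] that(1)] that(2)])
  show "(\<lambda>x. r * c x) \<in> S" if "c \<in> S"
    by (rule bspec [OF spec [OF conjunct2 [OF conjunct2 [OF l]]] that])
qed

lemma linear_set_uminus: "linear_set S \<Longrightarrow> c \<in> S \<Longrightarrow> (\<lambda>x. - c x) \<in> S"
  using linear_setD(3)[of S c "- 1"] by simp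

lemma linear_set_diff: 
  assumes "linear_set S" "c \<in> S" "d \<in> S" shows "(\<lambda>x. c x - d x) \<in> S"
proof -
  have "(\<lambda>x. c x + - d x) \<in> S"
    by (rule linear_setD(2)[OF assms(1,2) linear_set_uminus[OF assms(1,3)]])
  then show ?thesis by simp
qed

lemma abelian_group_function_space:
  assumes "linear_set S" shows "abelian_group (function_space S)"
proof (rule abelian_groupI)
  fix x assume "x \<in> carrier (function_space S)"
  then show "\<exists>y \<in> carrier (function_space S). y \<oplus>\<^bsub>function_space S\<^esub> x = \<zero>\<^bsub>function_space S\<^esub>"
    using linear_set_uminus[OF assms, of x]
    by (intro bexI[of _ "\<lambda>v. - x v"]) (auto simp: function_space_def)
qed (auto simp: function_space_def algebra_simps linear_setD(1)[OF assms] intro: linear_setD(2)[OF assms])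

lemma module_function_space:
  assumes "linear_set S" shows "module class_ring (function_space S)"
proof (rule moduleI)
  show "cring (class_ring :: 'b ring)"
    using field_class_ring[where 'k = 'b] unfolding field_def domain_def by blast
next
  show "abelian_group (function_space S)" by (rule abelian_group_function_space) fact
qed (auto simp: function_space_def algebra_simps intro: linear_setD(3)[OF assms])

text \<open>Lagrange's theorem for the additive groups, with the number of cosets expressed by the dimension.
  In this form the dimension of cohomology becomes accessible to counting.\<close>
lemma card_quotient_function_space:
  fixes Z B :: "('v list \<Rightarrow> 'k :: {field, finite}) set"
  assumes Z: "linear_set Z" "finite Z" and B: "linear_set B" "B \<subseteq> Z"
  shows "card Z = CARD('k) ^ vectorspace.dim (class_ring :: 'k ring) (quotient_module (function_space Z) B) * card B"
proof -
  let ?M = "function_space Z"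
  interpret M: module "class_ring :: 'k ring" ?M by (rule module_function_space) fact
  have carr: "carrier ?M = Z" by (simp add: function_space_def)
  have inv: "\<ominus>\<^bsub>?M\<^esub> b = (\<lambda>x. - b x)" if "b \<in> Z" for b
  proof -
    have "b \<in> carrier ?M" "(\<lambda>x. - b x) \<in> carrier ?M"
      using that linear_set_uminus Z by (auto simp: carr)
    moreover have "(\<lambda>x. - b x) \<oplus>\<^bsub>?M\<^esub> b = \<zero>\<^bsub>?M\<^esub>" by (simp add: function_space_def)
    ultimately show ?thesis using M.minus_equality by blast
  qed
  have sg: "subgroup B (add_monoid ?M)"
  proof (rule M.add.subgroupI)
    show "B \<subseteq> carrier ?M" using B by (simp add: carr)
    show "B \<noteq> {}" using linear_setD(1)[OF B(1)] by blast
    fix b assume b: "b \<in> B"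
    then show "\<ominus>\<^bsub>?M\<^esub> b \<in> B" using B(2) inv[of b] linear_set_uminus[OF B(1), of b] by auto
    fix b' assume "b' \<in> B"
    then show "b \<oplus>\<^bsub>?M\<^esub> b' \<in> B" using b linear_setD(2)[OF B(1), of b b'] by (simp add: function_space_def)
  qed
  have "additive_subgroup B ?M" using sg by (rule additive_subgroup.intro)
  then interpret Q: module "class_ring :: 'k ring" "quotient_module ?M B"
    by (intro module_quotient_module M.module_axioms)
       (simp_all add: function_space_def linear_setD(3)[OF B(1)])
  interpret Q: vectorspace "class_ring :: 'k ring" "quotient_module ?M B"
    by (intro vectorspace.intro Q.module_axioms field_class_ring)
  have carrQ: "carrier (quotient_module ?M B) = rcosets\<^bsub>add_monoid ?M\<^esub> B"
    by (simp add: quotient_module_def A_RCOSETS_def)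
  have "card (rcosets\<^bsub>add_monoid ?M\<^esub> B) * card B = order (add_monoid ?M)"
    by (rule M.add.lagrange) (rule sg)
  then have "card (carrier (quotient_module ?M B)) * card B = card Z"
    by (simp add: carrQ order_def carr)
  moreover have "finite (carrier (quotient_module ?M B))"
    unfolding carrQ RCOSETS_def using Z by (simp add: carr)
  then have "card (carrier (quotient_module ?M B)) = CARD('k) ^ Q.dim"
    using Q.card_carrier_eq_power_dim by simp
  ultimately show ?thesis by simp
qed

section \<open>Compactness of spaces of cochains\<close>

abbreviation (input) full_shift_topology :: "('v list \<Rightarrow> 'k) topology" where
  "full_shift_topology \<equiv> product_topology (\<lambda>_. discrete_topology UNIV) UNIV"

text \<open>A set is open if membership of each of its points can be certified by finitely many
  coordinates.\<close>
lemma openin_full_shiftI: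
  fixes U :: "('v list \<Rightarrow> 'k) set"
  assumes "\<And>c. c \<in> U \<Longrightarrow> \<exists>V. finite V \<and> (\<forall>c'. (\<forall>b\<in>V. c' b = c b) \<longrightarrow> c' \<in> U)"
  shows "openin full_shift_topology U"
proof (subst openin_subopen, intro ballI)
  fix c assume "c \<in> U"
  with assms obtain V where V: "finite V" "\<And>c'. (\<forall>b\<in>V. c' b = c b) \<Longrightarrow> c' \<in> U"
    by meson
  let ?W = "Pi\<^sub>E UNIV (\<lambda>b. if b \<in> V then {c b} else UNIV)"
  have "openin full_shift_topology ?W"
    by (rule product_topology_basis)
       (auto intro: finite_subset[OF _ V(1)] split: if_splits)
  moreover have "c \<in> ?W" by auto
  moreover have "?W \<subseteq> U"
  proof
    fix c' assume "c' \<in> ?W"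
    then have "c' b = c b" if "b \<in> V" for b
      using that by (auto simp: PiE_iff dest: spec[of _ b])
    then show "c' \<in> U" using V by blast
  qed
  ultimately show "\<exists>T. openin full_shift_topology T \<and> c \<in> T \<and> T \<subseteq> U" by blast
qed

lemma closedin_full_shiftI:
  fixes S :: "('v list \<Rightarrow> 'k) set"
  assumes "\<And>c. c \<notin> S \<Longrightarrow> \<exists>V. finite V \<and> (\<forall>c'. (\<forall>b\<in>V. c' b = c b) \<longrightarrow> c' \<notin> S)"
  shows "closedin full_shift_topology S"
proof -
  have "openin full_shift_topology (UNIV - S)"
  proof (rule openin_full_shiftI)
    fix c assume "c \<in> UNIV - S"
    then have "c \<notin> S" by simp
    from assms[OF this]
    show "\<exists>V. finite V \<and> (\<forall>c'. (\<forall>b\<in>V. c' b = c b) \<longrightarrow> c' \<in> UNIV - S)" by simp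
  qed
  then show ?thesis by (simp add: closedin_def)
qed

lemma topspace_pointwise_topology [simp]: "topspace (pointwise_topology S) = S"
  by (simp add: pointwise_topology_def)

lemma compact_space_pointwise_topology:
  fixes S :: "('v list \<Rightarrow> 'k :: finite) set"
  assumes "closedin full_shift_topology S"
  shows "compact_space (pointwise_topology S)"
proof -
  have "compact_space (full_shift_topology :: ('v list \<Rightarrow> 'k) topology)"
    by (subst compact_space_product_topology) (simp add: compact_space_discrete_topology)
  then show ?thesis
    using assms unfolding pointwise_topology_def
    by (simp add: compact_space_subtopology closedin_compact_space)
qed

lemma continuous_map_pointwise_coordinate:
  "continuous_map (pointwise_topology S) (discrete_topology UNIV) (\<lambda>c. c b)"
  unfolding pointwise_topology_def
  by (intro continuous_map_from_subtopology continuous_map_product_projection UNIV_I)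

lemma openin_coordinate_differs:
  fixes X :: "('v list \<Rightarrow> 'k) set"
  defines "P \<equiv> prod_topology (pointwise_topology X) (pointwise_topology X)"
  shows "openin P {z \<in> X \<times> X. fst z b \<noteq> snd z b}"
    and "closedin P {z \<in> X \<times> X. fst z b \<noteq> snd z b}"
proof -
  have "continuous_map P (prod_topology (discrete_topology UNIV) (discrete_topology UNIV))
          (\<lambda>z. (fst z b, snd z b))"
    unfolding P_def
    by (intro continuous_map_pairedI
          continuous_map_compose[OF continuous_map_fst continuous_map_pointwise_coordinate, unfolded o_def]
          continuous_map_compose[OF continuous_map_snd continuous_map_pointwise_coordinate, unfolded o_def])
  then have *: "continuous_map P (discrete_topology UNIV) (\<lambda>z. (fst z b, snd z b))"
    by (simp add: prod_topology_discrete_topology [symmetric])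
  have "openin P {z \<in> topspace P. (fst z b, snd z b) \<in> {(k, l). k \<noteq> l}}"
    by (rule openin_continuous_map_preimage[OF *]) simp
  then show "openin P {z \<in> X \<times> X. fst z b \<noteq> snd z b}"
    by (simp add: P_def)
  have "closedin P {z \<in> topspace P. (fst z b, snd z b) \<in> {(k, l). k \<noteq> l}}"
    by (rule closedin_continuous_map_preimage[OF *]) simp
  then show "closedin P {z \<in> X \<times> X. fst z b \<noteq> snd z b}"
    by (simp add: P_def)
qed

text \<open>Compactness of \<open>X \<times> X\<close>, in the form that serves for both comparisons of a generating pseudometric
  with agreement of coordinates.\<close>
lemma finite_subcover_pairs:
  fixes X :: "('v list \<Rightarrow> 'k :: finite) set"
  defines "P \<equiv> prod_topology (pointwise_topology X) (pointwise_topology X)"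
  assumes X: "closedin full_shift_topology X" and K: "closedin P K"
    and U: "\<And>i. i \<in> I \<Longrightarrow> openin P (U i)" and cover: "K \<subseteq> (\<Union>i\<in>I. U i)"
  obtains J where "finite J" "J \<subseteq> I" "K \<subseteq> (\<Union>i\<in>J. U i)"
proof -
  have "compact_space P"
    unfolding P_def using X by (simp add: compact_space_prod_topology compact_space_pointwise_topology)
  then have "compactin P K" using K by (rule closedin_compact_space)
  then obtain \<F> where \<F>: "finite \<F>" "\<F> \<subseteq> U ` I" "K \<subseteq> \<Union>\<F>"
    using U cover unfolding compactin_def by (elim conjE allE[of _ "U ` I"]) auto
  from finite_subset_image[OF \<F>(1,2)] obtain J where "J \<subseteq> I" "finite J" "\<F> = U ` J" by blast
  with \<F>(3) that show thesis by blast
qed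

text \<open>The pairs at distance at least \<open>\<kappa>\<close> form a compact set, and the two components of each of them differ
  at some coordinate; finitely many coordinates account for all of them.\<close>
lemma pseudometric_small_if_agree:
  fixes X :: "('v list \<Rightarrow> 'k :: finite) set"
  assumes X: "closedin full_shift_topology X"
    and \<rho>: "generating_pseudometric G (pointwise_topology X) \<alpha> \<rho>" and "\<kappa> > 0"
  obtains V where "finite V" "\<forall>x\<in>X. \<forall>y\<in>X. (\<forall>b\<in>V. x b = y b) \<longrightarrow> \<rho> x y < \<kappa>"
proof -
  let ?P = "prod_topology (pointwise_topology X) (pointwise_topology X)"
  let ?K = "{z \<in> topspace ?P. (case z of (x, y) \<Rightarrow> \<rho> x y) \<in> {\<kappa>..}}"
  have K: "closedin ?P ?K"
    by (rule closedin_continuous_map_preimage[where Y = euclideanreal])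
       (use \<rho> in \<open>auto simp: generating_pseudometric_def\<close>)
  have cover: "?K \<subseteq> (\<Union>b\<in>UNIV. {z \<in> X \<times> X. fst z b \<noteq> snd z b})"
  proof
    fix z assume "z \<in> ?K"
    then obtain x y where z: "z = (x, y)" "x \<in> X" "y \<in> X" "\<rho> x y \<ge> \<kappa>" by auto
    then have "x \<noteq> y" using \<rho> \<open>\<kappa> > 0\<close> by (auto simp: generating_pseudometric_def)
    then show "z \<in> (\<Union>b\<in>UNIV. {z \<in> X \<times> X. fst z b \<noteq> snd z b})"
      using z by (auto simp: fun_eq_iff)
  qed
  obtain V where V: "finite V" "V \<subseteq> UNIV" "?K \<subseteq> (\<Union>b\<in>V. {z \<in> X \<times> X. fst z b \<noteq> snd z b})"
    by (rule finite_subcover_pairs[OF X K openin_coordinate_differs(1) cover])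
  have "\<rho> x y < \<kappa>" if "x \<in> X" "y \<in> X" "\<forall>b\<in>V. x b = y b" for x y
  proof (rule ccontr)
    assume "\<not> \<rho> x y < \<kappa>"
    then have "(x, y) \<in> ?K" using that by auto
    then show False using V(3) that(3) by auto
  qed
  then have "\<forall>x\<in>X. \<forall>y\<in>X. (\<forall>b\<in>V. x b = y b) \<longrightarrow> \<rho> x y < \<kappa>" by blast
  with V(1) show thesis by (rule that)
qed

text \<open>Expansiveness. The pairs that differ somewhere on the finite set \<open>W\<close> form a compact set; as \<open>\<rho>\<close> is
  generating, each of them is separated by a translate, hence finitely many translates separate all of
  them by a uniform amount.\<close>
lemma agree_if_pseudometric_small:
  fixes X :: "('v list \<Rightarrow> 'k :: finite) set"
  assumes X: "closedin full_shift_topology X"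
    and \<rho>: "generating_pseudometric G (pointwise_topology X) \<alpha> \<rho>"
    and \<alpha>: "\<And>g. g \<in> carrier G \<Longrightarrow> continuous_map (pointwise_topology X) (pointwise_topology X) (\<alpha> g)"
    and W: "finite W"
  obtains E \<kappa> where "finite E" "E \<subseteq> carrier G" "\<kappa> > 0"
    "\<forall>x\<in>X. \<forall>y\<in>X. (\<forall>g\<in>E. \<rho> (\<alpha> g x) (\<alpha> g y) < \<kappa>) \<longrightarrow> (\<forall>b\<in>W. x b = y b)"
proof -
  let ?P = "prod_topology (pointwise_topology X) (pointwise_topology X)"
  let ?K = "\<Union>b\<in>W. {z \<in> X \<times> X. fst z b \<noteq> snd z b}"
  let ?U = "\<lambda>(g, m :: nat). {z \<in> topspace ?P. \<rho> (\<alpha> g (fst z)) (\<alpha> g (snd z)) \<in> {1 / real (Suc m)<..}}"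
  have K: "closedin ?P ?K"
    using W openin_coordinate_differs(2)[of X] by (intro closedin_Union) auto
  have U_gm: "openin ?P (?U (g, m))" if "g \<in> carrier G" for g m
  proof -
    have 1: "continuous_map ?P ?P (\<lambda>z. (\<alpha> g (fst z), \<alpha> g (snd z)))"
      using \<alpha>[OF that]
      by (intro continuous_map_pairedI continuous_map_compose[OF continuous_map_fst, unfolded o_def]
          continuous_map_compose[OF continuous_map_snd, unfolded o_def])
    have 2: "continuous_map ?P euclideanreal (\<lambda>(x, y). \<rho> x y)"
      using \<rho> by (simp add: generating_pseudometric_def)
    have "continuous_map ?P euclideanreal (\<lambda>z. \<rho> (\<alpha> g (fst z)) (\<alpha> g (snd z)))"
      using continuous_map_compose[OF 1 2] by (simp add: o_def)
    then show ?thesis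
      unfolding prod.case by (rule openin_continuous_map_preimage) simp
  qed
  then have U: "openin ?P (?U i)" if "i \<in> carrier G \<times> UNIV" for i
    using U_gm[of "fst i" "snd i"] that by auto
  have separating: "x \<noteq> y \<longrightarrow> (\<exists>g\<in>carrier G. \<rho> (\<alpha> g x) (\<alpha> g y) > 0)" if "x \<in> X" "y \<in> X" for x y
    using \<rho> that unfolding generating_pseudometric_def topspace_pointwise_topology by (elim conjE) simp
  have cover: "?K \<subseteq> (\<Union>i\<in>carrier G \<times> UNIV. ?U i)"
  proof
    fix z assume "z \<in> ?K"
    then obtain x y b where z: "z = (x, y)" "x \<in> X" "y \<in> X" and "x b \<noteq> y b" by force
    then have "x \<noteq> y" by blast
    with separating[OF z(2,3)] obtain g where g: "g \<in> carrier G" "\<rho> (\<alpha> g x) (\<alpha> g y) > 0"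
      by blast
    then obtain m where "inverse (real (Suc m)) < \<rho> (\<alpha> g x) (\<alpha> g y)"
      using reals_Archimedean by blast
    then have "z \<in> ?U (g, m)" using z by (simp add: inverse_eq_divide)
    then show "z \<in> (\<Union>i\<in>carrier G \<times> UNIV. ?U i)" using g by blast
  qed
  obtain J where J: "finite J" "J \<subseteq> carrier G \<times> UNIV" "?K \<subseteq> (\<Union>i\<in>J. ?U i)"
    by (rule finite_subcover_pairs[OF X K U cover])
  \<comment> \<open>A common bound for the finitely many denominators gives the uniform separation \<open>1 / (M + 1)\<close>.\<close>
  obtain M where M: "\<forall>m\<in>snd ` J. m \<le> M"
    using J(1) finite_nat_set_iff_bounded_le[of "snd ` J"] by auto
  have agree: "x b = y b" if x: "x \<in> X" "y \<in> X" "\<forall>g\<in>fst ` J. \<rho> (\<alpha> g x) (\<alpha> g y) < 1 / real (Suc M)" and b: "b \<in> W"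
    for x y b
  proof (rule ccontr)
    assume "x b \<noteq> y b"
    then have "(x, y) \<in> ?K" using x(1,2) b by (intro UN_I[OF b]) simp
    then obtain i where i: "i \<in> J" "(x, y) \<in> ?U i" using J(3) by blast
    obtain g m where "i = (g, m)" by (cases i)
    with i have gm: "(g, m) \<in> J" "\<rho> (\<alpha> g x) (\<alpha> g y) > 1 / real (Suc m)" by simp_all
    have "m \<le> M" using M gm(1) by force
    then have "1 / real (Suc M) \<le> 1 / real (Suc m)" by (simp add: frac_le)
    moreover have "\<rho> (\<alpha> g x) (\<alpha> g y) < 1 / real (Suc M)" using x(3) gm(1) by force
    ultimately show False using gm(2) by simp
  qed
  have "\<forall>x\<in>X. \<forall>y\<in>X. (\<forall>g\<in>fst ` J. \<rho> (\<alpha> g x) (\<alpha> g y) < 1 / real (Suc M)) \<longrightarrow> (\<forall>b\<in>W. x b = y b)"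
    by (intro ballI impI) (rule agree)
  moreover have "finite (fst ` J)" "fst ` J \<subseteq> carrier G" using J by auto
  ultimately show thesis by (intro that[of "fst ` J" "1 / real (Suc M)"]) simp_all
qed

section \<open>Free cocompact actions on simplicial complexes\<close>

locale simplicial_G_complex =
  fixes G (structure) and L :: "'v set set" and a :: "'g \<Rightarrow> 'v \<Rightarrow> 'v"
  assumes complex: "abstract_simplicial_complex L" and action: "simplicial_action G L a"
begin

sublocale group_action G "\<Union>L" a
  using action by (simp add: simplicial_action_def)

sublocale group G
  using group_hom by (simp add: group_hom_def)

lemma simplex_finite: "s \<in> L \<Longrightarrow> finite s" and simplex_nonempty: "s \<in> L \<Longrightarrow> s \<noteq> {}"
  using complex by (auto simp: abstract_simplicial_complex_def)

lemma act_simplex: "g \<in> carrier G \<Longrightarrow> s \<in> L \<Longrightarrow> a g ` s \<in> L"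
  using action by (simp add: simplicial_action_def)

lemma act_one: "v \<in> \<Union>L \<Longrightarrow> a \<one> v = v"
  using id_eq_one by (metis restrict_apply')

lemma act_mult: "g \<in> carrier G \<Longrightarrow> h \<in> carrier G \<Longrightarrow> v \<in> \<Union>L \<Longrightarrow> a (g \<otimes> h) v = a g (a h v)"
  using composition_rule by simp

lemma act_inv: "g \<in> carrier G \<Longrightarrow> v \<in> \<Union>L \<Longrightarrow> a (inv g) (a g v) = v"
  "g \<in> carrier G \<Longrightarrow> v \<in> \<Union>L \<Longrightarrow> a g (a (inv g) v) = v"
  by (simp_all add: act_mult [symmetric] act_one)

lemma act_simplex_one:
  assumes "s \<in> L" shows "a \<one> ` s = s"
proof -
  have "a \<one> ` s = id ` s"
  proof (rule image_cong)
    fix v assume "v \<in> s"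
    then show "a \<one> v = id v" using assms act_one[of v] by auto
  qed simp
  then show ?thesis by simp
qed

lemma act_simplex_mult: 
  assumes "g \<in> carrier G" "h \<in> carrier G" "s \<in> L"
  shows "a (g \<otimes> h) ` s = a g ` a h ` s"
proof -
  have "a (g \<otimes> h) v = a g (a h v)" if "v \<in> s" for v
    using that assms act_mult by blast
  then show ?thesis by (force simp: image_image)
qed

lemma act_simplex_inv: "g \<in> carrier G \<Longrightarrow> s \<in> L \<Longrightarrow> a (inv g) ` a g ` s = s"
  "g \<in> carrier G \<Longrightarrow> s \<in> L \<Longrightarrow> a g ` a (inv g) ` s = s"
  by (simp_all add: act_simplex_mult [symmetric] act_simplex_one)

text \<open>Freeness and cocompactness speak of points of the realization; barycentres carry them over to
  simplices.\<close>
definition barycentre :: "'v set \<Rightarrow> 'v \<Rightarrow> real" where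
  "barycentre s = (\<lambda>v. if v \<in> s then 1 / real (card s) else 0)"

lemma support_barycentre: "s \<in> L \<Longrightarrow> {v. barycentre s v \<noteq> 0} = s"
  using simplex_finite[of s] simplex_nonempty[of s] by (auto simp: barycentre_def)

lemma barycentre_inject: "s \<in> L \<Longrightarrow> t \<in> L \<Longrightarrow> barycentre s = barycentre t \<Longrightarrow> s = t"
  by (metis support_barycentre)

lemma barycentre_in_realization: "s \<in> L \<Longrightarrow> barycentre s \<in> realization L"
  using simplex_finite[of s] simplex_nonempty[of s]
  unfolding realization_def by (simp add: support_barycentre) (simp add: barycentre_def)

lemma realization_action_barycentre:
  assumes g: "g \<in> carrier G" and s: "s \<in> L"
  shows "realization_action G L a g (barycentre s) = barycentre (a g ` s)"
proof
  fix v
  have "inj_on (a g) s" using inj_prop[OF g] s by (meson Sup_upper inj_on_subset)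
  then have card: "card (a g ` s) = card s" by (rule card_image)
  have "a (inv g) v \<in> s \<longleftrightarrow> v \<in> a g ` s" if v: "v \<in> \<Union>L"
  proof
    assume "a (inv g) v \<in> s"
    then have "a g (a (inv g) v) \<in> a g ` s" by blast
    then show "v \<in> a g ` s" using act_inv(2)[OF g v] by simp
  next
    assume "v \<in> a g ` s"
    then obtain w where "w \<in> s" "v = a g w" by blast
    then show "a (inv g) v \<in> s" using act_inv(1)[OF g UnionI[OF s, of w]] by simp
  qed
  moreover have "v \<notin> a g ` s" if "v \<notin> \<Union>L" using that act_simplex[OF g s] by blast
  ultimately show "realization_action G L a g (barycentre s) v = barycentre (a g ` s) v"
    by (auto simp: realization_action_def barycentre_def card)
qed

lemma realization_action_one: "t \<in> realization L \<Longrightarrow> realization_action G L a \<one> t = t"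
proof
  fix v assume t: "t \<in> realization L"
  show "realization_action G L a \<one> t v = t v"
  proof (cases "v \<in> \<Union>L")
    case True then show ?thesis by (simp add: realization_action_def act_one)
  next
    case False
    then have "t v = 0" using t unfolding realization_def by blast
    with False show ?thesis by (simp add: realization_action_def)
  qed
qed

lemma stabilizer_trivial:
  assumes "free_action G L a" "g \<in> carrier G" "s \<in> L" "a g ` s = s"
  shows "g = \<one>"
proof -
  have "realization_action G L a g (barycentre s) = barycentre s"
    using realization_action_barycentre[OF assms(2,3)] assms(4) by simp
  then show ?thesis
    using assms(1,2) barycentre_in_realization[OF assms(3)] unfolding free_action_def by blast
qed

text \<open>Every set of barycentres is closed in the weak topology, because a closed cell contains only the
  barycentres of its finitely many faces.\<close>
lemma openin_realization_minus_barycentres: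
  assumes "S \<subseteq> barycentre ` L"
  shows "openin (realization_topology L) (realization L - S)"
  unfolding openin_realization_topology
proof (intro conjI ballI)
  fix s assume s: "s \<in> L"
  have closed_point: "closed {f}" for f :: "'v \<Rightarrow> real"
  proof -
    have "{f} = (\<Inter>v. {g. g v = f v})" by auto
    moreover have "closed {g :: 'v \<Rightarrow> real. g v = f v}" for v
      by (intro closed_Collect_eq continuous_on_product_coordinates continuous_on_const)
    ultimately show ?thesis by (simp add: closed_INT)
  qed
  have "S \<inter> closed_cell L s \<subseteq> barycentre ` Pow s"
    using assms support_barycentre by (auto simp: closed_cell_def)
  then have "finite (S \<inter> closed_cell L s)"
    using simplex_finite[OF s] by (meson finite_Pow_iff finite_imageI finite_subset)
  then have "closed (\<Union>f \<in> S \<inter> closed_cell L s. {f})"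
    by (intro closed_UN) (auto simp: closed_point)
  then have "closed (S \<inter> closed_cell L s)" by (simp only: UN_singleton)
  then have "openin (top_of_set (closed_cell L s)) (closed_cell L s \<inter> - (S \<inter> closed_cell L s))"
    by (intro openin_open_Int open_Compl)
  moreover have "closed_cell L s \<inter> - (S \<inter> closed_cell L s) = (realization L - S) \<inter> closed_cell L s"
    by (auto simp: closed_cell_def)
  ultimately show "openin (top_of_set (closed_cell L s)) ((realization L - S) \<inter> closed_cell L s)"
    by simp
qed auto

lemma topspace_realization_topology: "topspace (realization_topology L) = realization L"
proof
  show "topspace (realization_topology L) \<subseteq> realization L"
    using openin_topspace[of "realization_topology L"] unfolding openin_realization_topology by blast
  show "realization L \<subseteq> topspace (realization_topology L)"
    using openin_realization_minus_barycentres[of "{}"] openin_subset by fastforce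
qed

text \<open>The set \<open>U s\<close> leaves out all orbits of barycentres except that of the barycentre of \<open>s\<close>. It is open by
  the previous lemma, so finitely many sets \<open>U s\<close> cover the quotient; as each contains only one orbit of
  barycentres, there are only finitely many such orbits.\<close>
lemma finitely_many_orbits_of_simplices:
  assumes "cocompact_action G L a"
  obtains R where "finite R" "R \<subseteq> L" "\<forall>s\<in>L. \<exists>r\<in>R. \<exists>g\<in>carrier G. s = a g ` r"
proof -
  let ?X = "realization_topology L" and ?b = barycentre
  let ?q = "Group_Action.orbit G (realization_action G L a)"
  let ?Y = "quotient_topology ?X ?q"
  have Y: "topspace ?Y = ?q ` realization L"
    using quotient_map_quotient_topology[of ?X ?q] topspace_realization_topology
    by (simp add: quotient_map_def)
  have self: "t \<in> ?q t" if "t \<in> realization L" for t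
    using realization_action_one[OF that] unfolding orbit_def by force
  have orbit_b: "?q (?b s) = ?b ` {a g ` s | g. g \<in> carrier G}" if "s \<in> L" for s
  proof -
    have "?q (?b s) = {?b (a g ` s) | g. g \<in> carrier G}"
      unfolding orbit_def using realization_action_barycentre[OF _ that]
      by (intro Collect_cong ex_cong1) auto
    then show ?thesis by (simp add: image_Collect setcompr_eq_image image_image)
  qed
  define U where "U s = {T \<in> ?q ` realization L. T = ?q (?b s) \<or> T \<notin> ?q ` ?b ` L}" for s
  have "openin ?Y (U s)" if "s \<in> L" for s
  proof -
    let ?S = "{t \<in> realization L. ?q t \<noteq> ?q (?b s) \<and> ?q t \<in> ?q ` ?b ` L}"
    have "?S \<subseteq> ?b ` L"
    proof
      fix t assume t: "t \<in> ?S"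
      then obtain r where "r \<in> L" "?q t = ?q (?b r)" by auto
      then have "t \<in> ?b ` {a g ` r | g. g \<in> carrier G}" using self[of t] t orbit_b by auto
      then show "t \<in> ?b ` L" using act_simplex \<open>r \<in> L\<close> by blast
    qed
    then have "openin ?X (realization L - ?S)" by (rule openin_realization_minus_barycentres)
    moreover have "realization L - ?S = {t \<in> topspace ?X. ?q t \<in> U s}"
      by (auto simp: U_def topspace_realization_topology)
    ultimately show ?thesis
      unfolding openin_quotient_topology by (auto simp: U_def topspace_realization_topology)
  qed
  moreover have "topspace ?Y \<subseteq> (\<Union>s\<in>L. U s) \<or> L = {}"
    unfolding Y U_def by blast
  moreover have "compact_space ?Y" using assms by (simp add: cocompact_action_def)
  ultimately have "L = {} \<or> (\<exists>\<F>. finite \<F> \<and> \<F> \<subseteq> U ` L \<and> topspace ?Y \<subseteq> \<Union>\<F>)"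
    unfolding compact_space_alt by (metis (no_types, lifting) imageE)
  then obtain R where R: "finite R" "R \<subseteq> L" "L = {} \<or> topspace ?Y \<subseteq> (\<Union>s\<in>R. U s)"
    using finite_subset_image by (metis empty_subsetI finite.emptyI)
  have "\<exists>r\<in>R. \<exists>g\<in>carrier G. s = a g ` r" if s: "s \<in> L" for s
  proof -
    have "?q (?b s) \<in> topspace ?Y" using s barycentre_in_realization by (simp add: Y)
    then obtain r where r: "r \<in> R" "?q (?b s) \<in> U r" using R(3) s by blast
    then have "?q (?b s) = ?q (?b r)" using s by (auto simp: U_def)
    then have "?b s \<in> ?b ` {a g ` r | g. g \<in> carrier G}"
      using self[OF barycentre_in_realization[OF s]] orbit_b r R(2) by auto
    then obtain g where "g \<in> carrier G" "?b s = ?b (a g ` r)" by blast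
    then show ?thesis using r(1) R(2) barycentre_inject[OF s] act_simplex by blast
  qed
  with R that show thesis by blast
qed

text \<open>Stabilizers of simplices are trivial, so each simplex is the translate of the chosen representative
  of its orbit by exactly one group element, and \<open>\<gamma>\<close> picks that element. The simplices with \<open>\<gamma> s = \<one>\<close>
  are the representatives themselves.\<close>
lemma equivariant_map_to_group_exists:
  assumes free: "free_action G L a" and cocompact: "cocompact_action G L a"
  obtains \<gamma> where "\<forall>s\<in>L. \<gamma> s \<in> carrier G"
    and "\<forall>g\<in>carrier G. \<forall>s\<in>L. \<gamma> (a g ` s) = g \<otimes> \<gamma> s"
    and "finite {s \<in> L. \<gamma> s = \<one>}"
proof -
  obtain R where R: "finite R" "R \<subseteq> L" "\<forall>s\<in>L. \<exists>r\<in>R. \<exists>g\<in>carrier G. s = a g ` r"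
    by (rule finitely_many_orbits_of_simplices[OF cocompact])
  define rep where "rep s = (SOME r. r \<in> R \<and> (\<exists>g\<in>carrier G. s = a g ` r))" for s
  have "rep s \<in> R \<and> (\<exists>g\<in>carrier G. s = a g ` rep s)" if "s \<in> L" for s
    unfolding rep_def by (rule someI_ex) (use bspec[OF R(3) that] in \<open>simp only: Bex_def\<close>)
  then have rep: "rep s \<in> R" "\<exists>g\<in>carrier G. s = a g ` rep s" if "s \<in> L" for s
    using that by simp_all
  have unique: "g = h" if "g \<in> carrier G" "h \<in> carrier G" "r \<in> L" "a g ` r = a h ` r" for g h r
  proof -
    have "a (inv h \<otimes> g) ` r = r"
      using that by (simp add: act_simplex_mult act_simplex_inv)
    then have "inv h \<otimes> g = \<one>" using that by (intro stabilizer_trivial[OF free]) auto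
    then show ?thesis using that by (metis inv_closed inv_equality inv_inv)
  qed
  define \<gamma> where "\<gamma> s = (THE g. g \<in> carrier G \<and> s = a g ` rep s)" for s
  have \<gamma>_eq: "\<gamma> s = g" if "s \<in> L" "g \<in> carrier G" "s = a g ` rep s" for s g
    unfolding \<gamma>_def using that rep(1)[OF that(1)] R(2) unique by (intro the_equality) auto
  have \<gamma>: "\<gamma> s \<in> carrier G" "s = a (\<gamma> s) ` rep s" if s: "s \<in> L" for s
    using rep(2)[OF s] \<gamma>_eq[OF s] by auto
  have rep_act: "rep (a g ` s) = rep s" if g: "g \<in> carrier G" and s: "s \<in> L" for g s
  proof -
    have "(\<exists>h\<in>carrier G. a g ` s = a h ` r) \<longleftrightarrow> (\<exists>h\<in>carrier G. s = a h ` r)" if "r \<in> R" for r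
    proof safe
      fix h assume h: "h \<in> carrier G" "a g ` s = a h ` r"
      then have "s = a (inv g) ` a h ` r" using act_simplex_inv(1)[OF g s] by simp
      then have "s = a (inv g \<otimes> h) ` r"
        using h g \<open>r \<in> R\<close> R(2) by (subst act_simplex_mult) auto
      then show "\<exists>h\<in>carrier G. s = a h ` r" using g h by blast
    next
      fix h assume h: "h \<in> carrier G" "s = a h ` r"
      then have "a g ` a h ` r = a (g \<otimes> h) ` r"
        using g \<open>r \<in> R\<close> R(2) by (subst act_simplex_mult) auto
      then show "\<exists>h'\<in>carrier G. a g ` a h ` r = a h' ` r" using g h by blast
    qed
    then have "(\<lambda>r. r \<in> R \<and> (\<exists>h\<in>carrier G. a g ` s = a h ` r)) = (\<lambda>r. r \<in> R \<and> (\<exists>h\<in>carrier G. s = a h ` r))"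
      by (intro ext conj_cong refl)
    then show ?thesis unfolding rep_def by (simp only:)
  qed
  show thesis
  proof (rule that[of \<gamma>])
    show "\<forall>s\<in>L. \<gamma> s \<in> carrier G" using \<gamma> by blast
    show "\<forall>g\<in>carrier G. \<forall>s\<in>L. \<gamma> (a g ` s) = g \<otimes> \<gamma> s"
    proof (intro ballI, rule \<gamma>_eq)
      fix g s assume g: "g \<in> carrier G" and s: "s \<in> L"
      show "a g ` s \<in> L" using g s act_simplex by blast
      show "g \<otimes> \<gamma> s \<in> carrier G" using g \<gamma> s by blast
      have "a (g \<otimes> \<gamma> s) ` rep s = a g ` a (\<gamma> s) ` rep s"
        using g \<gamma>[OF s] rep[OF s] R(2) by (intro act_simplex_mult) auto
      then show "a g ` s = a (g \<otimes> \<gamma> s) ` rep (a g ` s)"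
        using \<gamma>(2)[OF s] rep_act[OF g s] by simp
    qed
    have "s \<in> R" if "s \<in> L" "\<gamma> s = \<one>" for s
    proof -
      have "rep s \<in> L" using rep(1)[OF that(1)] R(2) by blast
      then have "s = rep s" using \<gamma>(2)[OF that(1)] act_simplex_one that(2) by simp
      then show ?thesis using rep(1)[OF that(1)] by simp
    qed
    then have "{s \<in> L. \<gamma> s = \<one>} \<subseteq> R" by blast
    then show "finite {s \<in> L. \<gamma> s = \<one>}" using R(1) finite_subset by blast
  qed
qed

end

section \<open>Cocycle conditions and translation\<close>

text \<open>The set \<open>T\<close> of tested simplices lets one entropy computation serve both for the full cochain group
  (\<open>T = {}\<close>) and for the kernel of the coboundary map (\<open>T\<close> all simplices of dimension \<open>i + 1\<close>).\<close>
definition cocycles_on :: "'v set set \<Rightarrow> 'v list set \<Rightarrow> nat \<Rightarrow> ('v list \<Rightarrow> 'k :: field) set" where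
  "cocycles_on L T i = {c \<in> cochains L i. \<forall>vs\<in>T. coboundary L (Suc i) c vs = 0}"

lemma coboundary_add:
  "coboundary L i (\<lambda>v. c v + d v) = (\<lambda>v. coboundary L i c v + coboundary L i d v)"
  by (auto simp: coboundary_def algebra_simps sum.distrib)

lemma coboundary_smult:
  "coboundary L i (\<lambda>v. r * c v) = (\<lambda>v. r * coboundary L i c v)"
  by (auto simp: coboundary_def sum_distrib_left mult_ac)

lemma coboundary_diff:
  "coboundary L i (\<lambda>v. c v - d v) = (\<lambda>v. coboundary L i c v - coboundary L i d v)"
  by (auto simp: coboundary_def algebra_simps sum_subtractf)

lemma coboundary_zero: "coboundary L i (\<lambda>_. 0) = (\<lambda>_. 0)"
  by (auto simp: coboundary_def)

lemma linear_set_cochains: "linear_set (cochains L i)"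
  unfolding linear_set_def cochains_def by (auto simp: algebra_simps)

lemma linear_set_cocycles_on: "linear_set (cocycles_on L T i)"
proof -
  note l = linear_setD[OF linear_set_cochains]
  show ?thesis
    unfolding linear_set_def
  proof (intro conjI ballI allI)
    show "(\<lambda>_. 0) \<in> cocycles_on L T i"
      using l(1) by (auto simp: cocycles_on_def coboundary_zero)
    show "(\<lambda>x. c x + d x) \<in> cocycles_on L T i" if "c \<in> cocycles_on L T i" "d \<in> cocycles_on L T i" for c d
      using that l(2)[of c L i d] unfolding cocycles_on_def by (auto simp: coboundary_add)
    show "(\<lambda>x. r * c x) \<in> cocycles_on L T i" if "c \<in> cocycles_on L T i" for c r
      using that l(3)[of c L i r] unfolding cocycles_on_def by (auto simp: coboundary_smult)
  qed
qed

lemma cocycles_on_subset: "cocycles_on L T i \<subseteq> cochains L i"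
  by (auto simp: cocycles_on_def)

lemma cochain_zero: "c \<in> cochains L i \<Longrightarrow> vs \<notin> ordered_simplices L i \<Longrightarrow> c vs = 0"
  by (auto simp: cochains_def)

lemma cochain_eqI:
  assumes "c \<in> cochains L i" "d \<in> cochains L i" "\<And>vs. vs \<in> ordered_simplices L i \<Longrightarrow> c vs = d vs"
  shows "c = d"
proof
  fix vs show "c vs = d vs"
    using assms cochain_zero[of c L i vs] cochain_zero[of d L i vs] by (cases "vs \<in> ordered_simplices L i") auto
qed

lemma coboundary_cong_faces:
  assumes "\<And>j. j \<le> i \<Longrightarrow> c (face j vs) = d (face j vs)"
  shows "coboundary L i c vs = coboundary L i d vs"
  unfolding coboundary_eq by (auto intro!: sum.cong simp: assms)

text \<open>A function outside the set violates one of the defining conditions, and each condition involves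
  finitely many coordinates.\<close>
lemma closedin_cocycles_on:
  "closedin full_shift_topology (cocycles_on L T i :: ('v list \<Rightarrow> 'k :: field) set)"
proof (rule closedin_full_shiftI)
  fix c :: "'v list \<Rightarrow> 'k" assume c: "c \<notin> cocycles_on L T i"
  consider vs where "vs \<notin> ordered_simplices L i" "c vs \<noteq> 0"
    | vs \<pi> where "vs \<in> ordered_simplices L i" "\<pi> permutes {..<length vs}"
        "c (permute_list \<pi> vs) \<noteq> of_int (sign \<pi>) * c vs"
    | vs where "vs \<in> T" "coboundary L (Suc i) c vs \<noteq> 0"
    using c unfolding cocycles_on_def cochains_def by blast
  then show "\<exists>V. finite V \<and> (\<forall>c'. (\<forall>b\<in>V. c' b = c b) \<longrightarrow> c' \<notin> cocycles_on L T i)"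
  proof cases
    case (1 vs)
    show ?thesis
    proof (intro exI[of _ "{vs}"] conjI allI impI)
      fix c' :: "'v list \<Rightarrow> 'k" assume "\<forall>b\<in>{vs}. c' b = c b"
      then have "c' vs \<noteq> 0" using 1 by simp
      then show "c' \<notin> cocycles_on L T i" using 1 cochain_zero cocycles_on_subset by blast
    qed simp
  next
    case (2 vs \<pi>)
    show ?thesis
    proof (intro exI[of _ "{vs, permute_list \<pi> vs}"] conjI allI impI)
      fix c' :: "'v list \<Rightarrow> 'k" assume "\<forall>b\<in>{vs, permute_list \<pi> vs}. c' b = c b"
      then have "c' (permute_list \<pi> vs) \<noteq> of_int (sign \<pi>) * c' vs" using 2 by simp
      then show "c' \<notin> cocycles_on L T i" using 2 unfolding cocycles_on_def cochains_def by blast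
    qed simp
  next
    case (3 vs)
    show ?thesis
    proof (intro exI[of _ "(\<lambda>j. face j vs) ` {..Suc i}"] conjI allI impI)
      fix c' :: "'v list \<Rightarrow> 'k" assume "\<forall>b\<in>(\<lambda>j. face j vs) ` {..Suc i}. c' b = c b"
      then have "coboundary L (Suc i) c' vs = coboundary L (Suc i) c vs"
        by (intro coboundary_cong_faces) simp
      then have "coboundary L (Suc i) c' vs \<noteq> 0" using 3(2) by simp
      then show "c' \<notin> cocycles_on L T i" using 3(1) unfolding cocycles_on_def by blast
    qed simp
  qed
qed

context simplicial_G_complex
begin

abbreviation tr :: "'g \<Rightarrow> ('v list \<Rightarrow> 'k :: field) \<Rightarrow> 'v list \<Rightarrow> 'k" where
  "tr \<equiv> cochain_action G L a"

lemma set_map_act: "g \<in> carrier G \<Longrightarrow> set vs \<in> L \<Longrightarrow> set (map (a g) vs) \<in> L"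
  by (simp add: act_simplex)

lemma map_act_mult:
  assumes "g \<in> carrier G" "h \<in> carrier G" "set vs \<in> L"
  shows "map (a g) (map (a h) vs) = map (a (g \<otimes> h)) vs"
proof -
  have "a (g \<otimes> h) v = a g (a h v)" if "v \<in> set vs" for v
    using act_mult[OF assms(1,2) UnionI[OF assms(3) that]] .
  then show ?thesis by simp
qed

lemma map_act_one: "set vs \<in> L \<Longrightarrow> map (a \<one>) vs = vs"
  using act_one by (intro map_idI) blast

lemma map_act_inv:
  assumes "g \<in> carrier G" "set vs \<in> L"
  shows "map (a (inv g)) (map (a g) vs) = vs" "map (a g) (map (a (inv g)) vs) = vs"
  using assms by (simp_all only: map_act_mult inv_closed l_inv r_inv map_act_one)

lemma ordered_simplicesD:
  "vs \<in> ordered_simplices L i \<Longrightarrow> set vs \<in> L"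
  by (simp add: ordered_simplices_def)

lemma map_act_ordered_simplices:
  assumes "g \<in> carrier G" "vs \<in> ordered_simplices L i"
  shows "map (a g) vs \<in> ordered_simplices L i"
proof -
  have "inj_on (a g) (set vs)"
    using inj_prop[OF assms(1)] ordered_simplicesD[OF assms(2)] by (meson Sup_upper inj_on_subset)
  then show ?thesis
    using assms act_simplex by (auto simp: ordered_simplices_def distinct_map)
qed

lemma map_act_ordered_simplices_iff:
  assumes "g \<in> carrier G" "set vs \<in> L"
  shows "map (a g) vs \<in> ordered_simplices L i \<longleftrightarrow> vs \<in> ordered_simplices L i"
proof
  assume "map (a g) vs \<in> ordered_simplices L i"
  then have "map (a (inv g)) (map (a g) vs) \<in> ordered_simplices L i"
    by (rule map_act_ordered_simplices[OF inv_closed[OF assms(1)]])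
  then show "vs \<in> ordered_simplices L i" by (simp only: map_act_inv[OF assms])
qed (rule map_act_ordered_simplices[OF assms(1)])

lemma tr_apply: "set vs \<in> L \<Longrightarrow> tr g c vs = c (map (a (inv g)) vs)"
  by (simp add: cochain_action_def)

lemma tr_map_act: "g \<in> carrier G \<Longrightarrow> set vs \<in> L \<Longrightarrow> tr g c (map (a g) vs) = c vs"
  using map_act_inv(1)[of g vs] set_map_act[of g vs] by (simp add: tr_apply del: map_map list.set_map)

lemma tr_mult:
  assumes "g \<in> carrier G" "h \<in> carrier G"
  shows "tr g (tr h c) = tr (g \<otimes> h) c"
proof
  fix vs show "tr g (tr h c) vs = tr (g \<otimes> h) c vs"
  proof (cases "set vs \<in> L")
    case True
    have "tr g (tr h c) vs = c (map (a (inv h)) (map (a (inv g)) vs))"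
      using True set_map_act[of "inv g" vs] assms by (simp add: tr_apply del: map_map list.set_map)
    also have "map (a (inv h)) (map (a (inv g)) vs) = map (a (inv (g \<otimes> h))) vs"
      using True assms by (simp only: map_act_mult inv_closed inv_mult_group)
    finally show ?thesis using True by (simp add: tr_apply)
  qed (simp add: cochain_action_def)
qed

lemma tr_in_cochains:
  assumes "g \<in> carrier G" "c \<in> cochains L i"
  shows "tr g c \<in> cochains L i"
  unfolding cochains_def
proof (intro CollectI conjI allI impI ballI)
  fix vs assume vs: "vs \<notin> ordered_simplices L i"
  show "tr g c vs = 0"
  proof (cases "set vs \<in> L")
    case True
    then have "map (a (inv g)) vs \<notin> ordered_simplices L i"
      using vs map_act_ordered_simplices_iff[of "inv g" vs i] assms by simp
    then show ?thesis using assms True cochain_zero by (auto simp: tr_apply)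
  qed (simp add: cochain_action_def)
next
  fix vs \<pi> assume vs: "vs \<in> ordered_simplices L i" and \<pi>: "\<pi> permutes {..<length vs}"
  let ?w = "map (a (inv g)) vs"
  have w: "?w \<in> ordered_simplices L i" using map_act_ordered_simplices[of "inv g"] vs assms by simp
  have "tr g c (permute_list \<pi> vs) = c (permute_list \<pi> ?w)"
    using \<pi> vs ordered_simplicesD[OF vs] by (simp add: tr_apply permute_list_map)
  also have "\<dots> = of_int (sign \<pi>) * c ?w"
    using assms(2) w \<pi> unfolding cochains_def by simp
  finally show "tr g c (permute_list \<pi> vs) = of_int (sign \<pi>) * tr g c vs"
    using ordered_simplicesD[OF vs] by (simp add: tr_apply)
qed

lemma tr_one: "c \<in> cochains L i \<Longrightarrow> tr \<one> c = c"
  by (rule cochain_eqI[OF tr_in_cochains])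
     (auto simp: tr_apply map_act_one dest: ordered_simplicesD)

lemma tr_inv: 
  assumes "g \<in> carrier G" "c \<in> cochains L i"
  shows "tr (inv g) (tr g c) = c" "tr g (tr (inv g) c) = c"
  using assms by (simp_all add: tr_mult tr_one)

lemma tr_diff: "tr g (\<lambda>v. c v - d v) = (\<lambda>v. tr g c v - tr g d v)"
  and tr_add: "tr g (\<lambda>v. c v + d v) = (\<lambda>v. tr g c v + tr g d v)"
  and tr_smult: "tr g (\<lambda>v. r * c v) = (\<lambda>v. r * tr g c v)"
  and tr_zero: "tr g (\<lambda>v. 0) = (\<lambda>v. 0)"
  by (auto simp: cochain_action_def)

lemma coboundary_tr:
  assumes g: "g \<in> carrier G"
  shows "coboundary L (Suc i) (tr g c) = tr g (coboundary L (Suc i) c)"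
proof
  fix vs
  show "coboundary L (Suc i) (tr g c) vs = tr g (coboundary L (Suc i) c) vs"
  proof (cases "vs \<in> ordered_simplices L (Suc i)")
    case True
    let ?w = "map (a (inv g)) vs"
    have w: "?w \<in> ordered_simplices L (Suc i)"
      using map_act_ordered_simplices[of "inv g"] True g by simp
    have "tr g c (face j vs) = c (face j ?w)" if "j \<le> Suc i" for j
      using face_in_ordered_simplices[OF complex True that]
      by (simp add: tr_apply ordered_simplicesD face_map)
    then have "coboundary L (Suc i) (tr g c) vs = coboundary L (Suc i) c ?w"
      unfolding coboundary_eq using True w by (auto intro!: sum.cong)
    then show ?thesis using ordered_simplicesD[OF True] by (simp add: tr_apply)
  next
    case False
    have "tr g (coboundary L (Suc i) c) vs = 0"
    proof (cases "set vs \<in> L")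
      case True
      then have "map (a (inv g)) vs \<notin> ordered_simplices L (Suc i)"
        using False map_act_ordered_simplices_iff[of "inv g" vs "Suc i"] g by simp
      then show ?thesis using True by (simp add: tr_apply coboundary_eq)
    qed (simp add: cochain_action_def)
    with False show ?thesis by (simp add: coboundary_eq)
  qed
qed

lemma tr_in_cocycles_on:
  assumes T: "\<And>h vs. h \<in> carrier G \<Longrightarrow> vs \<in> T \<Longrightarrow> map (a h) vs \<in> T"
    and TL: "T \<subseteq> ordered_simplices L (Suc i)"
    and g: "g \<in> carrier G" and c: "c \<in> cocycles_on L T i"
  shows "tr g c \<in> cocycles_on L T i"
  unfolding cocycles_on_def
proof (intro CollectI conjI ballI)
  show "tr g c \<in> cochains L i" using c cocycles_on_subset by (blast intro: tr_in_cochains[OF g])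
  fix vs assume vs: "vs \<in> T"
  then have "set vs \<in> L" using TL ordered_simplicesD by blast
  then have "coboundary L (Suc i) (tr g c) vs = coboundary L (Suc i) c (map (a (inv g)) vs)"
    by (simp add: coboundary_tr[OF g] tr_apply)
  also have "\<dots> = 0"
    using c T[of "inv g" vs] vs g unfolding cocycles_on_def by simp
  finally show "coboundary L (Suc i) (tr g c) vs = 0" .
qed

lemma continuous_map_tr:
  fixes X :: "('v list \<Rightarrow> 'k :: field) set"
  assumes "\<And>c. c \<in> X \<Longrightarrow> tr g c \<in> X"
  shows "continuous_map (pointwise_topology X) (pointwise_topology X) (tr g)"
proof -
  have "continuous_map (pointwise_topology X) full_shift_topology (tr g :: ('v list \<Rightarrow> 'k) \<Rightarrow> _)"
    unfolding continuous_map_componentwise_UNIV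
  proof
    fix vs
    have "continuous_map (pointwise_topology X) (discrete_topology UNIV)
        (\<lambda>c. if set vs \<in> L then c (map (a (inv g)) vs) else 0)"
      by (cases "set vs \<in> L") (simp_all add: continuous_map_pointwise_coordinate)
    then show "continuous_map (pointwise_topology X) (discrete_topology UNIV) (\<lambda>c. tr g c vs)"
      by (simp add: cochain_action_def)
  qed
  then show ?thesis
    using assms by (subst (2) pointwise_topology_def) (auto simp: continuous_map_in_subtopology)
qed

end

section \<open>Gluing and expanding periodic cochains\<close>

definition fixed_cochains ::
    "('g, 'm) monoid_scheme \<Rightarrow> 'v set set \<Rightarrow> ('g \<Rightarrow> 'v \<Rightarrow> 'v) \<Rightarrow> 'g set \<Rightarrow>
     ('v list \<Rightarrow> 'k :: field) set \<Rightarrow> ('v list \<Rightarrow> 'k) set" where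
  "fixed_cochains G L a H S = {c \<in> S. \<forall>h\<in>H. cochain_action G L a h c = c}"

lemma card_le_card_mult_fibres:
  assumes "finite T" "f ` S \<subseteq> T" "\<And>y. y \<in> T \<Longrightarrow> finite {x \<in> S. f x = y} \<and> card {x \<in> S. f x = y} \<le> k"
  shows "card S \<le> card T * k"
proof -
  have "S = (\<Union>y\<in>T. {x \<in> S. f x = y})" using assms(2) by auto
  then have "card S = card (\<Union>y\<in>T. {x \<in> S. f x = y})" by simp
  also have "\<dots> \<le> (\<Sum>y\<in>T. card {x \<in> S. f x = y})"
    using assms by (intro card_UN_le)
  also have "\<dots> \<le> (\<Sum>y\<in>T. k)" using assms(3) by (intro sum_mono) blast
  finally show ?thesis by simp
qed

text \<open>The existence of \<open>\<gamma>\<close> is what remains of freeness and cocompactness in the rest of the proof. It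
  gives coordinates: every simplex is the translate by \<open>\<gamma> s\<close> of a simplex in a finite fundamental domain.\<close>
locale equivariant_section = simplicial_G_complex G L a
  for G (structure) and L :: "'v set set" and a :: "'g \<Rightarrow> 'v \<Rightarrow> 'v" +
  fixes \<gamma> :: "'v set \<Rightarrow> 'g"
  assumes \<gamma>_carrier: "s \<in> L \<Longrightarrow> \<gamma> s \<in> carrier G"
    and \<gamma>_equivariant: "g \<in> carrier G \<Longrightarrow> s \<in> L \<Longrightarrow> \<gamma> (a g ` s) = g \<otimes> \<gamma> s"
    and finite_domain: "finite {s \<in> L. \<gamma> s = \<one>}"
begin

definition window :: "nat \<Rightarrow> 'v list set" where
  "window i = {vs \<in> ordered_simplices L i. \<gamma> (set vs) = \<one>}"

lemma finite_window: "finite (window i)"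
proof -
  have "window i \<subseteq> (\<Union>s \<in> {s \<in> L. \<gamma> s = \<one>}. {vs. set vs \<subseteq> s \<and> length vs = Suc i})"
    by (auto simp: window_def ordered_simplices_def)
  moreover have "finite (\<Union>s \<in> {s \<in> L. \<gamma> s = \<one>}. {vs. set vs \<subseteq> s \<and> length vs = Suc i})"
    using finite_domain simplex_finite by (auto intro!: finite_lists_length_eq)
  ultimately show ?thesis by (rule finite_subset)
qed

lemma window_ordered_simplices: "window i \<subseteq> ordered_simplices L i"
  by (auto simp: window_def)

lemma \<gamma>_map_act: "g \<in> carrier G \<Longrightarrow> set vs \<in> L \<Longrightarrow> \<gamma> (set (map (a g) vs)) = g \<otimes> \<gamma> (set vs)"
  by (simp add: \<gamma>_equivariant)

lemma map_act_inv_\<gamma>_in_window: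
  assumes "vs \<in> ordered_simplices L i"
  shows "map (a (inv (\<gamma> (set vs)))) vs \<in> window i"
proof -
  have L: "set vs \<in> L" using assms by (rule ordered_simplicesD)
  then show ?thesis
    using assms map_act_ordered_simplices[of "inv (\<gamma> (set vs))" vs i]
      \<gamma>_map_act[of "inv (\<gamma> (set vs))" vs] \<gamma>_carrier[OF L]
    by (simp add: window_def)
qed

text \<open>A map \<open>\<phi>\<close> on cosets is read as a list of candidates \<open>\<phi> (H u)\<close> for the translates \<open>u\<^bsup>-1\<^esup> x\<close> of one
  \<open>H\<close>-invariant cochain \<open>x\<close>. Near the simplex \<open>s\<close> the gluing trusts the candidate for \<open>u = \<gamma> s\<close>, the
  translate that moves \<open>s\<close> into the fundamental domain. This depends only on the underlying set of a list of
  vertices, so that the result is alternating.\<close>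
definition glue :: "'g set \<Rightarrow> ('g set \<Rightarrow> 'v list \<Rightarrow> 'k :: field) \<Rightarrow> 'v list \<Rightarrow> 'k" where
  "glue H \<phi> = (\<lambda>vs. if set vs \<in> L then tr (\<gamma> (set vs)) (\<phi> (H #> \<gamma> (set vs))) vs else 0)"

text \<open>The inverse of gluing, \<open>H u \<mapsto> u\<^bsup>-1\<^esup> x\<close>; for \<open>H\<close>-invariant \<open>x\<close> every representative \<open>u\<close> of the coset
  gives the same value.\<close>
definition expand :: "('v list \<Rightarrow> 'k :: field) \<Rightarrow> 'g set \<Rightarrow> 'v list \<Rightarrow> 'k" where
  "expand x d = tr (inv (SOME u. u \<in> d)) x"

end

locale finite_index = equivariant_section G L a \<gamma>
  for G (structure) and L :: "'v set set" and a :: "'g \<Rightarrow> 'v \<Rightarrow> 'v" and \<gamma> +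
  fixes H :: "'g set"
  assumes subgroup_H: "subgroup H G" and finite_index: "finite (rcosets H)"
begin

abbreviation "D \<equiv> rcosets H"

lemma H_carrier: "H \<subseteq> carrier G"
  using subgroup_H by (rule subgroup.subset)

lemma coset_in_D: "u \<in> carrier G \<Longrightarrow> H #> u \<in> D"
  using H_carrier by (rule rcosetsI)

lemma D_cases: 
  assumes "d \<in> D" obtains u where "u \<in> carrier G" "d = H #> u"
  using assms by (auto simp: RCOSETS_def)

lemma card_D_pos: "card D > 0"
proof -
  have "H #> \<one> \<in> D" by (rule coset_in_D) simp
  then show ?thesis using finite_index by (auto simp: card_gt_0_iff)
qed

lemma shift_coset: "u \<in> carrier G \<Longrightarrow> g \<in> carrier G \<Longrightarrow> H #> u #> g = H #> (u \<otimes> g)"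
  using H_carrier by (simp add: coset_mult_assoc)

lemma shift_in_D: "d \<in> D \<Longrightarrow> g \<in> carrier G \<Longrightarrow> d #> g \<in> D"
  by (elim D_cases) (simp add: shift_coset coset_in_D)

lemma coset_mult_H: "h \<in> H \<Longrightarrow> u \<in> carrier G \<Longrightarrow> H #> (h \<otimes> u) = H #> u"
  using H_carrier coset_join2[of h H] subgroup_H
  by (metis coset_mult_assoc subsetD)

lemma linear_set_fixed: "linear_set S \<Longrightarrow> linear_set (fixed_cochains G L a H S)"
  unfolding fixed_cochains_def
  by (subst linear_set_def) (auto simp: tr_add tr_smult tr_zero intro: linear_setD)

lemma expand_coset:
  assumes x: "x \<in> fixed_cochains G L a H (cochains L i)" and u: "u \<in> carrier G"
  shows "expand x (H #> u) = tr (inv u) x"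
proof -
  have "u \<in> H #> u" using u subgroup_H by (rule rcos_self)
  then have "(SOME v. v \<in> H #> u) \<in> H #> u" by (rule someI)
  then obtain h where h: "h \<in> H" "(SOME v. v \<in> H #> u) = h \<otimes> u"
    by (auto simp: r_coset_def)
  have hG: "h \<in> carrier G" using h H_carrier by blast
  have inv_h: "inv h \<in> H" using h(1) subgroup_H by (simp add: subgroup.m_inv_closed)
  have "expand x (H #> u) = tr (inv u) (tr (inv h) x)"
    using hG u by (simp add: expand_def h(2) inv_mult_group tr_mult)
  then show ?thesis using x inv_h by (simp add: fixed_cochains_def)
qed

lemma expand_in_cochains:
  assumes x: "x \<in> fixed_cochains G L a H (cochains L i)" and d: "d \<in> D"
  shows "expand x d \<in> cochains L i"
proof -
  obtain u where u: "u \<in> carrier G" "d = H #> u" using D_cases[OF d] by blast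
  then show ?thesis
    using x expand_coset[OF x u(1)] by (auto simp: fixed_cochains_def intro: tr_in_cochains)
qed

lemma expand_diff: "expand (\<lambda>v. x v - y v) d = (\<lambda>v. expand x d v - expand y d v)"
  by (simp add: expand_def tr_diff)

lemma glue_in_cochains:
  assumes "\<And>d. d \<in> D \<Longrightarrow> \<phi> d \<in> cochains L i"
  shows "glue H \<phi> \<in> cochains L i"
proof -
  have t: "tr (\<gamma> (set vs)) (\<phi> (H #> \<gamma> (set vs))) \<in> cochains L i" if "set vs \<in> L" for vs
    using that assms coset_in_D \<gamma>_carrier by (intro tr_in_cochains) auto
  show ?thesis
    unfolding cochains_def
  proof (intro CollectI conjI allI impI ballI)
    fix vs assume "vs \<notin> ordered_simplices L i"
    then show "glue H \<phi> vs = 0"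
      using cochain_zero[OF t, of vs vs] by (simp add: glue_def)
  next
    fix vs \<pi> assume vs: "vs \<in> ordered_simplices L i" and \<pi>: "\<pi> permutes {..<length vs}"
    then show "glue H \<phi> (permute_list \<pi> vs) = of_int (sign \<pi>) * glue H \<phi> vs"
      using t[of vs] ordered_simplicesD[OF vs] unfolding cochains_def by (simp add: glue_def)
  qed
qed

text \<open>By equivariance of \<open>\<gamma>\<close>, the value of the glued cochain at \<open>u b\<close> is read from the coset of
  \<open>u \<gamma>(b)\<close>.\<close>
lemma glue_map_act:
  assumes "u \<in> carrier G" "set b \<in> L"
  shows "glue H \<phi> (map (a u) b) = \<phi> (H #> (u \<otimes> \<gamma> (set b))) (map (a (inv (\<gamma> (set b)))) b)"
proof -
  let ?k = "\<gamma> (set b)"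
  have k: "?k \<in> carrier G" using assms by (simp add: \<gamma>_carrier)
  have "glue H \<phi> (map (a u) b) = tr (u \<otimes> ?k) (\<phi> (H #> (u \<otimes> ?k))) (map (a u) b)"
    using assms set_map_act[OF assms] \<gamma>_map_act[OF assms] by (simp add: glue_def del: list.set_map)
  also have "\<dots> = tr (inv u) (tr (u \<otimes> ?k) (\<phi> (H #> (u \<otimes> ?k)))) b"
    using assms by (simp add: tr_apply)
  also have "\<dots> = tr ?k (\<phi> (H #> (u \<otimes> ?k))) b"
    using assms k by (simp add: tr_mult m_assoc [symmetric])
  finally show ?thesis using assms by (simp add: tr_apply)
qed

text \<open>Replacing \<open>b\<close> by \<open>h\<^bsup>-1\<^esup> b\<close> with \<open>h\<close> in \<open>H\<close> multiplies \<open>\<gamma>(b)\<close> on the left by an element of \<open>H\<close>, which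
  changes neither the coset nor the point of the fundamental domain at which \<open>\<phi>\<close> is read.\<close>
lemma glue_fixed:
  assumes "\<And>d. d \<in> D \<Longrightarrow> \<phi> d \<in> cochains L i"
  shows "glue H \<phi> \<in> fixed_cochains G L a H (cochains L i)"
  unfolding fixed_cochains_def
proof (intro CollectI conjI ballI)
  show g: "glue H \<phi> \<in> cochains L i" by (rule glue_in_cochains) fact
  fix h assume h: "h \<in> H"
  then have hG: "h \<in> carrier G" using H_carrier by blast
  have inv_h: "inv h \<in> H" using h subgroup_H by (simp add: subgroup.m_inv_closed)
  show "tr h (glue H \<phi>) = glue H \<phi>"
  proof (rule cochain_eqI[OF tr_in_cochains[OF hG g] g])
    fix vs assume "vs \<in> ordered_simplices L i"
    then have vs: "set vs \<in> L" by (rule ordered_simplicesD)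
    have "tr h (glue H \<phi>) vs = \<phi> (H #> (inv h \<otimes> \<gamma> (set vs))) (map (a (inv (\<gamma> (set vs)))) vs)"
      using glue_map_act[of "inv h" vs] vs hG by (simp add: tr_apply)
    also have "\<dots> = glue H \<phi> vs"
      using vs coset_mult_H[OF inv_h \<gamma>_carrier[OF vs]] by (simp add: glue_def tr_apply)
    finally show "tr h (glue H \<phi>) vs = glue H \<phi> vs" .
  qed
qed

lemma glue_expand:
  assumes x: "x \<in> fixed_cochains G L a H (cochains L i)"
    and \<phi>: "\<And>d b. d \<in> D \<Longrightarrow> b \<in> window i \<Longrightarrow> \<phi> d b = expand x d b"
    and \<phi>_cochains: "\<And>d. d \<in> D \<Longrightarrow> \<phi> d \<in> cochains L i"
  shows "glue H \<phi> = x"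
proof (rule cochain_eqI)
  show "glue H \<phi> \<in> cochains L i" by (rule glue_in_cochains) fact
  show xc: "x \<in> cochains L i" using x by (simp add: fixed_cochains_def)
  fix vs assume vs: "vs \<in> ordered_simplices L i"
  let ?k = "\<gamma> (set vs)"
  have L: "set vs \<in> L" using vs by (rule ordered_simplicesD)
  have k: "?k \<in> carrier G" using L by (rule \<gamma>_carrier)
  have "glue H \<phi> vs = \<phi> (H #> ?k) (map (a (inv ?k)) vs)"
    using L by (simp add: glue_def tr_apply)
  also have "\<dots> = expand x (H #> ?k) (map (a (inv ?k)) vs)"
    by (rule \<phi>[OF coset_in_D[OF k] map_act_inv_\<gamma>_in_window[OF vs]])
  also have "\<dots> = tr ?k (tr (inv ?k) x) vs"
    using L by (simp add: expand_coset[OF x k] tr_apply)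
  also have "\<dots> = x vs" by (simp add: tr_inv(2)[OF k xc])
  finally show "glue H \<phi> vs = x vs" .
qed

text \<open>The translate of the glued cochain at the coset \<open>d\<close> reads \<open>\<phi>\<close> at the coset \<open>d k\<close>. For exactly
  equivariant \<open>\<phi>\<close> the right-hand side would be \<open>\<phi> d b\<close>; so the glued cochain reproduces \<open>\<phi>\<close>
  wherever \<open>\<phi>\<close> is equivariant.\<close>
lemma expand_glue:
  assumes \<phi>: "\<And>d. d \<in> D \<Longrightarrow> \<phi> d \<in> cochains L i" and d: "d \<in> D" and b: "b \<in> ordered_simplices L i"
  defines "k \<equiv> \<gamma> (set b)"
  shows "expand (glue H \<phi>) d b = \<phi> (d #> k) (map (a (inv k)) b)"
proof -
  obtain u where u: "u \<in> carrier G" "d = H #> u" using D_cases[OF d] by blast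
  have L: "set b \<in> L" using b by (rule ordered_simplicesD)
  have "expand (glue H \<phi>) d b = glue H \<phi> (map (a u) b)"
    using u L by (simp add: expand_coset[OF glue_fixed[OF \<phi>]] tr_apply)
  also have "\<dots> = \<phi> (H #> (u \<otimes> k)) (map (a (inv k)) b)"
    unfolding k_def by (rule glue_map_act[OF u(1) L])
  finally show ?thesis using u \<gamma>_carrier[OF L] by (simp add: k_def shift_coset)
qed

text \<open>By equivariance, the cocycle condition of \<open>x\<close> on \<open>T\<close> amounts to conditions on finitely many simplices, for
  each of the translates of \<open>x\<close>.\<close>
lemma fixed_in_cocycles_onI:
  assumes x: "x \<in> fixed_cochains G L a H (cochains L i)"
    and T: "\<And>g vs. g \<in> carrier G \<Longrightarrow> vs \<in> T \<Longrightarrow> map (a g) vs \<in> T"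
    and TL: "T \<subseteq> ordered_simplices L (Suc i)"
    and zero: "\<And>d b. d \<in> D \<Longrightarrow> b \<in> window (Suc i) \<inter> T \<Longrightarrow> coboundary L (Suc i) (expand x d) b = 0"
  shows "x \<in> fixed_cochains G L a H (cocycles_on L T i)"
proof -
  have "coboundary L (Suc i) x vs = 0" if vs: "vs \<in> T" for vs
  proof -
    let ?k = "\<gamma> (set vs)"
    have os: "vs \<in> ordered_simplices L (Suc i)" using vs TL by blast
    then have L: "set vs \<in> L" by (rule ordered_simplicesD)
    have k: "?k \<in> carrier G" using L by (rule \<gamma>_carrier)
    let ?b = "map (a (inv ?k)) vs"
    have xc: "x \<in> cochains L i" using x by (simp add: fixed_cochains_def)
    have "coboundary L (Suc i) x vs = coboundary L (Suc i) (tr ?k (tr (inv ?k) x)) vs"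
      by (simp add: tr_inv(2)[OF k xc])
    also have "\<dots> = coboundary L (Suc i) (expand x (H #> ?k)) ?b"
      using L by (simp add: coboundary_tr[OF k] tr_apply expand_coset[OF x k])
    also have "\<dots> = 0"
      using coset_in_D[OF k] map_act_inv_\<gamma>_in_window[OF os] T[of "inv ?k" vs] vs k
      by (intro zero) auto
    finally show ?thesis .
  qed
  then show ?thesis using x by (simp add: fixed_cochains_def cocycles_on_def)
qed

end

section \<open>Approximately equivariant maps and their glued cochains\<close>

context finite_index
begin

definition bad :: "'v list set \<Rightarrow> ('g set \<Rightarrow> 'v list \<Rightarrow> 'k :: field) \<Rightarrow> 'g set set" where
  "bad V \<phi> = {d \<in> D. \<exists>b\<in>V. expand (glue H \<phi>) d b \<noteq> \<phi> d b}"

lemma bad_subset: "bad V \<phi> \<subseteq> D"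
  by (auto simp: bad_def)

text \<open>At the bad cosets one records the values of \<open>\<phi>\<close> on \<open>V\<close> and the defect of the cocycle condition of the
  glued cochain on the window; this gives the power of \<open>card B\<close>. Among maps with equal records, the
  glued cochains differ by periodic cocycles: the defects at bad cosets cancel, and at the other cosets they
  vanish, as there the glued cochain agrees with a cocycle on all faces that enter. The difference
  determines \<open>\<phi>\<close>, because outside \<open>B\<close> the glued cochain reproduces the values on \<open>V\<close>.\<close>
lemma card_with_bad_set_le:
  fixes A :: "('g set \<Rightarrow> 'v list \<Rightarrow> 'k :: {field, finite}) set" and i :: nat
  defines "W \<equiv> window (Suc i)"
  assumes T: "\<And>g vs. g \<in> carrier G \<Longrightarrow> vs \<in> T \<Longrightarrow> map (a g) vs \<in> T"
    and TL: "T \<subseteq> ordered_simplices L (Suc i)"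
    and V: "finite V" "V \<subseteq> ordered_simplices L i"
    and faces: "\<And>b j. b \<in> W \<inter> T \<Longrightarrow> j \<le> Suc i \<Longrightarrow> face j b \<in> V"
    and A: "finite A" "\<And>\<phi> d. \<phi> \<in> A \<Longrightarrow> d \<in> D \<Longrightarrow> \<phi> d \<in> cocycles_on L T i"
    and sep: "\<And>\<phi> \<psi>. \<phi> \<in> A \<Longrightarrow> \<psi> \<in> A \<Longrightarrow> (\<And>d b. d \<in> D \<Longrightarrow> b \<in> V \<Longrightarrow> \<phi> d b = \<psi> d b) \<Longrightarrow> \<phi> = \<psi>"
    and B: "B \<subseteq> D" "\<And>\<phi>. \<phi> \<in> A \<Longrightarrow> bad V \<phi> = B"
    and fin: "finite (fixed_cochains G L a H (cocycles_on L T i :: ('v list \<Rightarrow> 'k) set))"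
  shows "card A \<le> (CARD('k) ^ card V * CARD('k) ^ card W) ^ card B *
           card (fixed_cochains G L a H (cocycles_on L T i :: ('v list \<Rightarrow> 'k) set))"
proof -
  let ?X = "cocycles_on L T i :: ('v list \<Rightarrow> 'k) set"
  let ?Fix = "fixed_cochains G L a H ?X"
  let ?\<delta> = "coboundary L (Suc i) :: ('v list \<Rightarrow> 'k) \<Rightarrow> _"
  have finW: "finite W" unfolding W_def by (rule finite_window)
  have finB: "finite B" using B(1) finite_index by (rule finite_subset)
  define f where "f \<phi> = (\<lambda>d\<in>B. (restrict (\<phi> d) V, restrict (?\<delta> (expand (glue H \<phi>) d)) W))"
    for \<phi> :: "'g set \<Rightarrow> 'v list \<Rightarrow> 'k"
  define Y where "Y = B \<rightarrow>\<^sub>E ((V \<rightarrow>\<^sub>E (UNIV :: 'k set)) \<times> (W \<rightarrow>\<^sub>E (UNIV :: 'k set)))"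
  have cochain: "\<phi> d \<in> cochains L i" if "\<phi> \<in> A" "d \<in> D" for \<phi> d
    using A(2)[OF that] cocycles_on_subset by blast
  have glue_Fix: "glue H \<phi> \<in> fixed_cochains G L a H (cochains L i)" if "\<phi> \<in> A" for \<phi>
    by (rule glue_fixed) (rule cochain[OF that])
  have good: "expand (glue H \<phi>) d b = \<phi> d b" if "\<phi> \<in> A" "d \<in> D - B" "b \<in> V" for \<phi> d b
    using B(2)[OF that(1)] that(2,3) unfolding bad_def by blast
  have good_cocycle: "?\<delta> (expand (glue H \<phi>) d) b = 0"
    if "\<phi> \<in> A" "d \<in> D - B" "b \<in> W \<inter> T" for \<phi> d b
  proof -
    have "?\<delta> (expand (glue H \<phi>) d) b = ?\<delta> (\<phi> d) b"
      using good[OF that(1,2)] faces[OF that(3)] by (intro coboundary_cong_faces) blast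
    also have "\<dots> = 0" using A(2)[OF that(1), of d] that(2,3) by (auto simp: cocycles_on_def)
    finally show ?thesis .
  qed
  have fibre: "card {\<phi> \<in> A. f \<phi> = y} \<le> card ?Fix" for y
  proof (cases "{\<phi> \<in> A. f \<phi> = y} = {}")
    case False
    then obtain \<phi>0 where \<phi>0: "\<phi>0 \<in> A" "f \<phi>0 = y" by blast
    have eqs: "\<phi> d b = \<psi> d b" if "f \<phi> = f \<psi>" "d \<in> B" "b \<in> V" for \<phi> \<psi> d b
      using fun_cong[OF that(1), of d] that(2,3) unfolding f_def by (auto dest: fun_cong[of _ _ b])
    have eqs': "?\<delta> (expand (glue H \<phi>) d) b = ?\<delta> (expand (glue H \<psi>) d) b"
      if "f \<phi> = f \<psi>" "d \<in> B" "b \<in> W" for \<phi> \<psi> d b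
      using fun_cong[OF that(1), of d] that(2,3) unfolding f_def by (auto dest: fun_cong[of _ _ b])
    \<comment> \<open>Subtracting a reference element embeds the fibre into the periodic cocycles.\<close>
    let ?h = "\<lambda>\<phi> v. glue H \<phi> v - glue H \<phi>0 v"
    show ?thesis
    proof (rule card_inj_on_le[OF _ _ fin])
      show "inj_on ?h {\<phi> \<in> A. f \<phi> = y}"
      proof (rule inj_onI)
        fix \<phi> \<psi> assume \<phi>: "\<phi> \<in> {\<phi> \<in> A. f \<phi> = y}" and \<psi>: "\<psi> \<in> {\<phi> \<in> A. f \<phi> = y}" and eq: "?h \<phi> = ?h \<psi>"
        have g: "glue H \<phi> = glue H \<psi>"
        proof
          fix v show "glue H \<phi> v = glue H \<psi> v" using fun_cong[OF eq, of v] by simp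
        qed
        show "\<phi> = \<psi>"
        proof (rule sep)
          fix d b assume d: "d \<in> D" and b: "b \<in> V"
          show "\<phi> d b = \<psi> d b"
          proof (cases "d \<in> B")
            case True then show ?thesis using eqs[of \<phi> \<psi> d b] \<phi> \<psi> b by simp
          next
            case False
            then show ?thesis using good[of \<phi> d b] good[of \<psi> d b] \<phi> \<psi> b d g by simp
          qed
        qed (use \<phi> \<psi> in auto)
      qed
      show "?h ` {\<phi> \<in> A. f \<phi> = y} \<subseteq> ?Fix"
      proof (rule image_subsetI)
        fix \<phi> assume \<phi>: "\<phi> \<in> {\<phi> \<in> A. f \<phi> = y}"
        have "?h \<phi> \<in> fixed_cochains G L a H (cochains L i)"
          using \<phi> \<phi>0 by (intro linear_set_diff linear_set_fixed linear_set_cochains glue_Fix) auto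
        then show "?h \<phi> \<in> ?Fix"
        proof (rule fixed_in_cocycles_onI[OF _ T TL])
          fix d b assume d: "d \<in> D" and b: "b \<in> window (Suc i) \<inter> T"
          have "?\<delta> (expand (?h \<phi>) d) b = ?\<delta> (expand (glue H \<phi>) d) b - ?\<delta> (expand (glue H \<phi>0) d) b"
            by (simp add: expand_diff coboundary_diff)
          also have "\<dots> = 0"
          proof (cases "d \<in> B")
            case True then show ?thesis using eqs'[of \<phi> \<phi>0 d b] \<phi> \<phi>0 b by (simp add: W_def)
          next
            case False then show ?thesis
              using good_cocycle[of \<phi> d b] good_cocycle[of \<phi>0 d b] \<phi> \<phi>0 b d by (simp add: W_def)
          qed
          finally show "?\<delta> (expand (?h \<phi>) d) b = 0" .
        qed
      qed
    qed
  next
    case True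
    show ?thesis unfolding True by simp
  qed
  have "card A \<le> card Y * card ?Fix"
  proof (rule card_le_card_mult_fibres[where f = f])
    show "finite Y" unfolding Y_def using finB finW V(1) by (intro finite_PiE finite_cartesian_product) auto
    show "f ` A \<subseteq> Y" unfolding Y_def f_def by auto
    show "finite {\<phi> \<in> A. f \<phi> = y} \<and> card {\<phi> \<in> A. f \<phi> = y} \<le> card ?Fix" for y
      using A(1) fibre[of y] by simp
  qed
  also have "card Y = (CARD('k) ^ card V * CARD('k) ^ card W) ^ card B"
    unfolding Y_def using finB finW V(1) by (simp add: card_PiE card_cartesian_product)
  finally show ?thesis .
qed

text \<open>At a bad coset \<open>d\<close>, by \<open>expand_glue\<close> there is an \<open>f\<close> among finitely many elements such that \<open>\<phi> (s f d)\<close>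
  and \<open>f \<phi>(d)\<close> differ on the window, hence by expansiveness some translates of them by \<open>g\<close> are
  \<open>\<kappa>\<close>-apart. As \<open>s\<close> is an action, both translates can be compared with \<open>\<phi> (s (g f) d)\<close>, and one of the two
  comparisons has distance at least \<open>\<kappa> / 2\<close>. Chebyshev's inequality bounds the number of
  cosets where this happens for a given group element.\<close>
lemma card_bad_le:
  fixes X :: "('v list \<Rightarrow> 'k :: {field, finite}) set"
  assumes X: "X \<subseteq> cochains L i" and inv: "\<And>g c. g \<in> carrier G \<Longrightarrow> c \<in> X \<Longrightarrow> tr g c \<in> X"
    and \<rho>: "generating_pseudometric G (pointwise_topology X) tr \<rho>"
    and E: "finite E" "E \<subseteq> carrier G" "\<kappa> > 0"
    and expansive: "\<And>x y. x \<in> X \<Longrightarrow> y \<in> X \<Longrightarrow> (\<forall>g\<in>E. \<rho> (tr g x) (tr g y) < \<kappa>) \<Longrightarrow> (\<forall>b\<in>window i. x b = y b)"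
    and V: "finite V" "V \<subseteq> ordered_simplices L i"
    and F: "E \<subseteq> F" "\<And>g b. g \<in> E \<Longrightarrow> b \<in> V \<Longrightarrow> g \<otimes> inv (\<gamma> (set b)) \<in> F"
    and s: "\<And>g d. g \<in> carrier G \<Longrightarrow> d \<in> D \<Longrightarrow> s g d = d #> inv g"
    and \<phi>: "\<phi> \<in> approx_maps (pointwise_topology X) tr \<rho> F \<delta> D s" and "\<delta> > 0"
  shows "real (card (bad V \<phi>)) \<le> real (card V) * real (card E) * (2 * (\<delta>\<^sup>2 / (\<kappa> / 2)\<^sup>2)) * real (card D)"
proof -
  let ?N = "real (card D)"
  have N: "?N > 0" using card_D_pos by simp
  have \<phi>X: "\<phi> d \<in> X" if "d \<in> D" for d using \<phi> that by (auto simp: approx_maps_def)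
  have \<rho>_nonneg: "0 \<le> \<rho> x y" if "x \<in> X" "y \<in> X" for x y
    using \<rho> that by (simp add: generating_pseudometric_def)
  have \<rho>_sym: "\<rho> x y = \<rho> y x" if "x \<in> X" "y \<in> X" for x y
    using \<rho> that by (simp add: generating_pseudometric_def)
  have \<rho>_tri: "\<rho> x z \<le> \<rho> x y + \<rho> y z" if "x \<in> X" "y \<in> X" "z \<in> X" for x y z
    using \<rho> that by (simp add: generating_pseudometric_def)
  have sD: "s g d \<in> D" if "g \<in> carrier G" "d \<in> D" for g d
    using that by (simp add: s shift_in_D)
  have s_mult: "s g (s h d) = s (g \<otimes> h) d" if ghd: "g \<in> carrier G" "h \<in> carrier G" "d \<in> D" for g h d
  proof -
    obtain u where u: "u \<in> carrier G" "d = H #> u" using D_cases[OF ghd(3)] by blast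
    show ?thesis
      using ghd u sD[OF ghd(2,3)]
      by (simp add: s shift_coset inv_mult_group m_assoc shift_in_D coset_in_D)
  qed
  have s_inj: "inj_on (s g) D" if g: "g \<in> carrier G" for g
  proof (rule inj_on_inverseI[of _ "s (inv g)"])
    fix d assume d: "d \<in> D"
    then obtain u where u: "u \<in> carrier G" "d = H #> u" using D_cases by blast
    show "s (inv g) (s g d) = d"
      using g d u by (simp add: s_mult) (simp add: s shift_coset)
  qed
  define far where "far f = {d \<in> D. \<kappa> / 2 \<le> \<rho> (\<phi> (s f d)) (tr f (\<phi> d))}" for f
  have far: "real (card (far f)) \<le> \<delta>\<^sup>2 / (\<kappa> / 2)\<^sup>2 * ?N" if f: "f \<in> F" for f
  proof -
    have "dist_2 \<rho> D (\<lambda>d. \<phi> (s f d)) (\<lambda>d. tr f (\<phi> d)) < \<delta>"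
      using \<phi> f by (simp add: approx_maps_def)
    then have "(\<Sum>d\<in>D. (\<rho> (\<phi> (s f d)) (tr f (\<phi> d)))\<^sup>2) / ?N < \<delta>\<^sup>2"
      unfolding dist_2_def by (rule real_sqrt_less_iff[THEN iffD1, OF order_less_le_trans]) (use \<open>\<delta> > 0\<close> in simp)
    then have "(\<Sum>d\<in>D. (\<rho> (\<phi> (s f d)) (tr f (\<phi> d)))\<^sup>2) < \<delta>\<^sup>2 * ?N"
      using N by (simp add: pos_divide_less_eq)
    moreover have "real (card (far f)) * (\<kappa> / 2)\<^sup>2 \<le> (\<Sum>d\<in>D. (\<rho> (\<phi> (s f d)) (tr f (\<phi> d)))\<^sup>2)"
    proof -
      have "real (card (far f)) * (\<kappa> / 2)\<^sup>2 = (\<Sum>d\<in>far f. (\<kappa> / 2)\<^sup>2)" by simp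
      also have "\<dots> \<le> (\<Sum>d\<in>far f. (\<rho> (\<phi> (s f d)) (tr f (\<phi> d)))\<^sup>2)"
        using E(3) by (intro sum_mono power_mono) (auto simp: far_def)
      also have "\<dots> \<le> (\<Sum>d\<in>D. (\<rho> (\<phi> (s f d)) (tr f (\<phi> d)))\<^sup>2)"
        by (intro sum_mono2 finite_index) (auto simp: far_def)
      finally show ?thesis .
    qed
    ultimately have "real (card (far f)) * (\<kappa> / 2)\<^sup>2 \<le> \<delta>\<^sup>2 * ?N" by simp
    then show ?thesis using E(3) by (simp add: field_simps)
  qed
  let ?f = "\<lambda>b. inv (\<gamma> (set b))"
  have f_carrier: "?f b \<in> carrier G" if "b \<in> V" for b
    using that V(2) \<gamma>_carrier ordered_simplicesD by blast
  let ?P = "\<lambda>b g. far (g \<otimes> ?f b) \<union> {d \<in> D. s (?f b) d \<in> far g}"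
  have "bad V \<phi> \<subseteq> (\<Union>b\<in>V. \<Union>g\<in>E. ?P b g)"
  proof
    fix d assume d: "d \<in> bad V \<phi>"
    then have dD: "d \<in> D" by (simp add: bad_def)
    obtain b where b: "b \<in> V" "expand (glue H \<phi>) d b \<noteq> \<phi> d b" using d by (auto simp: bad_def)
    have bL: "b \<in> ordered_simplices L i" using b V by blast
    have k: "\<gamma> (set b) \<in> carrier G" using bL ordered_simplicesD \<gamma>_carrier by blast
    note f = f_carrier[OF b(1)]
    let ?w = "map (a (?f b)) b"
    have w: "?w \<in> window i" by (rule map_act_inv_\<gamma>_in_window[OF bL])
    have "expand (glue H \<phi>) d b = \<phi> (s (?f b) d) ?w"
      using expand_glue[of \<phi> i d b] \<phi>X X dD bL s[OF f dD] k by (simp add: subset_iff)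
    moreover have "\<phi> d b = tr (?f b) (\<phi> d) ?w"
      by (rule tr_map_act[OF f ordered_simplicesD[OF bL], symmetric])
    ultimately have "\<phi> (s (?f b) d) ?w \<noteq> tr (?f b) (\<phi> d) ?w" using b(2) by simp
    then have "\<not> (\<forall>g\<in>E. \<rho> (tr g (\<phi> (s (?f b) d))) (tr g (tr (?f b) (\<phi> d))) < \<kappa>)"
      using expansive[of "\<phi> (s (?f b) d)" "tr (?f b) (\<phi> d)"] w \<phi>X[OF sD[OF f dD]] inv[OF f \<phi>X[OF dD]] by blast
    then obtain g where g: "g \<in> E" "\<kappa> \<le> \<rho> (tr g (\<phi> (s (?f b) d))) (tr g (tr (?f b) (\<phi> d)))"
      by force
    have gG: "g \<in> carrier G" using g E by blast
    let ?x = "tr g (\<phi> (s (?f b) d))" and ?y = "\<phi> (s g (s (?f b) d))" and ?z = "tr (g \<otimes> ?f b) (\<phi> d)"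
    have X3: "?x \<in> X" "?y \<in> X" "?z \<in> X"
      using gG f dD by (auto intro!: inv \<phi>X sD)
    have "\<kappa> \<le> \<rho> ?x ?z" using g(2) gG f by (simp add: tr_mult)
    also have "\<dots> \<le> \<rho> ?x ?y + \<rho> ?y ?z" by (rule \<rho>_tri) (use X3 in auto)
    finally have "\<kappa> / 2 \<le> \<rho> ?y ?x \<or> \<kappa> / 2 \<le> \<rho> ?y ?z"
      using \<rho>_sym[OF X3(1,2)] by linarith
    then have "d \<in> ?P b g"
    proof
      assume "\<kappa> / 2 \<le> \<rho> ?y ?x"
      then have "s (?f b) d \<in> far g" using sD[OF f dD] by (simp add: far_def)
      then show ?thesis using dD by simp
    next
      assume "\<kappa> / 2 \<le> \<rho> ?y ?z"
      then have "d \<in> far (g \<otimes> ?f b)" using dD s_mult[OF gG f dD] by (simp add: far_def)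
      then show ?thesis by simp
    qed
    then show "d \<in> (\<Union>b\<in>V. \<Union>g\<in>E. ?P b g)" using b(1) g(1) by blast
  qed
  moreover have finP: "finite (?P b g)" for b g
    using finite_index by (auto simp: far_def)
  ultimately have "card (bad V \<phi>) \<le> card (\<Union>b\<in>V. \<Union>g\<in>E. ?P b g)"
    using V(1) E(1) by (intro card_mono finite_UN_I) auto
  also have "\<dots> \<le> (\<Sum>b\<in>V. card (\<Union>g\<in>E. ?P b g))" by (rule card_UN_le[OF V(1)])
  also have "\<dots> \<le> (\<Sum>b\<in>V. \<Sum>g\<in>E. card (?P b g))" by (intro sum_mono card_UN_le[OF E(1)])
  finally have "real (card (bad V \<phi>)) \<le> real (\<Sum>b\<in>V. \<Sum>g\<in>E. card (?P b g))"
    by (rule of_nat_mono)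
  also have "\<dots> = (\<Sum>b\<in>V. \<Sum>g\<in>E. real (card (?P b g)))" by simp
  also have "\<dots> \<le> (\<Sum>b\<in>V. \<Sum>g\<in>E. 2 * (\<delta>\<^sup>2 / (\<kappa> / 2)\<^sup>2) * ?N)"
  proof (intro sum_mono)
    fix b g assume b: "b \<in> V" and g: "g \<in> E"
    have gG: "g \<in> carrier G" using g E by blast
    have "card {d \<in> D. s (?f b) d \<in> far g} \<le> card (far g)"
    proof (rule card_inj_on_le[of "s (?f b)"])
      show "inj_on (s (?f b)) {d \<in> D. s (?f b) d \<in> far g}"
        by (rule inj_on_subset[OF s_inj[OF f_carrier[OF b]]]) auto
      show "finite (far g)" using finite_index by (auto simp: far_def)
    qed auto
    then have "card (?P b g) \<le> card (far (g \<otimes> ?f b)) + card (far g)"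
      using card_Un_le[of "far (g \<otimes> ?f b)" "{d \<in> D. s (?f b) d \<in> far g}"] by linarith
    then have "real (card (?P b g)) \<le> real (card (far (g \<otimes> ?f b))) + real (card (far g))"
      by linarith
    also have "\<dots> \<le> 2 * (\<delta>\<^sup>2 / (\<kappa> / 2)\<^sup>2) * ?N"
      using far[of "g \<otimes> ?f b"] far[of g] F g b by auto
    finally show "real (card (?P b g)) \<le> 2 * (\<delta>\<^sup>2 / (\<kappa> / 2)\<^sup>2) * ?N" .
  qed
  also have "\<dots> = real (card V) * real (card E) * (2 * (\<delta>\<^sup>2 / (\<kappa> / 2)\<^sup>2)) * ?N" by simp
  finally show ?thesis .
qed

end

section \<open>Entropy as growth of periodic cocycles\<close>

definition separated :: "real \<Rightarrow> ('a \<Rightarrow> 'a \<Rightarrow> real) \<Rightarrow> 'a set \<Rightarrow> bool" where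
  "separated \<kappa> d A \<longleftrightarrow> (\<forall>\<phi>\<in>A. \<forall>\<psi>\<in>A. \<phi> \<noteq> \<psi> \<longrightarrow> \<kappa> \<le> d \<phi> \<psi>)"

lemma log_separation_number_le:
  assumes "r \<ge> 1" "\<And>A. A \<subseteq> S \<Longrightarrow> finite A \<Longrightarrow> separated \<kappa> d A \<Longrightarrow> real (card A) \<le> r"
  shows "log_enat (separation_number \<kappa> S d) \<le> ereal (ln r)"
proof -
  have "separation_number \<kappa> S d \<le> enat (nat \<lfloor>r\<rfloor>)"
    unfolding separation_number_def
  proof (rule SUP_least)
    fix A assume "A \<in> {A. A \<subseteq> S \<and> finite A \<and> (\<forall>\<phi>\<in>A. \<forall>\<psi>\<in>A. \<phi> \<noteq> \<psi> \<longrightarrow> \<kappa> \<le> d \<phi> \<psi>)}"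
    then have "real (card A) \<le> r" using assms(2)[of A] unfolding separated_def by blast
    then show "enat (card A) \<le> enat (nat \<lfloor>r\<rfloor>)" by (simp add: le_nat_floor)
  qed
  then obtain k where k: "separation_number \<kappa> S d = enat k" "k \<le> nat \<lfloor>r\<rfloor>"
    by (metis enat_ile enat_ord_simps(1))
  then have "real k \<le> r" using assms(1) by (simp add: le_nat_iff le_floor_iff)
  then show ?thesis using k(1) assms(1) by (simp add: log_enat_def)
qed

lemma log_separation_number_ge:
  assumes "A \<subseteq> S" "finite A" "separated \<kappa> d A" "card A > 0"
  shows "ereal (ln (real (card A))) \<le> log_enat (separation_number \<kappa> S d)"
proof -
  have "enat (card A) \<le> separation_number \<kappa> S d"
    unfolding separation_number_def
    by (rule SUP_upper) (use assms in \<open>simp add: separated_def\<close>)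
  then show ?thesis
    using assms(4) by (cases "separation_number \<kappa> S d") (auto simp: log_enat_def)
qed

context equivariant_section
begin

text \<open>Cochains supported in the fundamental domain, which can be prescribed independently at each coset.\<close>
definition window_cochains :: "nat \<Rightarrow> ('v list \<Rightarrow> 'k :: field) set" where
  "window_cochains i = {c \<in> cochains L i. \<forall>vs. vs \<notin> window i \<longrightarrow> c vs = 0}"

lemma finite_window_cochains: "finite (window_cochains i :: ('v list \<Rightarrow> 'k :: {field, finite}) set)"
proof (rule finite_subset)
  show "window_cochains i \<subseteq> {c. \<forall>vs. (vs \<in> window i \<longrightarrow> c vs \<in> (UNIV :: 'k set)) \<and> (vs \<notin> window i \<longrightarrow> c vs = 0)}"
    by (auto simp: window_cochains_def)
  show "finite {c. \<forall>vs. (vs \<in> window i \<longrightarrow> c vs \<in> (UNIV :: 'k set)) \<and> (vs \<notin> window i \<longrightarrow> c vs = 0)}"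
    by (intro finite_set_of_finite_funs finite_window) simp
qed

end

text \<open>The power law for the number of invariant cochains in \<open>card_fixed_cochains\<close> comes from this bijection;
  its inverse cuts the translates of an invariant cochain down to the window.\<close>
lemma (in finite_index) bij_betw_glue:
  "bij_betw (glue H) (D \<rightarrow>\<^sub>E window_cochains i)
     (fixed_cochains G L a H (cochains L i) :: ('v list \<Rightarrow> 'k :: field) set)"
  unfolding bij_betw_def
proof (intro conjI inj_onI equalityI subsetI)
  fix \<phi> \<psi> :: "'g set \<Rightarrow> 'v list \<Rightarrow> 'k"
  assume \<phi>: "\<phi> \<in> D \<rightarrow>\<^sub>E window_cochains i" and \<psi>: "\<psi> \<in> D \<rightarrow>\<^sub>E window_cochains i"
    and eq: "glue H \<phi> = glue H \<psi>"
  have mem: "\<phi> d \<in> window_cochains i" "\<psi> d \<in> window_cochains i" if "d \<in> D" for d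
    using \<phi> \<psi> that by auto
  show "\<phi> = \<psi>"
  proof (rule PiE_ext[OF \<phi> \<psi>])
    fix d assume d: "d \<in> D"
    then obtain u where u: "u \<in> carrier G" "d = H #> u" using D_cases by blast
    show "\<phi> d = \<psi> d"
    proof
      fix b show "\<phi> d b = \<psi> d b"
      proof (cases "b \<in> window i")
        case True
        then have b: "set b \<in> L" "\<gamma> (set b) = \<one>"
          using window_ordered_simplices ordered_simplicesD by (auto simp: window_def)
        then show ?thesis
          using glue_map_act[OF u(1) b(1), of \<phi>] glue_map_act[OF u(1) b(1), of \<psi>] eq u
          by (simp add: map_act_one)
      next
        case False
        then show ?thesis using mem[OF d] by (simp add: window_cochains_def)
      qed
    qed
  qed
next
  fix x :: "'v list \<Rightarrow> 'k" assume "x \<in> glue H ` (D \<rightarrow>\<^sub>E window_cochains i)"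
  then obtain \<phi> where \<phi>: "\<phi> \<in> D \<rightarrow>\<^sub>E window_cochains i" "x = glue H \<phi>" by blast
  then have "\<phi> d \<in> cochains L i" if "d \<in> D" for d
    using that by (auto simp: window_cochains_def)
  then show "x \<in> fixed_cochains G L a H (cochains L i)" unfolding \<phi>(2) by (rule glue_fixed)
next
  fix x :: "'v list \<Rightarrow> 'k" assume x: "x \<in> fixed_cochains G L a H (cochains L i)"
  define \<phi> where "\<phi> = (\<lambda>d\<in>D. \<lambda>b. if b \<in> window i then expand x d b else 0)"
  have w: "permute_list \<pi> vs \<in> window i \<longleftrightarrow> vs \<in> window i"
    if "vs \<in> ordered_simplices L i" "\<pi> permutes {..<length vs}" for \<pi> vs
    using that permute_list_in_ordered_simplices[OF that] by (simp add: window_def)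
  have "\<phi> d \<in> window_cochains i" if "d \<in> D" for d
  proof -
    note e = expand_in_cochains[OF x that]
    have "\<phi> d \<in> cochains L i"
      unfolding cochains_def
    proof (intro CollectI conjI allI impI ballI)
      fix vs assume "vs \<notin> ordered_simplices L i"
      then have "vs \<notin> window i" using window_ordered_simplices by blast
      then show "\<phi> d vs = 0" using that by (simp add: \<phi>_def)
    next
      fix vs \<pi> assume vs: "vs \<in> ordered_simplices L i" "\<pi> permutes {..<length vs}"
      then have "expand x d (permute_list \<pi> vs) = of_int (sign \<pi>) * expand x d vs"
        using e unfolding cochains_def by blast
      then show "\<phi> d (permute_list \<pi> vs) = of_int (sign \<pi>) * \<phi> d vs"
        using that w[OF vs] by (simp add: \<phi>_def)
    qed
    then show ?thesis using that by (simp add: window_cochains_def \<phi>_def)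
  qed
  moreover from this have "glue H \<phi> = x"
    by (intro glue_expand[OF x]) (auto simp: \<phi>_def window_cochains_def)
  ultimately show "x \<in> glue H ` (D \<rightarrow>\<^sub>E window_cochains i)"
    by (intro image_eqI[of _ _ \<phi>]) (auto simp: \<phi>_def)
qed

lemma (in finite_index)
  fixes i :: nat
  defines "Fix \<equiv> fixed_cochains G L a H (cochains L i) :: ('v list \<Rightarrow> 'k :: {field, finite}) set"
  shows finite_fixed_cochains: "finite Fix"
    and card_fixed_cochains: "card Fix = card (window_cochains i :: ('v list \<Rightarrow> 'k) set) ^ card D"
proof -
  have "finite (D \<rightarrow>\<^sub>E (window_cochains i :: ('v list \<Rightarrow> 'k) set))"
    by (intro finite_PiE finite_index finite_window_cochains)
  then show "finite Fix" using bij_betw_finite[OF bij_betw_glue[of i, where 'k = 'k]] by (simp add: Fix_def)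
  show "card Fix = card (window_cochains i :: ('v list \<Rightarrow> 'k) set) ^ card D"
    using bij_betw_same_card[OF bij_betw_glue[of i, where 'k = 'k]] finite_index
    by (simp add: Fix_def card_PiE)
qed

lemma fixed_cochains_mono: "S \<subseteq> S' \<Longrightarrow> fixed_cochains G L a H S \<subseteq> fixed_cochains G L a H S'"
  by (auto simp: fixed_cochains_def)

locale cocycle_shift = equivariant_section G L a \<gamma>
  for G (structure) and L :: "'v set set" and a :: "'g \<Rightarrow> 'v \<Rightarrow> 'v" and \<gamma> +
  fixes i :: nat and T :: "'v list set"
  assumes T_invariant: "g \<in> carrier G \<Longrightarrow> vs \<in> T \<Longrightarrow> map (a g) vs \<in> T"
    and T_simplices: "T \<subseteq> ordered_simplices L (Suc i)"
begin

lemma tr_cocycles: "g \<in> carrier G \<Longrightarrow> c \<in> cocycles_on L T i \<Longrightarrow> tr g c \<in> cocycles_on L T i"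
  by (rule tr_in_cocycles_on[OF T_invariant T_simplices])

lemma cochain: "c \<in> cocycles_on L T i \<Longrightarrow> c \<in> cochains L i"
  using cocycles_on_subset by blast

text \<open>Two invariant cochains that differ at a simplex \<open>s\<close> have translates by \<open>\<gamma>(s)\<^bsup>-1\<^esup>\<close> that differ on the
  window, so the constant \<open>\<kappa>\<close> of expansiveness separates their maps, whatever the subgroup. The maps are
  exactly equivariant, hence belong to \<open>approx_maps\<close> for all \<open>F\<close> and \<open>\<delta>\<close>.\<close>
lemma separated_periodic_orbit_maps:
  fixes \<rho> :: "('v list \<Rightarrow> 'k :: {field, finite}) \<Rightarrow> ('v list \<Rightarrow> 'k) \<Rightarrow> real"
  assumes \<rho>: "generating_pseudometric G (pointwise_topology (cocycles_on L T i)) tr \<rho>"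
  obtains \<kappa> where "\<kappa> > 0"
    "\<And>H s F \<delta>. finite_index G L a \<gamma> H \<Longrightarrow> F \<subseteq> carrier G \<Longrightarrow> \<delta> > 0 \<Longrightarrow>
       (\<And>g d. g \<in> carrier G \<Longrightarrow> d \<in> rcosets H \<Longrightarrow> s g d = d #> inv g) \<Longrightarrow>
       \<exists>A \<subseteq> approx_maps (pointwise_topology (cocycles_on L T i)) tr \<rho> F \<delta> (rcosets H) s.
         finite A \<and> separated \<kappa> (dist_inf \<rho> (rcosets H)) A \<and>
         card A = card (fixed_cochains G L a H (cocycles_on L T i :: ('v list \<Rightarrow> 'k) set))"
proof -
  let ?X = "cocycles_on L T i :: ('v list \<Rightarrow> 'k) set"
  obtain E \<kappa> where E: "finite E" "E \<subseteq> carrier G" "\<kappa> > 0"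
    and "\<forall>x\<in>?X. \<forall>y\<in>?X. (\<forall>g\<in>E. \<rho> (tr g x) (tr g y) < \<kappa>) \<longrightarrow> (\<forall>b\<in>window i. x b = y b)"
    by (rule agree_if_pseudometric_small[OF closedin_cocycles_on \<rho> continuous_map_tr[OF tr_cocycles] finite_window[of i]])
  then have expansive: "\<forall>b\<in>window i. x b = y b"
    if "x \<in> ?X" "y \<in> ?X" "\<forall>g\<in>E. \<rho> (tr g x) (tr g y) < \<kappa>" for x y
    using that by simp
  show thesis
  proof (rule that[OF E(3)])
    fix H s F \<delta>
    assume "finite_index G L a \<gamma> H" and F: "F \<subseteq> carrier G" and \<delta>: "(\<delta> :: real) > 0"
      and s: "\<And>g d. g \<in> carrier G \<Longrightarrow> d \<in> rcosets H \<Longrightarrow> s g d = d #> inv g"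
    interpret finite_index G L a \<gamma> H by fact
    let ?Fix = "fixed_cochains G L a H ?X"
    have Fix: "x \<in> fixed_cochains G L a H (cochains L i)" if "x \<in> ?Fix" for x
      using that fixed_cochains_mono[OF cocycles_on_subset] by blast
    define \<Phi> where "\<Phi> x = (\<lambda>d\<in>D. expand x d)" for x :: "'v list \<Rightarrow> 'k"
    have \<Phi>: "\<Phi> x (H #> u) = tr (inv u) x" if "x \<in> ?Fix" "u \<in> carrier G" for x u
      using that expand_coset[OF Fix] coset_in_D by (simp add: \<Phi>_def)
    have X: "x \<in> ?X" if "x \<in> ?Fix" for x using that by (simp add: fixed_cochains_def)
    have \<Phi>X: "\<Phi> x d \<in> ?X" if x: "x \<in> ?Fix" and d: "d \<in> D" for x d
    proof -
      obtain u where "u \<in> carrier G" "d = H #> u" using D_cases[OF d] by blast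
      then show ?thesis using \<Phi>[OF x] tr_cocycles[OF inv_closed X[OF x]] by simp
    qed
    have sep: "\<kappa> \<le> dist_inf \<rho> D (\<Phi> x) (\<Phi> y)" if x: "x \<in> ?Fix" and y: "y \<in> ?Fix" and "x \<noteq> y" for x y
    proof -
      obtain vs where vs: "vs \<in> ordered_simplices L i" "x vs \<noteq> y vs"
        using cochain_eqI[OF cochain[OF X[OF x]] cochain[OF X[OF y]]] \<open>x \<noteq> y\<close> by blast
      let ?u = "\<gamma> (set vs)"
      have L: "set vs \<in> L" using vs(1) by (rule ordered_simplicesD)
      have u: "?u \<in> carrier G" using L by (rule \<gamma>_carrier)
      have "tr (inv ?u) x (map (a (inv ?u)) vs) \<noteq> tr (inv ?u) y (map (a (inv ?u)) vs)"
        using vs(2) by (simp only: tr_map_act[OF inv_closed[OF u] L] not_False_eq_True)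
      then have "\<not> (\<forall>g\<in>E. \<rho> (tr g (tr (inv ?u) x)) (tr g (tr (inv ?u) y)) < \<kappa>)"
        using expansive[OF tr_cocycles[OF inv_closed[OF u] X[OF x]] tr_cocycles[OF inv_closed[OF u] X[OF y]]]
          map_act_inv_\<gamma>_in_window[OF vs(1)] by blast
      then obtain g where g: "g \<in> E" "\<kappa> \<le> \<rho> (tr g (tr (inv ?u) x)) (tr g (tr (inv ?u) y))" by force
      have gG: "g \<in> carrier G" using g E by blast
      \<comment> \<open>The coset whose value under \<open>\<Phi> x\<close> is \<open>g u\<^bsup>-1\<^esup> x\<close> for \<open>u = \<gamma>(s)\<close>.\<close>
      let ?d = "H #> (?u \<otimes> inv g)"
      have d: "?d \<in> D" using u gG by (intro coset_in_D) simp
      have "\<kappa> \<le> \<rho> (\<Phi> x ?d) (\<Phi> y ?d)"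
        using g(2) gG u x y by (simp add: \<Phi> inv_mult_group tr_mult)
      also have "\<dots> \<le> dist_inf \<rho> D (\<Phi> x) (\<Phi> y)"
        unfolding dist_inf_def using d finite_index by (intro Max_ge) auto
      finally show ?thesis .
    qed
    have \<rho>0: "\<rho> x x = 0" if "x \<in> ?X" for x
      using \<rho> that by (simp add: generating_pseudometric_def)
    have eq0: "dist_inf \<rho> D (\<Phi> x) (\<Phi> x) = 0" if "x \<in> ?Fix" for x
    proof -
      have "(\<lambda>d. \<rho> (\<Phi> x d) (\<Phi> x d)) ` D = {0}"
        using \<rho>0 \<Phi>X[OF that] card_D_pos by (force simp: card_gt_0_iff)
      then show ?thesis by (simp add: dist_inf_def)
    qed
    have inj: "inj_on \<Phi> ?Fix"
    proof (rule inj_onI, rule ccontr)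
      fix x y assume "x \<in> ?Fix" "y \<in> ?Fix" "\<Phi> x = \<Phi> y" "x \<noteq> y"
      then show False using sep[of x y] eq0[of x] E(3) by simp
    qed
    show "\<exists>A \<subseteq> approx_maps (pointwise_topology ?X) tr \<rho> F \<delta> D s.
         finite A \<and> separated \<kappa> (dist_inf \<rho> D) A \<and> card A = card ?Fix"
    proof (intro exI[of _ "\<Phi> ` ?Fix"] conjI)
      show "finite (\<Phi> ` ?Fix)"
        by (rule finite_imageI) (rule finite_subset[OF fixed_cochains_mono[OF cocycles_on_subset] finite_fixed_cochains])
      show "card (\<Phi> ` ?Fix) = card ?Fix" by (rule card_image[OF inj])
      show "separated \<kappa> (dist_inf \<rho> D) (\<Phi> ` ?Fix)"
        unfolding separated_def using sep by auto
      show "\<Phi> ` ?Fix \<subseteq> approx_maps (pointwise_topology ?X) tr \<rho> F \<delta> D s"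
      proof (rule image_subsetI)
        fix x assume x: "x \<in> ?Fix"
        have "dist_2 \<rho> D (\<lambda>d. \<Phi> x (s f d)) (\<lambda>d. tr f (\<Phi> x d)) < \<delta>" if f: "f \<in> F" for f
        proof -
          have fG: "f \<in> carrier G" using f F by blast
          have "\<rho> (\<Phi> x (s f d)) (tr f (\<Phi> x d)) = 0" if d: "d \<in> D" for d
          proof -
            obtain u where u: "u \<in> carrier G" "d = H #> u" using D_cases[OF d] by blast
            have "\<Phi> x (s f d) = tr f (\<Phi> x d)"
              using fG u x s[OF fG d] by (simp add: shift_coset \<Phi> inv_mult_group tr_mult)
            then show ?thesis using \<rho>0 tr_cocycles[OF fG \<Phi>X[OF x d]] by simp
          qed
          then show ?thesis using \<delta> by (simp add: dist_2_def)
        qed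
        moreover have "\<Phi> x \<in> D \<rightarrow>\<^sub>E ?X" using \<Phi>X[OF x] by (auto simp: \<Phi>_def)
        ultimately show "\<Phi> x \<in> approx_maps (pointwise_topology ?X) tr \<rho> F \<delta> D s"
          by (simp add: approx_maps_def)
      qed
    qed
  qed
qed

text \<open>The set \<open>V\<close> contains the coordinates that control distances below \<open>\<kappa>\<close>, so that elements of a
  \<open>\<kappa>\<close>-separated set are determined by their values on \<open>V\<close>, and the faces of the simplices in the window, so that the cocycle
  condition can be tested on \<open>V\<close>. The constants \<open>F\<close> and \<open>\<delta>\<close> are chosen to make the bad sets of
  relative size at most \<open>\<epsilon>\<close>; they depend neither on the subgroup nor on the separated set.\<close>
lemma card_separated_approx_maps_le:
  fixes \<rho> :: "('v list \<Rightarrow> 'k :: {field, finite}) \<Rightarrow> ('v list \<Rightarrow> 'k) \<Rightarrow> real"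
  assumes \<rho>: "generating_pseudometric G (pointwise_topology (cocycles_on L T i)) tr \<rho>"
    and "\<kappa> > 0" "\<eta> > 0"
  obtains F \<delta> where "finite F" "F \<subseteq> carrier G" "\<delta> > 0"
    "\<And>H s A. finite_index G L a \<gamma> H \<Longrightarrow>
       (\<And>g d. g \<in> carrier G \<Longrightarrow> d \<in> rcosets H \<Longrightarrow> s g d = d #> inv g) \<Longrightarrow>
       A \<subseteq> approx_maps (pointwise_topology (cocycles_on L T i)) tr \<rho> F \<delta> (rcosets H) s \<Longrightarrow>
       finite A \<Longrightarrow> separated \<kappa> (dist_inf \<rho> (rcosets H)) A \<Longrightarrow>
       real (card A) \<le> real (card (fixed_cochains G L a H (cocycles_on L T i :: ('v list \<Rightarrow> 'k) set)))
         * exp (\<eta> * real (card (rcosets H)))"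
proof -
  let ?X = "cocycles_on L T i :: ('v list \<Rightarrow> 'k) set"
  obtain V0 where V0: "finite V0" and "\<forall>x\<in>?X. \<forall>y\<in>?X. (\<forall>b\<in>V0. x b = y b) \<longrightarrow> \<rho> x y < \<kappa>"
    by (rule pseudometric_small_if_agree[OF closedin_cocycles_on \<rho> \<open>\<kappa> > 0\<close>])
  then have close: "\<rho> x y < \<kappa>" if "x \<in> ?X" "y \<in> ?X" "\<forall>b\<in>V0. x b = y b" for x y
    using that by simp
  let ?W = "window (Suc i)"
  define V where "V = (V0 \<inter> ordered_simplices L i) \<union> (\<Union>b\<in>?W. (\<lambda>j. face j b) ` {..Suc i})"
  have V: "finite V" "V \<subseteq> ordered_simplices L i"
  proof -
    have "finite ?W" by (rule finite_window)
    then show "finite V" using V0 by (simp add: V_def)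
    have "face j b \<in> ordered_simplices L i" if "b \<in> ?W" "j \<le> Suc i" for j b
      using face_in_ordered_simplices[OF complex _ that(2)] that(1) window_ordered_simplices by blast
    then show "V \<subseteq> ordered_simplices L i" unfolding V_def by blast
  qed
  obtain E \<kappa>0 where E: "finite E" "E \<subseteq> carrier G" "\<kappa>0 > 0"
    and "\<forall>x\<in>?X. \<forall>y\<in>?X. (\<forall>g\<in>E. \<rho> (tr g x) (tr g y) < \<kappa>0) \<longrightarrow> (\<forall>b\<in>window i. x b = y b)"
    by (rule agree_if_pseudometric_small[OF closedin_cocycles_on \<rho> continuous_map_tr[OF tr_cocycles] finite_window[of i]])
  then have expansive: "\<forall>b\<in>window i. x b = y b"
    if "x \<in> ?X" "y \<in> ?X" "\<forall>g\<in>E. \<rho> (tr g x) (tr g y) < \<kappa>0" for x y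
    using that by simp
  define Q where "Q = CARD('k) ^ card V * CARD('k) ^ card ?W"
  obtain \<epsilon> where \<epsilon>: "\<epsilon> > 0" and small: "\<forall>D :: 'g set set. finite D \<longrightarrow>
       (\<Sum>B | B \<subseteq> D \<and> real (card B) \<le> \<epsilon> * real (card D). real Q ^ card B) \<le> exp (\<eta> * real (card D))"
    by (rule sum_small_subsets_le_exp[OF of_nat_0_le_iff \<open>\<eta> > 0\<close>])
  define C where "C = real (card V) * real (card E) * 2"
  have C: "C \<ge> 0" by (simp add: C_def)
  \<comment> \<open>Solves \<open>\<delta>\<^sup>2 / (\<kappa>0 / 2)\<^sup>2 = \<epsilon> / (C + 1)\<close>, which makes the bound of \<open>card_bad_le\<close> at most \<open>\<epsilon> N\<close>.\<close>
  define \<delta> where "\<delta> = (\<kappa>0 / 2) * sqrt (\<epsilon> / (C + 1))"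
  have \<delta>: "\<delta> > 0" using E(3) \<epsilon> C by (simp add: \<delta>_def)
  have "\<delta>\<^sup>2 = (\<kappa>0 / 2)\<^sup>2 * (sqrt (\<epsilon> / (C + 1)))\<^sup>2"
    unfolding \<delta>_def by (rule power_mult_distrib)
  also have "(sqrt (\<epsilon> / (C + 1)))\<^sup>2 = \<epsilon> / (C + 1)" using \<epsilon> C by (intro real_sqrt_pow2) simp
  finally have "\<delta>\<^sup>2 / (\<kappa>0 / 2)\<^sup>2 = \<epsilon> / (C + 1)" using E(3) by simp
  then have "C * (\<delta>\<^sup>2 / (\<kappa>0 / 2)\<^sup>2) \<le> (C + 1) * (\<epsilon> / (C + 1))"
    using \<epsilon> C by (intro mult_mono) simp_all
  also have "\<dots> = \<epsilon>" using C by simp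
  finally have C\<delta>: "real (card V) * real (card E) * (2 * (\<delta>\<^sup>2 / (\<kappa>0 / 2)\<^sup>2)) \<le> \<epsilon>"
    by (simp only: C_def mult.assoc)
  define F where "F = E \<union> (\<lambda>(g, b). g \<otimes> inv (\<gamma> (set b))) ` (E \<times> V)"
  have "\<gamma> (set b) \<in> carrier G" if "b \<in> V" for b
    using that V(2) ordered_simplicesD \<gamma>_carrier by blast
  then have F: "finite F" "F \<subseteq> carrier G" using E V(1) by (auto simp: F_def)
  show thesis
  proof (rule that[OF F \<delta>])
    fix H s A
    assume "finite_index G L a \<gamma> H"
      and s: "\<And>g d. g \<in> carrier G \<Longrightarrow> d \<in> rcosets H \<Longrightarrow> s g d = d #> inv g"
      and A: "A \<subseteq> approx_maps (pointwise_topology ?X) tr \<rho> F \<delta> (rcosets H) s" "finite A"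
      and sep: "separated \<kappa> (dist_inf \<rho> (rcosets H)) A"
    interpret finite_index G L a \<gamma> H by fact
    let ?N = "real (card D)"
    let ?Fix = "fixed_cochains G L a H ?X"
    define \<B> where "\<B> = {B. B \<subseteq> D \<and> real (card B) \<le> \<epsilon> * ?N}"
    have fin\<B>: "finite \<B>" using finite_index by (simp add: \<B>_def)
    have AX: "\<phi> d \<in> ?X" if "\<phi> \<in> A" "d \<in> D" for \<phi> d
      using that A(1) by (auto simp: approx_maps_def)
    have bad: "bad V \<phi> \<in> \<B>" if "\<phi> \<in> A" for \<phi>
    proof -
      have "real (card (bad V \<phi>)) \<le> real (card V) * real (card E) * (2 * (\<delta>\<^sup>2 / (\<kappa>0 / 2)\<^sup>2)) * ?N"
      proof (rule card_bad_le[OF cocycles_on_subset tr_cocycles \<rho> E expansive V])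
        show "E \<subseteq> F" "\<And>g b. g \<in> E \<Longrightarrow> b \<in> V \<Longrightarrow> g \<otimes> inv \<gamma> (set b) \<in> F"
          unfolding F_def by auto
        show "\<phi> \<in> approx_maps (pointwise_topology ?X) tr \<rho> F \<delta> D s" using that A(1) by blast
      qed (use s \<delta> in auto)
      also have "\<dots> \<le> \<epsilon> * ?N" by (intro mult_right_mono C\<delta>) simp
      finally show ?thesis using bad_subset by (auto simp: \<B>_def)
    qed
    have eq_if_agree: "\<phi> = \<psi>" if \<phi>\<psi>: "\<phi> \<in> A" "\<psi> \<in> A" and agree: "\<And>d b. d \<in> D \<Longrightarrow> b \<in> V \<Longrightarrow> \<phi> d b = \<psi> d b" for \<phi> \<psi>
    proof (rule ccontr)
      assume "\<phi> \<noteq> \<psi>"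
      then have "\<kappa> \<le> dist_inf \<rho> D \<phi> \<psi>" using sep \<phi>\<psi> by (simp add: separated_def)
      moreover have "\<rho> (\<phi> d) (\<psi> d) < \<kappa>" if d: "d \<in> D" for d
      proof (rule close[OF AX AX])
        show "\<forall>b\<in>V0. \<phi> d b = \<psi> d b"
        proof
          fix b assume b: "b \<in> V0"
          show "\<phi> d b = \<psi> d b"
          proof (cases "b \<in> ordered_simplices L i")
            case True then show ?thesis using agree[OF d] b by (simp add: V_def)
          next
            case False
            then show ?thesis
              using cochain_zero[OF cochain[OF AX[OF \<open>\<phi> \<in> A\<close> d]]] cochain_zero[OF cochain[OF AX[OF \<open>\<psi> \<in> A\<close> d]]]
              by simp
          qed
        qed
      qed (use \<phi>\<psi> d in auto)
      then have "dist_inf \<rho> D \<phi> \<psi> < \<kappa>"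
        unfolding dist_inf_def using finite_index card_D_pos by (subst Max_less_iff) (auto simp: card_gt_0_iff)
      ultimately show False by simp
    qed
    have finFix: "finite ?Fix"
      by (rule finite_subset[OF fixed_cochains_mono[OF cocycles_on_subset] finite_fixed_cochains])
    have count: "card {\<phi> \<in> A. bad V \<phi> = B} \<le> Q ^ card B * card ?Fix" if "B \<in> \<B>" for B
      unfolding Q_def
    proof (rule card_with_bad_set_le[OF T_invariant T_simplices V])
      show "face j b \<in> V" if "b \<in> ?W \<inter> T" "j \<le> Suc i" for b j
        using that by (auto simp: V_def)
      show "\<phi> = \<psi>" if "\<phi> \<in> {\<phi> \<in> A. bad V \<phi> = B}" "\<psi> \<in> {\<phi> \<in> A. bad V \<phi> = B}"
        "\<And>d b. d \<in> D \<Longrightarrow> b \<in> V \<Longrightarrow> \<phi> d b = \<psi> d b" for \<phi> \<psi>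
        using that by (intro eq_if_agree) auto
    qed (use that A(2) AX finFix in \<open>auto simp: \<B>_def\<close>)
    have le: "real (card {\<phi> \<in> A. bad V \<phi> = B}) \<le> real Q ^ card B * real (card ?Fix)" if "B \<in> \<B>" for B
      using of_nat_mono[OF count[OF that], where 'a = real] by simp
    have "A = (\<Union>B\<in>\<B>. {\<phi> \<in> A. bad V \<phi> = B})" using bad by blast
    then have "card A \<le> (\<Sum>B\<in>\<B>. card {\<phi> \<in> A. bad V \<phi> = B})"
      using card_UN_le[OF fin\<B>, of "\<lambda>B. {\<phi> \<in> A. bad V \<phi> = B}"] by simp
    from of_nat_mono[OF this, where 'a = real]
    have "real (card A) \<le> (\<Sum>B\<in>\<B>. real (card {\<phi> \<in> A. bad V \<phi> = B}))"
      by (simp only: of_nat_sum)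
    also have "\<dots> \<le> (\<Sum>B\<in>\<B>. real Q ^ card B * real (card ?Fix))" by (intro sum_mono le)
    also have "\<dots> = (\<Sum>B\<in>\<B>. real Q ^ card B) * real (card ?Fix)" by (simp add: sum_distrib_right)
    also have "\<dots> \<le> exp (\<eta> * ?N) * real (card ?Fix)"
      using small finite_index by (intro mult_right_mono) (simp_all add: \<B>_def)
    finally show "real (card A) \<le> real (card ?Fix) * exp (\<eta> * ?N)" by (simp add: mult.commute)
  qed
qed

text \<open>The two preceding lemmas bound the separation numbers from both sides uniformly in \<open>n\<close>; the factor
  \<open>exp (\<eta> N)\<close> contributes \<open>\<eta>\<close> to the growth rate, and \<open>\<eta>\<close> is arbitrary.\<close>
theorem sofic_entropy_eq_periodic_growth:
  fixes \<rho> :: "('v list \<Rightarrow> 'k :: {field, finite}) \<Rightarrow> ('v list \<Rightarrow> 'k) \<Rightarrow> real"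
  assumes \<rho>: "generating_pseudometric G (pointwise_topology (cocycles_on L T i)) tr \<rho>"
    and \<Gamma>: "\<And>n. finite_index G L a \<gamma> (\<Gamma> n)"
  shows "sofic_entropy G (coset_space G \<Gamma>) (chain_approximation G \<Gamma>)
           (pointwise_topology (cocycles_on L T i)) tr \<rho>
    = limsup (\<lambda>n. ereal (ln (real (card (fixed_cochains G L a (\<Gamma> n) (cocycles_on L T i :: ('v list \<Rightarrow> 'k) set))))
        / real (card (rcosets (\<Gamma> n)))))"
    (is "?h = limsup ?c")
proof (rule antisym)
  let ?X = "cocycles_on L T i :: ('v list \<Rightarrow> 'k) set"
  let ?Fix = "\<lambda>n. fixed_cochains G L a (\<Gamma> n) ?X"
  let ?N = "\<lambda>n. real (card (rcosets (\<Gamma> n)))"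
  let ?S = "\<lambda>\<kappa> \<delta> F n. separation_number \<kappa>
      (approx_maps (pointwise_topology ?X) tr \<rho> F \<delta> (coset_space G \<Gamma> n) (chain_approximation G \<Gamma> n))
      (dist_inf \<rho> (coset_space G \<Gamma> n))"
  have s: "chain_approximation G \<Gamma> n g d = d #> inv g" if "d \<in> rcosets (\<Gamma> n)" for n g d
    using that by (simp add: chain_approximation_def coset_space_def)
  have N: "?N n > 0" for n using finite_index.card_D_pos[OF \<Gamma>] by simp
  have Fix: "card (?Fix n) > 0" for n
  proof -
    have "finite (?Fix n)"
      by (rule finite_subset[OF fixed_cochains_mono[OF cocycles_on_subset] finite_index.finite_fixed_cochains[OF \<Gamma>]])
    moreover have "(\<lambda>_. 0) \<in> ?Fix n"
      using linear_setD(1)[OF finite_index.linear_set_fixed[OF \<Gamma> linear_set_cocycles_on]] .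
    ultimately show ?thesis by (auto simp: card_gt_0_iff)
  qed
  show "?h \<le> limsup ?c"
    unfolding sofic_entropy_def
  proof (rule SUP_least)
    fix \<kappa> :: real assume "\<kappa> \<in> {0<..}"
    then have \<kappa>: "\<kappa> > 0" by simp
    show "(INF \<delta>\<in>{0<..}. INF F\<in>{F. finite F \<and> F \<subseteq> carrier G}.
        limsup (\<lambda>n. log_enat (?S \<kappa> \<delta> F n) / ereal (real (card (coset_space G \<Gamma> n))))) \<le> limsup ?c"
    proof (rule ereal_le_epsilon2)
      fix \<eta> :: real assume \<eta>: "0 < \<eta>"
      show "(INF \<delta>\<in>{0<..}. INF F\<in>{F. finite F \<and> F \<subseteq> carrier G}.
        limsup (\<lambda>n. log_enat (?S \<kappa> \<delta> F n) / ereal (real (card (coset_space G \<Gamma> n))))) \<le> limsup ?c + ereal \<eta>"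
      proof (rule card_separated_approx_maps_le[OF \<rho> \<kappa> \<eta>])
        fix F \<delta> assume F: "finite F" "F \<subseteq> carrier G" "(\<delta> :: real) > 0"
          and le: "\<And>H s A. finite_index G L a \<gamma> H \<Longrightarrow>
             (\<And>g d. g \<in> carrier G \<Longrightarrow> d \<in> rcosets H \<Longrightarrow> s g d = d #> inv g) \<Longrightarrow>
             A \<subseteq> approx_maps (pointwise_topology ?X) tr \<rho> F \<delta> (rcosets H) s \<Longrightarrow>
             finite A \<Longrightarrow> separated \<kappa> (dist_inf \<rho> (rcosets H)) A \<Longrightarrow>
             real (card A) \<le> real (card (fixed_cochains G L a H ?X)) * exp (\<eta> * real (card (rcosets H)))"
        have "log_enat (?S \<kappa> \<delta> F n) / ereal (real (card (coset_space G \<Gamma> n))) \<le> ?c n + ereal \<eta>" for n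
        proof -
          let ?r = "real (card (?Fix n)) * exp (\<eta> * ?N n)"
          have "1 * 1 \<le> ?r" using Fix[of n] \<eta> by (intro mult_mono) auto
          then have "log_enat (?S \<kappa> \<delta> F n) \<le> ereal (ln ?r)"
            unfolding coset_space_def
            by (intro log_separation_number_le le[of "\<Gamma> n" "chain_approximation G \<Gamma> n", OF \<Gamma>]) (simp_all add: s)
          also have "ln ?r = ln (real (card (?Fix n))) + \<eta> * ?N n"
            using Fix[of n] by (simp add: ln_mult)
          finally have "log_enat (?S \<kappa> \<delta> F n) / ereal (?N n)
              \<le> ereal (ln (real (card (?Fix n))) + \<eta> * ?N n) / ereal (?N n)"
            using N by (intro ereal_divide_right_mono) auto
          also have "\<dots> = ?c n + ereal \<eta>" using N[of n] by (simp add: add_divide_distrib)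
          finally show ?thesis by (simp add: coset_space_def)
        qed
        then have "limsup (\<lambda>n. log_enat (?S \<kappa> \<delta> F n) / ereal (real (card (coset_space G \<Gamma> n))))
            \<le> limsup (\<lambda>n. ?c n + ereal \<eta>)"
          by (intro Limsup_mono) simp
        also have "\<dots> = limsup ?c + ereal \<eta>" by (intro Limsup_add_ereal_right) auto
        finally show "(INF \<delta>\<in>{0<..}. INF F\<in>{F. finite F \<and> F \<subseteq> carrier G}.
          limsup (\<lambda>n. log_enat (?S \<kappa> \<delta> F n) / ereal (real (card (coset_space G \<Gamma> n))))) \<le> limsup ?c + ereal \<eta>"
          using F by (intro INF_lower2[of \<delta>] INF_lower2[of F]) auto
      qed
    qed
  qed
  show "limsup ?c \<le> ?h"
    unfolding sofic_entropy_def
  proof (rule separated_periodic_orbit_maps[OF \<rho>], rule SUP_upper2)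
    fix \<kappa> :: real assume \<kappa>: "\<kappa> > 0" and ex: "\<And>H s F \<delta>. finite_index G L a \<gamma> H \<Longrightarrow> F \<subseteq> carrier G \<Longrightarrow> \<delta> > 0 \<Longrightarrow>
       (\<And>g d. g \<in> carrier G \<Longrightarrow> d \<in> rcosets H \<Longrightarrow> s g d = d #> inv g) \<Longrightarrow>
       \<exists>A \<subseteq> approx_maps (pointwise_topology ?X) tr \<rho> F \<delta> (rcosets H) s.
         finite A \<and> separated \<kappa> (dist_inf \<rho> (rcosets H)) A \<and> card A = card (fixed_cochains G L a H ?X)"
    show "\<kappa> \<in> {0<..}" using \<kappa> by simp
    show "limsup ?c \<le> (INF \<delta>\<in>{0<..}. INF F\<in>{F. finite F \<and> F \<subseteq> carrier G}.
        limsup (\<lambda>n. log_enat (?S \<kappa> \<delta> F n) / ereal (real (card (coset_space G \<Gamma> n)))))"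
    proof (intro INF_greatest Limsup_mono always_eventually allI)
      fix \<delta> F n assume \<delta>: "(\<delta> :: real) \<in> {0<..}" and F: "F \<in> {F. finite F \<and> F \<subseteq> carrier G}"
      obtain A where A: "A \<subseteq> approx_maps (pointwise_topology ?X) tr \<rho> F \<delta> (rcosets (\<Gamma> n)) (chain_approximation G \<Gamma> n)"
        "finite A" "separated \<kappa> (dist_inf \<rho> (rcosets (\<Gamma> n))) A" "card A = card (?Fix n)"
        using ex[OF \<Gamma>, of F \<delta> n "chain_approximation G \<Gamma> n"] s F \<delta> by auto
      have "ereal (ln (real (card (?Fix n)))) \<le> log_enat (?S \<kappa> \<delta> F n)"
        using log_separation_number_ge[OF A(1-3)] A(4) Fix[of n] by (simp add: coset_space_def)
      then have "ereal (ln (real (card (?Fix n)))) / ereal (?N n) \<le> log_enat (?S \<kappa> \<delta> F n) / ereal (?N n)"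
        using N by (intro ereal_divide_right_mono) auto
      then show "?c n \<le> log_enat (?S \<kappa> \<delta> F n) / ereal (real (card (coset_space G \<Gamma> n)))"
        using N[of n] by (simp add: coset_space_def)
    qed
  qed
qed

end

section \<open>The cohomological identity\<close>

lemma card_eq_card_image_mult_card_kernel:
  fixes S :: "('v list \<Rightarrow> 'k :: field) set"
  assumes S: "linear_set S" "finite S"
  shows "card S = card (coboundary L i ` S) * card {c \<in> S. coboundary L i c = (\<lambda>_. 0)}"
proof -
  let ?\<delta> = "coboundary L i" and ?K = "{c \<in> S. coboundary L i c = (\<lambda>_. 0)}"
  have fibre: "card {c \<in> S. ?\<delta> c = y} = card ?K" if y: "y \<in> ?\<delta> ` S" for y
  proof -
    obtain c0 where c0: "c0 \<in> S" "y = ?\<delta> c0" using y by blast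
    have "bij_betw (\<lambda>c v. c v - c0 v) {c \<in> S. ?\<delta> c = y} ?K"
    proof (rule bij_betw_byWitness[where f' = "\<lambda>c v. c v + c0 v"])
      show "(\<lambda>c v. c v - c0 v) ` {c \<in> S. ?\<delta> c = y} \<subseteq> ?K"
        using linear_set_diff[OF S(1) _ c0(1)] by (auto simp: coboundary_diff c0(2))
      show "(\<lambda>c v. c v + c0 v) ` ?K \<subseteq> {c \<in> S. ?\<delta> c = y}"
        using linear_setD(2)[OF S(1) _ c0(1)] by (auto simp: coboundary_add c0(2))
    qed auto
    then show ?thesis by (rule bij_betw_same_card)
  qed
  have "card S = (\<Sum>y\<in>?\<delta> ` S. card {c \<in> S. ?\<delta> c = y})"
    using sum.image_gen[OF S(2), of "\<lambda>_. 1 :: nat" ?\<delta>] by simp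
  also have "\<dots> = (\<Sum>y\<in>?\<delta> ` S. card ?K)" by (rule sum.cong) (simp_all add: fibre)
  finally show ?thesis by simp
qed

lemma linear_set_coboundary_image:
  assumes "linear_set S" shows "linear_set (coboundary L i ` S)"
  unfolding linear_set_def
proof (intro conjI ballI allI)
  show "(\<lambda>_. 0) \<in> coboundary L i ` S"
    using linear_setD(1)[OF assms] by (intro image_eqI[of _ _ "\<lambda>_. 0"]) (simp_all add: coboundary_zero)
  show "(\<lambda>x. c x + d x) \<in> coboundary L i ` S" if c: "c \<in> coboundary L i ` S" and d: "d \<in> coboundary L i ` S" for c d
  proof -
    obtain c' d' where "c' \<in> S" "d' \<in> S" "c = coboundary L i c'" "d = coboundary L i d'" using c d by blast
    then show ?thesis
      using linear_setD(2)[OF assms, of c' d'] by (intro image_eqI[of _ _ "\<lambda>x. c' x + d' x"]) (simp_all add: coboundary_add)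
  qed
  show "(\<lambda>x. r * c x) \<in> coboundary L i ` S" if c: "c \<in> coboundary L i ` S" for c r
  proof -
    obtain c' where "c' \<in> S" "c = coboundary L i c'" using c by blast
    then show ?thesis
      using linear_setD(3)[OF assms, of c'] by (intro image_eqI[of _ _ "\<lambda>x. r * c' x"]) (simp_all add: coboundary_smult)
  qed
qed

lemma cochains_eq_cocycles_on: "cochains L i = cocycles_on L {} i"
  by (simp add: cocycles_on_def)

lemma coboundary_kernel_eq_cocycles_on:
  "coboundary_kernel L (Suc i) = cocycles_on L (ordered_simplices L (Suc i)) i"
  by (auto simp: coboundary_kernel_def cocycles_on_def coboundary_eq fun_eq_iff)

lemma quotient_cochains_eq_fixed: "quotient_cochains G L a H i = fixed_cochains G L a H (cochains L i)"
  by (simp add: quotient_cochains_def fixed_cochains_def)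

lemma quotient_coboundary_kernel_eq_fixed:
  "quotient_coboundary_kernel G L a H (Suc i) = fixed_cochains G L a H (coboundary_kernel L (Suc i))"
  by (auto simp: quotient_coboundary_kernel_def quotient_cochains_def fixed_cochains_def coboundary_kernel_def)

text \<open>Both \<open>|Z| = |H\<^bsup>p\<^esup>| |B|\<close> and \<open>|C| = |B| |K|\<close> hold for the space \<open>B\<close> of coboundaries; eliminating \<open>|B|\<close>
  leaves the Euler characteristic relation in multiplicative form.\<close>
lemma (in finite_index) card_quotient_cochains_mult_card_kernel:
  fixes q :: nat and C K Z :: "('v list \<Rightarrow> 'k :: {field, finite}) set"
  defines "C \<equiv> quotient_cochains G L a H q" and "K \<equiv> quotient_coboundary_kernel G L a H (Suc q)"
    and "Z \<equiv> quotient_coboundary_kernel G L a H (Suc (Suc q))"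
  shows "card Z * card K =
           CARD('k) ^ vectorspace.dim (class_ring :: 'k ring) (quotient_cohomology G L a H (Suc q)) * card C"
    and "card Z > 0" and "card K > 0" and "card C > 0"
proof -
  have linC: "linear_set C" unfolding C_def quotient_cochains_eq_fixed
    by (rule linear_set_fixed[OF linear_set_cochains])
  have finC: "finite C" unfolding C_def quotient_cochains_eq_fixed by (rule finite_fixed_cochains)
  have K: "K = {c \<in> C. coboundary L (Suc q) c = (\<lambda>_. 0)}"
    by (simp add: K_def C_def quotient_coboundary_kernel_def)
  have linZ: "linear_set Z" unfolding Z_def quotient_coboundary_kernel_eq_fixed coboundary_kernel_eq_cocycles_on
    by (rule linear_set_fixed[OF linear_set_cocycles_on])
  have finZ: "finite Z" unfolding Z_def quotient_coboundary_kernel_eq_fixed coboundary_kernel_eq_cocycles_on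
    by (rule finite_subset[OF fixed_cochains_mono[OF cocycles_on_subset] finite_fixed_cochains])
  let ?B = "coboundary L (Suc q) ` C"
  have "?B \<subseteq> Z"
  proof (rule image_subsetI)
    fix c assume c: "c \<in> C"
    then have "c \<in> cochains L q" by (simp add: C_def quotient_cochains_def)
    then have "coboundary L (Suc q) c \<in> cochains L (Suc q)" by (rule coboundary_in_cochains[OF complex])
    moreover have "tr h (coboundary L (Suc q) c) = coboundary L (Suc q) c" if "h \<in> H" for h
      using c that H_carrier coboundary_tr[of h q c] by (auto simp: C_def quotient_cochains_def)
    ultimately show "coboundary L (Suc q) c \<in> Z"
      by (simp add: Z_def quotient_coboundary_kernel_def quotient_cochains_def coboundary_coboundary[OF complex])
  qed
  then have "card Z = CARD('k) ^ vectorspace.dim (class_ring :: 'k ring) (quotient_module (function_space Z) ?B) * card ?B"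
    by (intro card_quotient_function_space linZ finZ linear_set_coboundary_image linC)
  moreover have "quotient_module (function_space Z) ?B = quotient_cohomology G L a H (Suc q)"
    by (simp add: quotient_cohomology_def Z_def C_def quotient_coboundary_image_def)
  moreover have "card C = card ?B * card K"
    unfolding K by (rule card_eq_card_image_mult_card_kernel[OF linC finC])
  ultimately show "card Z * card K =
      CARD('k) ^ vectorspace.dim (class_ring :: 'k ring) (quotient_cohomology G L a H (Suc q)) * card C"
    by simp
  have "(\<lambda>_. 0) \<in> K" using linear_setD(1)[OF linC] by (simp add: K coboundary_zero)
  then show "card K > 0" using finC by (auto simp: K card_gt_0_iff)
  show "card Z > 0" using linear_setD(1)[OF linZ] finZ by (auto simp: card_gt_0_iff)
  show "card C > 0" using linear_setD(1)[OF linC] finC by (auto simp: card_gt_0_iff)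
qed

lemma sofic_chain_finite_index:
  assumes "equivariant_section G L a \<gamma>" "sofic_chain G \<Gamma>"
  shows "finite_index G L a \<gamma> (\<Gamma> n)"
  using assms by (auto simp: finite_index_def finite_index_axioms_def sofic_chain_def)

theorem corollary5p4:
  fixes G :: "('g, 'm) monoid_scheme"
    and \<Gamma> :: "nat \<Rightarrow> 'g set"
    and L :: "'v set set"
    and a :: "'g \<Rightarrow> 'v \<Rightarrow> 'v"
    and p :: nat
    and \<rho>C \<rho>K \<rho>Z :: "('v list \<Rightarrow> 'k :: {field, finite}) \<Rightarrow> ('v list \<Rightarrow> 'k) \<Rightarrow> real"
  assumes "group G" and "countable (carrier G)" and "residually_finite G"
    and "sofic_chain G \<Gamma>"
    and "abstract_simplicial_complex L"
    and "simplicial_action G L a" and "free_action G L a" and "cocompact_action G L a"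
    and "p \<ge> 1"
    and "convergent (\<lambda>n.
           ln (real (card (quotient_coboundary_kernel G L a (\<Gamma> n) p :: ('v list \<Rightarrow> 'k) set)))
           / real (card (rcosets\<^bsub>G\<^esub> (\<Gamma> n))))"
    and "generating_pseudometric G (pointwise_topology (cochains L (p - 1)))
           (cochain_action G L a) \<rho>C"
    and "generating_pseudometric G (pointwise_topology (coboundary_kernel L p))
           (cochain_action G L a) \<rho>K"
    and "generating_pseudometric G (pointwise_topology (coboundary_kernel L (p + 1)))
           (cochain_action G L a) \<rho>Z"
  shows "sofic_entropy G (coset_space G \<Gamma>) (chain_approximation G \<Gamma>)
           (pointwise_topology (cochains L (p - 1))) (cochain_action G L a) \<rho>C
         + limsup (\<lambda>n. ereal
             (real (vectorspace.dim (class_ring :: 'k ring) (quotient_cohomology G L a (\<Gamma> n) p))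
              / real (card (rcosets\<^bsub>G\<^esub> (\<Gamma> n)))))
           * ereal (ln (real CARD('k)))
       = sofic_entropy G (coset_space G \<Gamma>) (chain_approximation G \<Gamma>)
           (pointwise_topology (coboundary_kernel L p)) (cochain_action G L a) \<rho>K
         + sofic_entropy G (coset_space G \<Gamma>) (chain_approximation G \<Gamma>)
           (pointwise_topology (coboundary_kernel L (p + 1))) (cochain_action G L a) \<rho>Z"
proof -
  obtain q where p: "p = Suc q" using \<open>p \<ge> 1\<close> by (cases p) auto
  interpret simplicial_G_complex G L a using assms by unfold_locales
  obtain \<gamma> where \<gamma>: "\<forall>s\<in>L. \<gamma> s \<in> carrier G"
    "\<forall>g\<in>carrier G. \<forall>s\<in>L. \<gamma> (a g ` s) = g \<otimes>\<^bsub>G\<^esub> \<gamma> s" "finite {s \<in> L. \<gamma> s = \<one>\<^bsub>G\<^esub>}"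
    by (rule equivariant_map_to_group_exists[OF \<open>free_action G L a\<close> \<open>cocompact_action G L a\<close>])
  interpret equivariant_section G L a \<gamma> using \<gamma> by unfold_locales auto
  have fi: "finite_index G L a \<gamma> (\<Gamma> n)" for n
    by (rule sofic_chain_finite_index[OF equivariant_section_axioms \<open>sofic_chain G \<Gamma>\<close>])
  let ?C = "\<lambda>n. quotient_cochains G L a (\<Gamma> n) q :: ('v list \<Rightarrow> 'k) set"
  let ?K = "\<lambda>n. quotient_coboundary_kernel G L a (\<Gamma> n) (Suc q) :: ('v list \<Rightarrow> 'k) set"
  let ?Z = "\<lambda>n. quotient_coboundary_kernel G L a (\<Gamma> n) (Suc (Suc q)) :: ('v list \<Rightarrow> 'k) set"
  let ?dim = "\<lambda>n. real (vectorspace.dim (class_ring :: 'k ring) (quotient_cohomology G L a (\<Gamma> n) (Suc q)))"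
  let ?N = "\<lambda>n. real (card (rcosets\<^bsub>G\<^esub> (\<Gamma> n)))"
  let ?h = "\<lambda>X \<rho>. sofic_entropy G (coset_space G \<Gamma>) (chain_approximation G \<Gamma>)
              (pointwise_topology X) (cochain_action G L a) \<rho>"
  have N: "?N n > 0" for n using finite_index.card_D_pos[OF fi] by simp
  have simplices: "map (a g) vs \<in> ordered_simplices L i"
    if "g \<in> carrier G" "vs \<in> ordered_simplices L i" for g vs i
    using that by (rule map_act_ordered_simplices)
  interpret C: cocycle_shift G L a \<gamma> q "{}" by unfold_locales auto
  interpret K: cocycle_shift G L a \<gamma> q "ordered_simplices L (Suc q)" by unfold_locales (auto intro: simplices simp del: set_map)
  interpret Z: cocycle_shift G L a \<gamma> "Suc q" "ordered_simplices L (Suc (Suc q))"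
    by unfold_locales (auto intro: simplices)
  have hC: "?h (cochains L q) \<rho>C = limsup (\<lambda>n. ereal (ln (real (card (?C n))) / ?N n))"
    using C.sofic_entropy_eq_periodic_growth[OF _ fi, of \<rho>C] assms
    by (simp add: p quotient_cochains_eq_fixed cochains_eq_cocycles_on)
  have hK: "?h (coboundary_kernel L (Suc q)) \<rho>K = limsup (\<lambda>n. ereal (ln (real (card (?K n))) / ?N n))"
    using K.sofic_entropy_eq_periodic_growth[OF _ fi, of \<rho>K] assms
    by (simp add: p quotient_coboundary_kernel_eq_fixed coboundary_kernel_eq_cocycles_on)
  have hZ: "?h (coboundary_kernel L (Suc (Suc q))) \<rho>Z = limsup (\<lambda>n. ereal (ln (real (card (?Z n))) / ?N n))"
    using Z.sofic_entropy_eq_periodic_growth[OF _ fi, of \<rho>Z] assms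
    by (simp add: p quotient_coboundary_kernel_eq_fixed coboundary_kernel_eq_cocycles_on)
  define c where "c = ln (real (card (window_cochains q :: ('v list \<Rightarrow> 'k) set)))"
  have C: "ln (real (card (?C n))) / ?N n = c" for n
  proof -
    have "card (?C n) = card (window_cochains q :: ('v list \<Rightarrow> 'k) set) ^ card (rcosets\<^bsub>G\<^esub> (\<Gamma> n))"
      using finite_index.card_fixed_cochains[OF fi] by (simp add: quotient_cochains_eq_fixed)
    then show ?thesis using N[of n] by (simp add: c_def ln_realpow)
  qed
  obtain k where k: "(\<lambda>n. ln (real (card (?K n))) / ?N n) \<longlonglongrightarrow> k"
    using assms(10) by (auto simp: p convergent_def)
  have growth: "?dim n / ?N n * ln (real CARD('k))
      = (ln (real (card (?K n))) / ?N n - c) + ln (real (card (?Z n))) / ?N n" for n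
  proof -
    note card = finite_index.card_quotient_cochains_mult_card_kernel[OF fi[of n], of q, where 'k = 'k]
    have "real (card (?Z n)) * real (card (?K n)) = real CARD('k) ^ vectorspace.dim (class_ring :: 'k ring)
        (quotient_cohomology G L a (\<Gamma> n) (Suc q)) * real (card (?C n))"
      using arg_cong[OF card(1), of real] by simp
    from arg_cong[OF this, of ln]
    have "ln (real (card (?Z n))) + ln (real (card (?K n))) = ?dim n * ln (real CARD('k)) + ln (real (card (?C n)))"
      using card(2-4) by (simp add: ln_mult ln_realpow)
    then have "?dim n * ln (real CARD('k))
        = ln (real (card (?K n))) - ln (real (card (?C n))) + ln (real (card (?Z n)))" by simp
    then show ?thesis using C[of n] by (simp add: add_divide_distrib diff_divide_distrib)
  qed
  have "limsup (\<lambda>n. ereal (?dim n / ?N n)) * ereal (ln (real CARD('k)))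
      = limsup (\<lambda>n. ereal (?dim n / ?N n) * ereal (ln (real CARD('k))))"
    by (rule limsup_ereal_mult_right[symmetric]) (simp add: Suc_leI)
  also have "\<dots> = limsup (\<lambda>n. ereal (ln (real (card (?K n))) / ?N n - c) + ereal (ln (real (card (?Z n))) / ?N n))"
    by (simp only: times_ereal.simps plus_ereal.simps growth)
  also have "\<dots> = ereal (k - c) + limsup (\<lambda>n. ereal (ln (real (card (?Z n))) / ?N n))"
    by (rule ereal_limsup_lim_add) (auto intro!: tendsto_intros k)
  finally have cohomology: "limsup (\<lambda>n. ereal (?dim n / ?N n)) * ereal (ln (real CARD('k)))
      = ereal (k - c) + ?h (coboundary_kernel L (Suc (Suc q))) \<rho>Z"
    by (simp only: hZ)
  have "?h (cochains L q) \<rho>C = ereal c" by (simp add: hC C Limsup_const)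
  moreover have "?h (coboundary_kernel L (Suc q)) \<rho>K = ereal k"
    unfolding hK by (rule lim_imp_Limsup) (auto intro!: tendsto_intros k)
  ultimately show ?thesis
    by (simp add: p cohomology add.assoc [symmetric])
qed

end
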